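(* Let $q\ge2$, let $M_1,\dots,M_q:\mathbb{S}^1\to\mathrm{SL}_n(\mathbb{C})$ be analytic maps, and suppose for some $i,j\in\{1,\dots,q\}$ that $M_i$ and $M_j$ are irreducible except at a finite subset of $\mathbb{S}^1$. Then the following are equivalent: (i) $M_1,\dots,M_q$ are simultaneously $r$-unitarizable for some $r\in(0,1)$. (ii) $M_1,\dots,M_q$ are pointwise simultaneously unitarizable on $\mathbb{S}^1$ minus a finite subset. Moreover, $r$-unitarizers are unique in the following sense: if $V_1:\mathcal{A}_{r_1,1}\to\mathrm{SL}_n(\mathbb{C})$ and $V_2:\mathcal{A}_{r_2,1}\to\mathrm{SL}_n(\mathbb{C})$ are respective $r_1$- and $r_2$-unitarizers, then $V_2V_1^{-1}$ extends holomorphically to $\mathbb{S}^1$ and its restriction to $\mathbb{S}^1$ is an analytic map $\mathbb{S}^1\to\mathrm{SU}_n$.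
   Context: $\mathbb{S}^1=\{\lambda\in\mathbb{C}:|\lambda|=1\}$ and, for $0<r<s$, $\mathcal{A}_{r,s}=\{\lambda\in\mathbb{C}:r<|\lambda|<s\}$. "Analytic" on $\mathbb{S}^1$ means real analytic. Two matrices $A,B\in M_{n\times n}(\mathbb{C})$ are reducible if there is a proper nonzero subspace $W\subset\mathbb{C}^n$ with $AW\subset W$ and $BW\subset W$, and irreducible otherwise; for maps this is understood pointwise. The maps are pointwise simultaneously unitarizable at $p$ if there is a matrix $V\in\mathrm{SL}_n(\mathbb{C})$ with $VM_k(p)V^{-1}\in\mathrm{SU}_n$ for all $k$. Simultaneous $r$-unitarizability: let $r\in(0,1)$ and suppose $M_1,\dots,M_q$ extend holomorphically to respective holomorphic maps $\widetilde M_1,\dots,\widetilde M_q:\mathcal{A}_{r,1}\to\mathrm{SL}_n(\mathbb{C})$. Then $M_1,\dots,M_q$ are simultaneously $r$-unitarizable if there exists a holomorphic map $V:\mathcal{A}_{r,1}\to\mathrm{SL}_n(\mathbb{C})$ (an $r$-unitarizer) which extends holomorphically to $\mathbb{S}^1$ minus a finite subset, such that $V\widetilde M_1V^{-1},\dots,V\widetilde M_qV^{-1}$ extend holomorphically to $\mathbb{S}^1$ and their respective restrictions to $\mathbb{S}^1$ are analytic maps $\mathbb{S}^1\to\mathrm{SU}_n$. *)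

theory Defs
  imports "HOL-Analysis.Analysis"
begin

definition annulus :: "real \<Rightarrow> real \<Rightarrow> complex set" where
  "annulus r s = {z. r < cmod z \<and> cmod z < s}"

abbreviation circle :: "complex set" where
  "circle \<equiv> sphere 0 1"

definition SL :: "(complex^'n^'n) set" where
  "SL = {A. det A = 1}"

definition ctranspose :: "complex^'n^'n \<Rightarrow> complex^'n^'n" where
  "ctranspose A = (\<chi> i j. cnj (A $ j $ i))"

definition SU :: "(complex^'n^'n) set" where
  "SU = {A. A ** ctranspose A = mat 1 \<and> ctranspose A ** A = mat 1 \<and> det A = 1}"

definition reducible_pair :: "complex^'n^'n \<Rightarrow> complex^'n^'n \<Rightarrow> bool" where
  "reducible_pair A B \<longleftrightarrow>
     (\<exists>W. vec.subspace W \<and> W \<noteq> {0} \<and> W \<noteq> UNIV \<and>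
          (*v) A ` W \<subseteq> W \<and> (*v) B ` W \<subseteq> W)"

definition pointwise_unitarizable_at ::
    "nat \<Rightarrow> (nat \<Rightarrow> complex \<Rightarrow> complex^'n^'n) \<Rightarrow> complex \<Rightarrow> bool" where
  "pointwise_unitarizable_at q M p \<longleftrightarrow>
     (\<exists>V\<in>SL. \<forall>k\<in>{1..q}. V ** M k p ** matrix_inv V \<in> SU)"

definition real_analytic_at :: "(real \<Rightarrow> complex) \<Rightarrow> real \<Rightarrow> bool" where
  "real_analytic_at f t0 \<longleftrightarrow>
     (\<exists>c e. e > 0 \<and>
        (\<forall>t. \<bar>t - t0\<bar> < e \<longrightarrow> (\<lambda>m. c m * of_real (t - t0) ^ m) sums f t))"

text \<open>Real analyticity on the unit circle, regarded as a real analytic manifold with the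
  angle as local coordinate; matrix-valued maps are treated entrywise.\<close>

definition circle_analytic :: "(complex \<Rightarrow> complex^'n^'n) \<Rightarrow> bool" where
  "circle_analytic F \<longleftrightarrow>
     (\<forall>i j t. real_analytic_at (\<lambda>t. F (cis t) $ i $ j) t)"

definition mat_holomorphic_on ::
    "(complex \<Rightarrow> complex^'n^'n) \<Rightarrow> complex set \<Rightarrow> bool" where
  "mat_holomorphic_on F S \<longleftrightarrow> (\<forall>i j. (\<lambda>z. F z $ i $ j) holomorphic_on S)"

definition mat_analytic_on ::
    "(complex \<Rightarrow> complex^'n^'n) \<Rightarrow> complex set \<Rightarrow> bool" where
  "mat_analytic_on F S \<longleftrightarrow> (\<forall>i j. (\<lambda>z. F z $ i $ j) analytic_on S)"

text \<open>The map \<open>F\<close>, given on \<open>A\<close>, extends holomorphically to the further set \<open>E\<close>, with \<open>G\<close> as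
  the extension. Here \<open>E\<close> is a subset of the boundary circle of the annulus \<open>A\<close>, so \<open>G\<close> has to
  be holomorphic on an open neighbourhood of \<open>A \<union> E\<close>, which is the meaning of
  \<open>analytic_on\<close>.\<close>

definition holomorphic_extension ::
    "complex set \<Rightarrow> (complex \<Rightarrow> complex^'n^'n) \<Rightarrow> complex set \<Rightarrow>
     (complex \<Rightarrow> complex^'n^'n) \<Rightarrow> bool" where
  "holomorphic_extension A F E G \<longleftrightarrow>
     mat_analytic_on G (A \<union> E) \<and> (\<forall>z\<in>A. G z = F z)"

text \<open>The map \<open>M\<close> on the circle extends holomorphically to the map
  \<open>Mt : annulus r 1 \<rightarrow> SL\<close>: the two are restrictions of one holomorphic map.\<close>

definition extends_to_annulus ::
    "real \<Rightarrow> (complex \<Rightarrow> complex^'n^'n) \<Rightarrow> (complex \<Rightarrow> complex^'n^'n) \<Rightarrow> bool" where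
  "extends_to_annulus r M Mt \<longleftrightarrow>
     mat_holomorphic_on Mt (annulus r 1) \<and> Mt ` annulus r 1 \<subseteq> SL \<and>
     (\<exists>G. holomorphic_extension (annulus r 1) Mt circle G \<and> (\<forall>z\<in>circle. G z = M z))"

definition extends_to_SU_on_circle ::
    "real \<Rightarrow> (complex \<Rightarrow> complex^'n^'n) \<Rightarrow> bool" where
  "extends_to_SU_on_circle r F \<longleftrightarrow>
     (\<exists>G. holomorphic_extension (annulus r 1) F circle G \<and>
          circle_analytic G \<and> G ` circle \<subseteq> SU)"

text \<open>The extensions \<open>Mt k\<close> are determined by \<open>M k\<close> on \<open>annulus r 1\<close>, so quantifying over them
  existentially involves no choice.\<close>

definition unitarizer ::
    "real \<Rightarrow> nat \<Rightarrow> (nat \<Rightarrow> complex \<Rightarrow> complex^'n^'n) \<Rightarrow> (complex \<Rightarrow> complex^'n^'n) \<Rightarrow> bool" where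
  "unitarizer r q M V \<longleftrightarrow>
     0 < r \<and> r < 1 \<and>
     mat_holomorphic_on V (annulus r 1) \<and> V ` annulus r 1 \<subseteq> SL \<and>
     (\<exists>F W. finite F \<and> F \<subseteq> circle \<and> holomorphic_extension (annulus r 1) V (circle - F) W) \<and>
     (\<exists>Mt. \<forall>k\<in>{1..q}.
        extends_to_annulus r (M k) (Mt k) \<and>
        extends_to_SU_on_circle r (\<lambda>z. V z ** Mt k z ** matrix_inv (V z)))"

definition simultaneously_unitarizable ::
    "real \<Rightarrow> nat \<Rightarrow> (nat \<Rightarrow> complex \<Rightarrow> complex^'n^'n) \<Rightarrow> bool" where
  "simultaneously_unitarizable r q M \<longleftrightarrow> (\<exists>V. unitarizer r q M V)"

end

theory Submission
  imports Defs "HOL-Complex_Analysis.Complex_Analysis"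
begin

text \<open>
  At a single point, a unitarizer \<open>V\<close> amounts, up to a unitary left factor, to a Hermitian form: the matrix
  \<open>X = V\<^sup>* V\<close> is positive definite, and \<open>V M V\<inverse>\<close> is unitary for every \<open>M = M k\<close> if and only if
  \<open>M\<^sup>* X M = X\<close>. These equations are linear in \<open>X\<close>, and where two of the maps are irreducible,
  Schur's lemma leaves a solution space of dimension at most one. The theorem follows by letting the point of the circle vary.

  For existence, reflection in the circle, \<open>f\<^sup>#(z) = cnj (f (1 / cnj z))\<close>, turns the coefficients of
  the equations into functions that are analytic near the circle. The solution with one diagonal
  entry equal to 1 is therefore meromorphic near the circle (\<open>meromorphic_intertwiner\<close>), and it is
  positive definite at all points of the circle outside a finite set. Cholesky's algorithm
  over the meromorphic functions writes it as \<open>V\<^sup>* V\<close> with \<open>V\<close> meromorphic near the circle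
  (\<open>positive_definite_factorization\<close>). The algorithm needs meromorphic functions of prescribed squared
  modulus in place of square roots. They exist because a function that is positive on the circle has
  zeros and poles of even order there, and because near the circle the factor \<open>\<bar>z - p\<bar>\<^sup>2\<close> is the
  product of \<open>z - p\<close> with its reflection. Finally \<open>V\<close> is divided by an \<open>n\<close>-th root of its
  determinant, after a unimodular row scaling has given this determinant a single-valued root in the
  annulus inside the circle (\<open>positive_circle_factorization\<close>). The root may branch at finitely
  many points of the circle, but it cancels in \<open>V M V\<inverse>\<close>, which is meromorphic near the circle and bounded on
  the circle; so its singularities on the circle are removable.

  For uniqueness, let \<open>U = V\<^sub>2 V\<^sub>1\<inverse>\<close>. On the circle off finitely many points \<open>V\<^sub>1\<^sup>* V\<^sub>1\<close> and
  \<open>V\<^sub>2\<^sup>* V\<^sub>2\<close> are proportional with determinant 1, hence equal, and \<open>U\<close> is unitary. At an exceptional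
  point the growth of \<open>U\<close> is not known in advance. But \<open>U\<close> intertwines the two unitary families, so
  \<open>U = u Y\<close> with a scalar function \<open>u\<close> and a meromorphic matrix function \<open>Y\<close>, and \<open>det U = 1\<close>
  shows that \<open>u\<^sup>n = 1 / det Y\<close> is meromorphic. Thus the \<open>n\<close>-th powers of the entries of \<open>U\<close> are
  meromorphic and bounded on the circle. In a given row they cannot all vanish at the same point, since
  the row has norm 1; an entry whose power does not vanish at the point is a root of a nonvanishing analytic function
  and extends (\<open>local_root_extension\<close>), and the other entries are meromorphic multiples of it.
\<close>

(* The dollar sign denotes components of vectors throughout, not coefficients of power series. *)
no_notation fps_nth (infixl \<open>$\<close> 75)

section \<open>Neighbourhoods and generic points of the circle\<close>

text \<open>
  The filter of statements that hold on the circle outside a finite set. Its companion is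
  \<open>cosparse circle\<close>, the filter of statements that hold in a neighbourhood of the circle outside
  isolated points. Using both, exceptional sets never have to be named, and \<open>eventually_elim\<close>
  combines finitely many of them.
\<close>
abbreviation generic_circle :: "complex filter" where
  "generic_circle \<equiv> inf (cosparse circle) (principal circle)"

lemma eventually_cosparse_iff_at:
  fixes A :: "complex set"
  shows "eventually P (cosparse A) \<longleftrightarrow> (\<forall>p\<in>A. eventually P (at p))"
proof
  assume "eventually P (cosparse A)"
  then show "\<forall>p\<in>A. eventually P (at p)"
    by (auto intro: eventually_cosparse_imp_eventually_at)
next
  assume *: "\<forall>p\<in>A. eventually P (at p)"
  show "eventually P (cosparse A)"
    unfolding eventually_cosparse sparse_in_ball_def
  proof
    fix p assume "p \<in> A"
    then obtain d where d: "d > 0" "\<And>z. z \<noteq> p \<Longrightarrow> dist z p < d \<Longrightarrow> P z"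
      using * by (auto simp: eventually_at)
    have "\<not> y islimpt {x. \<not> P x}" if "y \<in> ball p d" for y
    proof
      assume "y islimpt {x. \<not> P x}"
      moreover have "{x. \<not> P x} \<inter> ball p d \<subseteq> {p}"
        using d(2) by (force simp: dist_commute)
      then have "finite ({x. \<not> P x} \<inter> ball p d)"
        using finite_subset by blast
      then have "\<not> y islimpt ({x. \<not> P x} \<inter> ball p d)"
        by (rule islimpt_finite)
      ultimately show False
        using that by (meson Elementary_Metric_Spaces.open_ball islimpt_Int_eventually eventually_at_in_open')
    qed
    then show "\<exists>e>0. \<forall>y\<in>ball p e. \<not> y islimpt {x. \<not> P x}"
      using d(1) by blast
  qed
qed

lemma eventually_generic_circle_iff:
  "eventually P generic_circle \<longleftrightarrow> (\<exists>F. finite F \<and> F \<subseteq> circle \<and> (\<forall>p\<in>circle - F. P p))"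
proof
  assume "eventually P generic_circle"
  then have "{x. \<not> (x \<in> circle \<longrightarrow> P x)} sparse_in circle"
    by (simp add: eventually_inf_principal eventually_cosparse)
  then have "finite (circle \<inter> {x. \<not> (x \<in> circle \<longrightarrow> P x)})"
    by (rule sparse_in_compact_finite) simp
  then show "\<exists>F. finite F \<and> F \<subseteq> circle \<and> (\<forall>p\<in>circle - F. P p)"
    by (intro exI[of _ "circle \<inter> {x. \<not> (x \<in> circle \<longrightarrow> P x)}"]) auto
next
  assume "\<exists>F. finite F \<and> F \<subseteq> circle \<and> (\<forall>p\<in>circle - F. P p)"
  then obtain F where F: "finite F" "\<forall>p\<in>circle - F. P p"
    by blast
  have "{x. \<not> (x \<in> circle \<longrightarrow> P x)} sparse_in circle"
    by (rule sparse_in_subset2[OF finite_imp_sparse[OF F(1)]]) (use F(2) in auto)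
  then show "eventually P generic_circle"
    by (simp add: eventually_inf_principal eventually_cosparse)
qed

lemma eventually_generic_circle_at:
  assumes "eventually P generic_circle" "p \<in> circle"
  shows "eventually P (at p within circle)"
  using assms by (auto simp: eventually_inf_principal eventually_cosparse_iff_at eventually_at_filter
    elim!: eventually_mono dest!: bspec[of _ _ p])

lemma eventually_cosparse_imp_generic:
  "eventually P (cosparse circle) \<Longrightarrow> eventually P generic_circle"
  by (auto simp: eventually_inf_principal elim: eventually_mono)

lemma eventually_generic_in_circle: "eventually (\<lambda>p. p \<in> circle) generic_circle"
  by (simp add: eventually_inf_principal)

text \<open>The angle \<open>s\<close> as a local coordinate at \<open>p\<close>; for small \<open>s \<noteq> 0\<close> the point differs from \<open>p\<close>.\<close>
lemma circle_point_tendsto: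
  assumes "p \<in> circle"
  shows "((\<lambda>s. p * cis s) \<longlongrightarrow> p) (at 0)" "filterlim (\<lambda>s. p * cis s) (at p within circle) (at 0)"
proof -
  have "((\<lambda>s. p * cis s) \<longlongrightarrow> p * cis 0) (at 0)"
    by (intro tendsto_intros)
  then show 1: "((\<lambda>s. p * cis s) \<longlongrightarrow> p) (at 0)"
    by simp
  have p0: "p \<noteq> 0" using assms by auto
  have "eventually (\<lambda>s::real. s \<in> ball 0 pi - {0}) (at 0)"
    by (intro eventually_at_in_open) auto
  then have "eventually (\<lambda>s. p * cis s \<in> circle \<and> p * cis s \<noteq> p) (at 0)"
  proof eventually_elim
    case (elim s)
    have "cis s \<noteq> 1"
    proof
      assume "cis s = 1"
      then have "cos s = 1" by (simp add: complex_eq_iff)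
      then obtain n :: int where "s = of_int n * 2 * pi" by (auto simp: cos_one_2pi_int)
      moreover from this elim have "\<bar>of_int n * 2 * pi\<bar> < pi" by auto
      then have "\<bar>real_of_int n\<bar> * 2 < 1" by (simp add: abs_mult)
      then have "n = 0" by linarith
      ultimately show False using elim by simp
    qed
    then show ?case using assms p0 by (simp add: norm_mult)
  qed
  then show "filterlim (\<lambda>s. p * cis s) (at p within circle) (at 0)"
    using 1 by (simp add: filterlim_at eventually_conj_iff)
qed

lemma at_within_circle_neq_bot:
  assumes "p \<in> circle"
  shows "at p within circle \<noteq> bot"
  using circle_point_tendsto(2)[OF assms] by (metis at_neq_bot bot.extremum_unique filterlim_def filtermap_bot_iff)

lemma generic_circle_neq_bot: "generic_circle \<noteq> bot"
proof
  assume "generic_circle = bot"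
  then have "eventually (\<lambda>_. False) (at 1 within circle)"
    by (intro eventually_generic_circle_at) auto
  then show False
    using at_within_circle_neq_bot[of 1] by (simp add: eventually_False)
qed

text \<open>
  Compactness: finitely many discs around points of the circle cover an annulus, and the statement
  can fail in each of them only at the centre. Hence all exceptions lie on the circle itself.
  The radius of a unitarizer comes from here.
\<close>
lemma eventually_cosparse_circle_annulus:
  assumes "eventually Q (cosparse circle)"
  obtains r P where "0 < r" "r < 1" "finite P" "P \<subseteq> circle"
    "\<And>z. r < cmod z \<Longrightarrow> cmod z < 1 / r \<Longrightarrow> z \<notin> P \<Longrightarrow> Q z"
proof -
  have "\<forall>p\<in>circle. \<exists>e>0. \<forall>z. z \<noteq> p \<longrightarrow> dist z p < e \<longrightarrow> Q z"
    using assms unfolding eventually_cosparse_iff_at eventually_at by (metis UNIV_I)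
  then obtain e where e: "\<And>p. p \<in> circle \<Longrightarrow> e p > 0"
      "\<And>p z. p \<in> circle \<Longrightarrow> z \<noteq> p \<Longrightarrow> dist z p < e p \<Longrightarrow> Q z"
    by metis
  obtain P where P: "P \<subseteq> circle" "finite P" "circle \<subseteq> (\<Union>p\<in>P. ball p (e p))"
  proof (rule compactE_image[OF compact_sphere[of 0 1], of circle "\<lambda>p. ball p (e p)"])
    show "circle \<subseteq> (\<Union>p\<in>circle. ball p (e p))"
      using e(1) by (auto intro!: bexI)
  qed (use that in auto)
  obtain \<delta> where \<delta>: "\<delta> > 0" "{x. infdist x circle \<le> \<delta>} \<subseteq> (\<Union>p\<in>P. ball p (e p))"
    by (rule compact_in_open_separated[of circle "\<Union>p\<in>P. ball p (e p)"]) (use P in auto)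
  define m where "m = min \<delta> 1"
  define r where "r = 1 / (1 + m)"
  have m: "0 < m" "m \<le> \<delta>" using \<delta> by (auto simp: m_def)
  have r: "0 < r" "r < 1" "1 / r = 1 + m" "1 - r \<le> m"
    using m by (auto simp: r_def field_simps)
  have "Q z" if z: "r < cmod z" "cmod z < 1 / r" "z \<notin> P" for z
  proof -
    have z0: "z \<noteq> 0" using z r by auto
    have "infdist z circle \<le> dist z (sgn z)"
      by (rule infdist_le) (use z0 in \<open>auto simp: norm_sgn\<close>)
    also have "z - sgn z = of_real (cmod z - 1) * sgn z"
      using z0 by (simp add: sgn_eq field_simps)
    then have "dist z (sgn z) = \<bar>cmod z - 1\<bar>"
      using z0 by (simp only: dist_norm norm_mult norm_of_real norm_sgn) auto
    also have "\<dots> \<le> \<delta>"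
      using z r m by auto
    finally obtain p where "p \<in> P" "z \<in> ball p (e p)"
      using \<delta>(2) by blast
    then show ?thesis
      using e(2)[of p z] P(1) z(3) by (metis dist_commute mem_ball subsetD)
  qed
  with r P that show ?thesis by blast
qed

lemma analytic_at_eventually:
  assumes "f analytic_on {p}"
  shows "eventually (\<lambda>z. f analytic_on {z}) (nhds p)"
proof -
  obtain A where "open A" "p \<in> A" "f holomorphic_on A"
    using assms by (auto simp: analytic_at)
  then show ?thesis
    by (auto simp: eventually_nhds analytic_at)
qed

lemma analytic_on_circle_eventually:
  assumes "f analytic_on circle"
  shows "eventually (\<lambda>z. f analytic_on {z}) (cosparse circle)"
  using assms analytic_on_imp_meromorphic_on meromorphic_on_imp_analytic_cosparse by blast

lemma meromorphic_frequently_0_imp_eventually: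
  assumes "f meromorphic_on {p}" "frequently (\<lambda>z. f z = 0) (at p)"
  shows "eventually (\<lambda>z. f z = 0) (at p)"
  using assms not_essential_frequently_0_imp_eventually_0 by (auto simp: meromorphic_at_iff)

text \<open>
  The identity theorem in the form needed at a boundary point: \<open>S\<close> is either the circle or the annulus
  inside it.
\<close>
lemma analytic_eq_within_imp_eq:
  assumes "f analytic_on {p}" "g analytic_on {p}" "at p within S \<noteq> bot"
    and "eventually (\<lambda>z. f z = g z) (at p within S)"
  shows "eventually (\<lambda>z. f z = g z) (nhds p)"
proof -
  have an: "(\<lambda>z. f z - g z) analytic_on {p}"
    using assms by (intro analytic_intros)
  have "frequently (\<lambda>z. f z - g z = 0) (at p within S)"
    using eventually_frequently[OF assms(3)] assms(4) by (simp add: eventually_mono)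
  then have "frequently (\<lambda>z. f z - g z = 0) (at p)"
    unfolding frequently_def using filter_leD[OF at_le[OF subset_UNIV]] by blast
  then have ev: "eventually (\<lambda>z. f z - g z = 0) (at p)"
    using meromorphic_frequently_0_imp_eventually[OF analytic_on_imp_meromorphic_on[OF an]] by blast
  have "((\<lambda>z. f z - g z) \<longlongrightarrow> f p - g p) (at p)"
    using analytic_at_imp_isCont[OF an] by (auto simp: isCont_def)
  then have "f p - g p = 0"
    using tendsto_eventually[OF ev] LIM_unique by blast
  with ev show ?thesis
    by (auto simp: eventually_nhds_conv_at)
qed

text \<open>
  Near a pole a meromorphic function is large in every direction, so a bound along any set that
  accumulates at the point, for instance along the circle, rules a pole out.
\<close>
lemma meromorphic_bounded_imp_removable:
  assumes "f meromorphic_on {p}" "at p within S \<noteq> bot"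
    and "eventually (\<lambda>z. cmod (f z) \<le> C) (at p within S)"
  shows "remove_sings f analytic_on {p}"
proof -
  have "\<not> is_pole f p"
  proof
    assume "is_pole f p"
    then have "filterlim f at_infinity (at p within S)"
      using filterlim_mono[OF _ order_refl at_le[of S UNIV p]] by (auto simp: is_pole_def)
    then have "eventually (\<lambda>z. C + 1 \<le> cmod (f z)) (at p within S)"
      by (auto simp: filterlim_at_infinity_conv_norm_at_top filterlim_at_top)
    with assms(3) have "eventually (\<lambda>_. False) (at p within S)"
      by eventually_elim simp
    with assms(2) show False by (simp add: eventually_False)
  qed
  then obtain c where "f \<midarrow>p\<rightarrow> c"
    using assms(1) by (auto simp: meromorphic_at_iff not_essential_def)
  then show ?thesis
    using assms(1) remove_sings_analytic_at by (auto simp: meromorphic_at_iff)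
qed

text \<open>
  The involution \<open>z \<mapsto> 1 / cnj z\<close> fixes the points of the circle, so on the circle the reflected function is the
  complex conjugate of \<open>f\<close>, while analyticity is preserved. Conjugates and adjoints on the circle
  thereby become values of analytic functions.
\<close>
definition circle_reflect :: "(complex \<Rightarrow> complex) \<Rightarrow> complex \<Rightarrow> complex" where
  "circle_reflect f z = cnj (f (1 / cnj z))"

lemma circle_reflect_on_circle: "z \<in> circle \<Longrightarrow> circle_reflect f z = cnj (f z)"
  by (simp add: circle_reflect_def complex_div_cnj[of 1 "cnj z"])

lemma circle_reflect_analytic:
  assumes "f analytic_on circle"
  shows "circle_reflect f analytic_on circle"
proof -
  obtain A where A: "open A" "circle \<subseteq> A" "f holomorphic_on A"
    using assms by (auto simp: analytic_on_holomorphic)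
  define B where "B = cnj ` A"
  have B: "open B" "cnj ` B = A"
    using A(1) by (auto simp: B_def image_cnj_conv_vimage_cnj intro!: open_vimage)
  have circB: "1 / z \<in> B" if "z \<in> circle" for z
    using A(2) that by (auto simp: B_def norm_divide intro!: image_eqI[of _ _ "cnj (1 / z)"])
  have "cnj \<circ> f \<circ> cnj holomorphic_on B"
    by (rule holomorphic_on_compose_cnj_cnj) (use A B in auto)
  then have "(cnj \<circ> f \<circ> cnj) analytic_on B"
    using B(1) by (simp add: analytic_on_open)
  then have "(cnj \<circ> f \<circ> cnj) analytic_on (\<lambda>z. 1 / z) ` circle"
    by (rule analytic_on_subset) (use circB in auto)
  moreover have "(\<lambda>z. 1 / z) analytic_on circle"
    by (intro analytic_intros) auto
  ultimately have "((cnj \<circ> f \<circ> cnj) \<circ> (\<lambda>z. 1 / z)) analytic_on circle"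
    by (rule analytic_on_compose[rotated])
  moreover have "(cnj \<circ> f \<circ> cnj) \<circ> (\<lambda>z. 1 / z) = circle_reflect f"
    by (auto simp: circle_reflect_def fun_eq_iff)
  ultimately show ?thesis by simp
qed

section \<open>Analytic functions on the circle and their extensions\<close>

lemma powser_eq_on_reals_imp_eq:
  fixes a b :: "nat \<Rightarrow> complex"
  assumes "r > 0"
    and "\<And>z. cmod z < r \<Longrightarrow> (\<lambda>n. a n * z ^ n) sums f z"
    and "\<And>z. cmod z < r \<Longrightarrow> (\<lambda>n. b n * z ^ n) sums g z"
    and eq: "\<And>u::real. \<bar>u\<bar> < r \<Longrightarrow> f (of_real u) = g (of_real u)"
  shows "a = b"
proof (rule ccontr)
  assume "a \<noteq> b"
  have sm: "(\<lambda>n. (a n - b n) * (z - 0) ^ n) sums (f z - g z)" if "cmod (z - 0) < r" for z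
    using sums_diff[OF assms(2,3)[of z]] that by (simp add: algebra_simps)
  have "a 0 - b 0 = 0"
    using sums_unique2[OF powser_sums_zero[of "\<lambda>n. a n - b n"]] sm[of 0] eq[of 0] \<open>r > 0\<close> by simp
  with \<open>a \<noteq> b\<close> obtain m where m: "a m - b m \<noteq> 0" "m > 0"
    by (metis eq_iff_diff_eq_0 ext gr0I)
  have z0: "f 0 - g 0 = 0"
    using eq[of 0] \<open>r > 0\<close> by simp
  obtain s where s: "0 < s" "\<And>z. z \<in> cball 0 s - {0} \<Longrightarrow> f z - g z \<noteq> 0"
    using powser_0_nonzero[OF \<open>r > 0\<close> sm z0 m] by blast
  define u where "u = min s (r / 2)"
  have "f (of_real u) - g (of_real u) \<noteq> 0"
    by (rule s(2)) (use s(1) \<open>r > 0\<close> in \<open>auto simp: u_def\<close>)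
  moreover have "\<bar>u\<bar> < r"
    using s(1) \<open>r > 0\<close> by (auto simp: u_def)
  ultimately show False using eq[of u] by simp
qed

lemma powser_real_imp_complex:
  fixes c :: "nat \<Rightarrow> complex"
  assumes "\<And>s::real. \<bar>s\<bar> < e \<Longrightarrow> (\<lambda>m. c m * of_real s ^ m) sums f s" "cmod z < e"
  shows "(\<lambda>m. c m * z ^ m) sums (\<Sum>m. c m * z ^ m)"
proof -
  obtain s where s: "cmod z < s" "s < e" using dense assms(2) by blast
  then have "0 < s" using norm_ge_zero[of z] by linarith
  then have "summable (\<lambda>m. c m * of_real s ^ m)"
    using assms(1)[of s] s by (auto simp: sums_iff)
  then have "summable (\<lambda>m. c m * z ^ m)"
    by (rule powser_inside) (use s \<open>0 < s\<close> in auto)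
  then show ?thesis by (rule summable_sums)
qed

text \<open>
  Write a point near the circle as \<open>w = \<bar>w\<bar> q\<close> with \<open>q\<close> on the circle. The extension at \<open>w\<close> is the
  Taylor series of \<open>f\<close> at \<open>q\<close> in the angle, evaluated at the imaginary angle \<open>- \<i> ln \<bar>w\<bar>\<close>. Its
  coefficients are determined by the germ of \<open>f\<close> at \<open>q\<close>, so no branch of the angle has to be chosen.
  Expanding the series at a nearby fixed point \<open>p\<close> again around \<open>q\<close> shows that the extension is,
  near \<open>p\<close>, the series at \<open>p\<close> composed with the analytic function \<open>- \<i> Ln (w / p)\<close>.
\<close>
lemma real_analytic_circle_imp_extension:
  assumes ra: "\<And>t. real_analytic_at (\<lambda>t. f (cis t)) t"
  obtains g where "g analytic_on circle" "\<And>z. z \<in> circle \<Longrightarrow> g z = f z"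
proof -
  define R where "R = (\<lambda>p c e. e > 0 \<and> (\<forall>s. \<bar>s\<bar> < e \<longrightarrow> (\<lambda>m. c m * of_real s ^ m) sums f (p * cis s)))"
  have "\<exists>c e. R p c e" if "p \<in> circle" for p
  proof -
    have "cis (Arg p) = p"
      using that by (subst cis_Arg) (auto simp: sgn_eq)
    then obtain t0 where t0: "p = cis t0"
      by metis
    obtain c e where ce: "e > 0" "\<And>t. \<bar>t - t0\<bar> < e \<Longrightarrow> (\<lambda>m. c m * of_real (t - t0) ^ m) sums f (cis t)"
      using ra[of t0] by (auto simp: real_analytic_at_def)
    have "(\<lambda>m. c m * of_real s ^ m) sums f (p * cis s)" if "\<bar>s\<bar> < e" for s
      using ce(2)[of "t0 + s"] that by (simp add: t0 cis_mult)
    with ce(1) show ?thesis unfolding R_def by blast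
  qed
  then obtain c e where ce: "\<And>p. p \<in> circle \<Longrightarrow> R p (c p) (e p)"
    by metis
  define G where "G = (\<lambda>w. \<Sum>m. c (w / of_real (cmod w)) m * (- \<i> * of_real (ln (cmod w))) ^ m)"
  have main: "G analytic_on {p} \<and> G p = f p" if p: "p \<in> circle" for p
  proof -
    define h where "h = (\<lambda>\<zeta>. \<Sum>m. c p m * \<zeta> ^ m)"
    have e: "e p > 0" "\<And>s. \<bar>s\<bar> < e p \<Longrightarrow> (\<lambda>m. c p m * of_real s ^ m) sums f (p * cis s)"
      using ce[OF p] by (auto simp: R_def)
    have hs: "(\<lambda>m. c p m * \<zeta> ^ m) sums h \<zeta>" if "cmod \<zeta> < e p" for \<zeta>
      unfolding h_def by (rule powser_real_imp_complex[OF e(2) that])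
    have hf: "h (of_real s) = f (p * cis s)" if "\<bar>s\<bar> < e p" for s
      using sums_unique2[OF hs[of "of_real s"] e(2)[OF that]] that by simp
    have holh: "h holomorphic_on ball 0 (e p)"
      by (rule power_series_holomorphic[of _ _ "c p"]) (use hs in auto)
    have Gh: "G (p * exp (\<i> * \<zeta>)) = h \<zeta>" if \<zeta>: "cmod \<zeta> < e p / 2" for \<zeta>
    proof -
      define s y where "s = Re \<zeta>" and "y = Im \<zeta>"
      have \<zeta>_eq: "\<zeta> = of_real s + \<i> * of_real y"
        by (simp add: s_def y_def complex_eq)
      have sy: "\<bar>s\<bar> < e p / 2" "\<bar>y\<bar> < e p / 2"
        using \<zeta> abs_Re_le_cmod[of \<zeta>] abs_Im_le_cmod[of \<zeta>] by (auto simp: s_def y_def)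
      have w: "exp (\<i> * \<zeta>) = cis s * of_real (exp (- y))"
        by (simp add: \<zeta>_eq cis_conv_exp exp_of_real[symmetric] algebra_simps flip: exp_add)
      have nw: "cmod (p * exp (\<i> * \<zeta>)) = exp (- y)"
        using p by (simp add: w norm_mult)
      define q where "q = p * cis s"
      have q: "q \<in> circle" using p by (simp add: q_def norm_mult)
      have wq: "p * exp (\<i> * \<zeta>) / of_real (cmod (p * exp (\<i> * \<zeta>))) = q"
        unfolding nw by (simp add: w q_def)
      define d where "d = (\<lambda>m. (deriv ^^ m) h (of_real s) / fact m)"
      have ds: "(\<lambda>m. d m * z ^ m) sums h (of_real s + z)" if "cmod z < e p - \<bar>s\<bar>" for z
      proof -
        have "h holomorphic_on ball (of_real s) (e p - \<bar>s\<bar>)"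
          by (rule holomorphic_on_subset[OF holh])
             (auto simp: ball_subset_ball_iff dist_norm)
        from holomorphic_power_series[OF this, of "of_real s + z"] that
        show ?thesis by (simp add: d_def dist_norm)
      qed
      have eq: "e q > 0" "\<And>u. \<bar>u\<bar> < e q \<Longrightarrow> (\<lambda>m. c q m * of_real u ^ m) sums f (q * cis u)"
        using ce[OF q] by (auto simp: R_def)
      have "c q = d"
      proof (rule powser_eq_on_reals_imp_eq[of "min (e q) (e p - \<bar>s\<bar>)"])
        show "0 < min (e q) (e p - \<bar>s\<bar>)" using eq sy e by auto
        show "(\<lambda>m. c q m * z ^ m) sums (\<Sum>m. c q m * z ^ m)" if "cmod z < min (e q) (e p - \<bar>s\<bar>)" for z
          by (rule powser_real_imp_complex[OF eq(2)]) (use that in auto)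
        show "(\<lambda>m. d m * z ^ m) sums h (of_real s + z)" if "cmod z < min (e q) (e p - \<bar>s\<bar>)" for z
          using ds that by auto
        show "(\<Sum>m. c q m * of_real u ^ m) = h (of_real s + of_real u)" if "\<bar>u\<bar> < min (e q) (e p - \<bar>s\<bar>)" for u
        proof -
          have "(\<Sum>m. c q m * of_real u ^ m) = f (q * cis u)"
            using eq(2)[of u] that by (auto simp: sums_iff)
          also have "\<dots> = f (p * cis (s + u))"
            by (simp add: q_def cis_mult mult.assoc)
          also have "\<dots> = h (of_real (s + u))"
            using that by (intro hf[symmetric]) auto
          finally show ?thesis by simp
        qed
      qed
      have "G (p * exp (\<i> * \<zeta>)) = (\<Sum>m. d m * (\<i> * of_real y) ^ m)"
        unfolding G_def wq unfolding nw \<open>c q = d\<close> by simp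
      also have "\<dots> = h \<zeta>"
        using ds[of "\<i> * of_real y"] sy by (auto simp: \<zeta>_eq sums_iff norm_mult)
      finally show ?thesis .
    qed
    have p0: "p \<noteq> 0" using p by auto
    define \<zeta> where "\<zeta> = (\<lambda>w. - \<i> * Ln (w / p))"
    have an\<zeta>: "\<zeta> analytic_on {p}"
      unfolding \<zeta>_def by (intro analytic_intros) (use p0 in auto)
    have \<zeta>p: "\<zeta> p = 0" using p0 by (simp add: \<zeta>_def)
    have "(h \<circ> \<zeta>) analytic_on {p}"
      by (rule analytic_on_compose[OF an\<zeta>])
         (use holh e(1) in \<open>auto simp: \<zeta>p intro!: holomorphic_on_imp_analytic_at\<close>)
    moreover have "eventually (\<lambda>w. G w = (h \<circ> \<zeta>) w) (nhds p)"
    proof -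
      have "(\<zeta> \<longlongrightarrow> 0) (nhds p)"
        using isContD[OF analytic_at_imp_isCont[OF an\<zeta>]] tendsto_at_iff_tendsto_nhds[of \<zeta> p] \<zeta>p by simp
      then have "eventually (\<lambda>w. dist (\<zeta> w) 0 < e p / 2) (nhds p)"
        by (rule tendstoD) (use e in auto)
      moreover have "eventually (\<lambda>w. w \<noteq> 0) (nhds p)"
        using p0 by (intro t1_space_nhds)
      ultimately show ?thesis
      proof eventually_elim
        case (elim w)
        have "p * exp (\<i> * \<zeta> w) = w"
          using elim p0 by (simp add: \<zeta>_def exp_Ln)
        with Gh[of "\<zeta> w"] elim show ?case by simp
      qed
    qed
    ultimately have "G analytic_on {p}"
      using analytic_at_cong[OF _ refl, of G "h \<circ> \<zeta>"] by blast
    moreover have "G p = f p"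
      using Gh[of 0] hf[of 0] e(1) by simp
    ultimately show ?thesis by simp
  qed
  show ?thesis
    by (rule that[of G]) (use main analytic_on_analytic_at in blast)+
qed

lemma analytic_on_circle_imp_real_analytic:
  assumes "g analytic_on circle"
  shows "real_analytic_at (\<lambda>t. g (cis t)) t"
proof -
  have "(g \<circ> (\<lambda>\<zeta>. exp (\<i> * \<zeta>))) analytic_on {of_real t}"
    by (intro analytic_on_compose analytic_intros analytic_on_subset[OF assms]) auto
  then obtain e where e: "e > 0" "(g \<circ> (\<lambda>\<zeta>. exp (\<i> * \<zeta>))) holomorphic_on ball (of_real t) e"
    by (auto simp: analytic_at_ball)
  have "(\<lambda>m. (deriv ^^ m) (g \<circ> (\<lambda>\<zeta>. exp (\<i> * \<zeta>))) (of_real t) / fact m * of_real (u - t) ^ m) sums g (cis u)"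
    if "\<bar>u - t\<bar> < e" for u
    using holomorphic_power_series[OF e(2), of "of_real u"] that
    by (simp add: dist_norm cis_conv_exp abs_minus_commute flip: of_real_diff)
  with e(1) show ?thesis
    unfolding real_analytic_at_def by (intro exI[of _ "\<lambda>m. (deriv ^^ m) (g \<circ> (\<lambda>\<zeta>. exp (\<i> * \<zeta>))) (of_real t) / fact m"] exI[of _ e]) auto
qed

lemma circle_analytic_extension:
  assumes "circle_analytic F"
  obtains G where "mat_analytic_on G circle" "\<And>z. z \<in> circle \<Longrightarrow> G z = F z"
proof -
  have "\<exists>g. g analytic_on circle \<and> (\<forall>z\<in>circle. g z = F z $ i $ j)" for i j
    using real_analytic_circle_imp_extension[of "\<lambda>z. F z $ i $ j"] assms
    unfolding circle_analytic_def by metis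
  then obtain g where g: "\<And>i j. g i j analytic_on circle" "\<And>i j z. z \<in> circle \<Longrightarrow> g i j z = F z $ i $ j"
    by metis
  show ?thesis
    by (rule that[of "\<lambda>z. \<chi> i j. g i j z"]) (use g in \<open>auto simp: mat_analytic_on_def vec_eq_iff\<close>)
qed

lemma mat_analytic_imp_circle_analytic:
  "mat_analytic_on G circle \<Longrightarrow> circle_analytic G"
  using analytic_on_circle_imp_real_analytic by (auto simp: mat_analytic_on_def circle_analytic_def)

text \<open>
  Local extensions live on discs centred on the circle. If two discs share a point outside the unit
  disc, they share its reflection in the circle, because reflection moves an outer point closer to
  every point of the circle. So the two discs also meet inside the unit disc, where both extensions
  equal \<open>f\<close>; as their intersection is convex, the extensions agree on all of it.
\<close>
lemma glue_extensions_across_circle: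
  assumes f: "f holomorphic_on annulus r 1"
    and loc: "\<And>p. p \<in> circle \<Longrightarrow> \<exists>g. g analytic_on {p} \<and> eventually (\<lambda>z. cmod z < 1 \<longrightarrow> g z = f z) (nhds p)"
  obtains G where "G analytic_on (annulus r 1 \<union> circle)" "\<And>z. z \<in> annulus r 1 \<Longrightarrow> G z = f z"
proof -
  have "\<exists>g e. e > 0 \<and> g holomorphic_on ball p e \<and> (\<forall>z\<in>ball p e. cmod z < 1 \<longrightarrow> g z = f z)"
    if p: "p \<in> circle" for p
  proof -
    obtain g where g: "g analytic_on {p}" "eventually (\<lambda>z. cmod z < 1 \<longrightarrow> g z = f z) (nhds p)"
      using loc[OF p] by blast
    obtain d where d: "d > 0" "g holomorphic_on ball p d"
      using g(1) by (auto simp: analytic_at_ball)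
    obtain d' where d': "d' > 0" "\<And>z. dist z p < d' \<Longrightarrow> cmod z < 1 \<Longrightarrow> g z = f z"
      using g(2) by (auto simp: eventually_nhds_metric)
    have "g holomorphic_on ball p (min d d')"
      by (rule holomorphic_on_subset[OF d(2)]) auto
    with d d' show ?thesis
      by (intro exI[of _ g] exI[of _ "min d d'"]) (auto simp: dist_commute)
  qed
  then obtain g e where e: "\<And>p. p \<in> circle \<Longrightarrow> e p > 0"
    and hol: "\<And>p. p \<in> circle \<Longrightarrow> g p holomorphic_on ball p (e p)"
    and gf: "\<And>p z. p \<in> circle \<Longrightarrow> z \<in> ball p (e p) \<Longrightarrow> cmod z < 1 \<Longrightarrow> g p z = f z"
    by metis
  have compat: "g p z = g p' z"
    if pp: "p \<in> circle" "p' \<in> circle" and z: "z \<in> ball p (e p)" "z \<in> ball p' (e p')" "1 \<le> cmod z" for p p' z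
  proof -
    define I where "I = ball p (e p) \<inter> ball p' (e p')"
    have refl: "dist q (1 / cnj z) \<le> dist q z" if "q \<in> circle" for q
    proof -
      have z0: "z \<noteq> 0" using z by auto
      have "cmod (q * cnj z - 1) = cmod (q * cnj (z - q))"
        using that complex_norm_square[of q] by (simp add: algebra_simps)
      also have "\<dots> = dist q z"
        using that by (simp only: norm_mult complex_mod_cnj) (simp add: dist_norm norm_minus_commute)
      finally have "cmod (q * cnj z - 1) = dist q z" .
      moreover have "q - 1 / cnj z = (q * cnj z - 1) / cnj z"
        using z0 by (simp add: field_simps)
      ultimately have "dist q (1 / cnj z) = dist q z / cmod z"
        by (simp add: dist_norm norm_divide)
      then show ?thesis using z(3) z0 by (simp add: divide_le_eq mult_le_cancel_left1)
    qed
    have opI: "open I" "connected I" "z \<in> I"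
      using z by (auto simp: I_def intro!: convex_connected convex_Int)
    have "1 / cnj z \<in> I"
      using refl[OF pp(1)] refl[OF pp(2)] z by (auto simp: I_def)
    moreover have "1 / cnj z \<in> closure (ball 0 1)"
      using z by (auto simp: norm_divide divide_simps)
    ultimately have ne: "I \<inter> ball 0 1 \<noteq> {}"
      using open_Int_closure_eq_empty[OF opI(1), of "ball 0 1"] by blast
    show ?thesis
    proof (rule analytic_continuation_open[of "I \<inter> ball 0 1" I "g p" "g p'"])
      show "g p holomorphic_on I" "g p' holomorphic_on I"
        by (rule holomorphic_on_subset[OF hol[OF pp(1)]], simp add: I_def)
           (rule holomorphic_on_subset[OF hol[OF pp(2)]], simp add: I_def)
      show "g p w = g p' w" if "w \<in> I \<inter> ball 0 1" for w
        using gf[OF pp(1), of w] gf[OF pp(2), of w] that by (simp add: I_def)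
    qed (use opI ne in auto)
  qed
  define G where "G = (\<lambda>z. if cmod z < 1 then f z else g (SOME p. p \<in> circle \<and> z \<in> ball p (e p)) z)"
  have Gg: "G z = g p z" if "p \<in> circle" "z \<in> ball p (e p)" for p z
  proof (cases "cmod z < 1")
    case False
    define p' where "p' = (SOME p. p \<in> circle \<and> z \<in> ball p (e p))"
    have "p' \<in> circle \<and> z \<in> ball p' (e p')"
      unfolding p'_def by (rule someI[of _ p]) (use that in auto)
    then have "g p z = g p' z"
      using that False by (intro compat) auto
    then show ?thesis using False by (simp add: G_def p'_def)
  qed (use that gf in \<open>auto simp: G_def\<close>)
  have "G analytic_on {p}" if "p \<in> circle" for p
  proof -
    have "G holomorphic_on ball p (e p)"
      by (rule holomorphic_transform[OF hol[OF that]]) (simp add: Gg[OF that])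
    then show ?thesis using e[OF that] by (auto simp: analytic_at_ball)
  qed
  moreover have op: "open (annulus r 1)"
    unfolding annulus_def by (intro open_Collect_conj open_Collect_less continuous_intros)
  then have "G analytic_on annulus r 1"
    unfolding analytic_on_open[OF op] by (intro holomorphic_transform[OF f]) (simp add: annulus_def G_def)
  ultimately have "G analytic_on (annulus r 1 \<union> circle)"
    using analytic_on_analytic_at analytic_on_Un by blast
  then show ?thesis
    by (rule that) (auto simp: G_def annulus_def)
qed

section \<open>Meromorphic solutions of intertwining equations\<close>

definition mat_meromorphic_on :: "(complex \<Rightarrow> complex^'n^'n) \<Rightarrow> complex set \<Rightarrow> bool" where
  "mat_meromorphic_on F S \<longleftrightarrow> (\<forall>i j. (\<lambda>z. F z $ i $ j) meromorphic_on S)"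

lemma det_analytic:
  fixes A :: "complex \<Rightarrow> complex^'n^'n"
  assumes "\<And>i j. (\<lambda>z. A z $ i $ j) analytic_on S"
  shows "(\<lambda>z. det (A z)) analytic_on S"
  unfolding det_def by (intro analytic_intros assms)

lemma det_meromorphic:
  fixes A :: "complex \<Rightarrow> complex^'n^'n"
  assumes "\<And>i j. (\<lambda>z. A z $ i $ j) meromorphic_on S"
  shows "(\<lambda>z. det (A z)) meromorphic_on S"
  unfolding det_def by (intro meromorphic_intros assms)

lemma mat_analytic_imp_meromorphic: "mat_analytic_on A S \<Longrightarrow> mat_meromorphic_on A S"
  by (auto simp: mat_analytic_on_def mat_meromorphic_on_def analytic_on_imp_meromorphic_on)

lemma mat_analytic_mult:
  assumes "mat_analytic_on A S" "mat_analytic_on B S"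
  shows "mat_analytic_on (\<lambda>z. A z ** B z) S"
  using assms unfolding mat_analytic_on_def matrix_matrix_mult_def
  by (auto intro!: analytic_intros)

lemma mat_meromorphic_mult:
  assumes "mat_meromorphic_on A S" "mat_meromorphic_on B S"
  shows "mat_meromorphic_on (\<lambda>z. A z ** B z) S"
  using assms unfolding mat_meromorphic_on_def matrix_matrix_mult_def
  by (auto intro!: meromorphic_intros)

lemma matrix_inv_left_right:
  fixes A :: "complex^'n^'n"
  assumes "det A \<noteq> 0"
  shows "matrix_inv A ** A = mat 1" "A ** matrix_inv A = mat 1"
proof -
  have "invertible A" using assms by (simp add: invertible_det_nz)
  then have "\<exists>B. A ** B = mat 1 \<and> B ** A = mat 1" by (simp add: invertible_def)
  from someI_ex[OF this] show "matrix_inv A ** A = mat 1" "A ** matrix_inv A = mat 1"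
    unfolding matrix_inv_def by auto
qed

lemma left_inverse_imp_matrix_inv:
  fixes A B :: "complex^'n^'n"
  assumes "B ** A = mat 1"
  shows "matrix_inv A = B"
proof -
  have "det B * det A = 1" using assms by (metis det_mul det_I)
  then have "det A \<noteq> 0" by auto
  from matrix_inv_left_right(2)[OF this] assms show ?thesis
    by (metis matrix_mul_assoc matrix_mul_lid matrix_mul_rid)
qed

text \<open>Cramer's rule: the entries of the inverse are rational functions of the entries of the matrix.\<close>
lemma matrix_inv_cramer:
  fixes A :: "complex^'n^'n"
  assumes "det A \<noteq> 0"
  shows "matrix_inv A $ k $ j = det (\<chi> a b. if b = k then (if a = j then 1 else 0) else A $ a $ b) / det A"
proof -
  have "A *v column j (matrix_inv A) = axis j 1"
  proof -
    have "A *v column j (matrix_inv A) = column j (A ** matrix_inv A)"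
      by (simp add: vec_eq_iff column_def matrix_matrix_mult_def matrix_vector_mult_def)
    then show ?thesis
      by (simp add: matrix_inv_left_right[OF assms] vec_eq_iff column_def mat_def axis_def)
  qed
  then have "column j (matrix_inv A) = (\<chi> k. det (\<chi> a b. if b = k then axis j 1 $ a else A $ a $ b) / det A)"
    by (simp add: cramer[OF assms])
  then have "column j (matrix_inv A) $ k = det (\<chi> a b. if b = k then axis j 1 $ a else A $ a $ b) / det A"
    by simp
  then show ?thesis
    by (simp add: column_def axis_def cong: if_cong)
qed

lemma mat_meromorphic_inv:
  fixes A :: "complex \<Rightarrow> complex^'n^'n"
  assumes A: "mat_meromorphic_on A S" and ev: "eventually (\<lambda>z. det (A z) \<noteq> 0) (cosparse S)"
  shows "mat_meromorphic_on (\<lambda>z. matrix_inv (A z)) S"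
  unfolding mat_meromorphic_on_def
proof (intro allI)
  fix k j
  let ?g = "\<lambda>z. det (\<chi> a b. if b = k then (if a = j then 1 else 0) else A z $ a $ b) / det (A z)"
  have entry: "(\<lambda>z. A z $ a $ b) meromorphic_on S" for a b
    using A by (simp add: mat_meromorphic_on_def)
  have "(\<lambda>z. if b = k then (if a = j then 1 else 0) else A z $ a $ b) meromorphic_on S" for a b
    by (cases "b = k") (auto intro!: entry)
  then have "?g meromorphic_on S"
    by (intro meromorphic_intros det_meromorphic) (auto intro!: entry)
  moreover have "eventually (\<lambda>z. matrix_inv (A z) $ k $ j = ?g z) (at p)" if "p \<in> S" for p
    using eventually_cosparse_imp_eventually_at[OF ev that, of UNIV]
    by eventually_elim (rule matrix_inv_cramer)
  ultimately show "(\<lambda>z. matrix_inv (A z) $ k $ j) meromorphic_on S"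
    using meromorphic_on_cong[of S "\<lambda>z. matrix_inv (A z) $ k $ j" ?g S] by blast
qed

lemma mat_analytic_inv:
  fixes A :: "complex \<Rightarrow> complex^'n^'n"
  assumes A: "mat_analytic_on A S" and nz: "\<And>z. z \<in> S \<Longrightarrow> det (A z) \<noteq> 0"
  shows "mat_analytic_on (\<lambda>z. matrix_inv (A z)) S"
  unfolding mat_analytic_on_def
proof (intro allI)
  fix k j
  let ?g = "\<lambda>z. det (\<chi> a b. if b = k then (if a = j then 1 else 0) else A z $ a $ b) / det (A z)"
  have "(\<lambda>z. matrix_inv (A z) $ k $ j) analytic_on {p}" if p: "p \<in> S" for p
  proof -
    have entry: "(\<lambda>z. A z $ a $ b) analytic_on {p}" for a b
      using A p analytic_on_subset unfolding mat_analytic_on_def by blast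
    then have an: "(\<lambda>z. det (A z)) analytic_on {p}"
      by (rule det_analytic)
    have "(\<lambda>z. if b = k then (if a = j then 1 else 0) else A z $ a $ b) analytic_on {p}" for a b
      by (cases "b = k") (auto intro!: entry)
    then have "?g analytic_on {p}"
      using nz[OF p] by (intro analytic_intros det_analytic) (auto intro!: entry)
    moreover have "eventually (\<lambda>z. det (A z) \<noteq> 0) (nhds p)"
      using tendsto_imp_eventually_ne[of "\<lambda>z. det (A z)" "det (A p)" "nhds p" 0] nz[OF p]
        isContD[OF analytic_at_imp_isCont[OF an]] tendsto_at_iff_tendsto_nhds[of "\<lambda>z. det (A z)" p]
      by simp
    then have "eventually (\<lambda>z. matrix_inv (A z) $ k $ j = ?g z) (nhds p)"
      by eventually_elim (rule matrix_inv_cramer)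
    ultimately show ?thesis
      using analytic_at_cong[of "\<lambda>z. matrix_inv (A z) $ k $ j" ?g p p] by blast
  qed
  then show "(\<lambda>z. matrix_inv (A z) $ k $ j) analytic_on S"
    using analytic_on_analytic_at by blast
qed

text \<open>The characteristic polynomial tends to infinity with \<open>c\<close>, so by Liouville's theorem it has a zero.\<close>
lemma ex_eigenvalue:
  fixes Y :: "complex^'n^'n"
  shows "\<exists>c. det (Y - mat c) = 0"
proof (rule Liouville_weak_inverse)
  have "(\<lambda>c. det (Y - mat c)) analytic_on UNIV"
  proof (rule det_analytic)
    fix i j
    show "(\<lambda>c. (Y - mat c) $ i $ j) analytic_on UNIV"
      by (cases "i = j") (auto simp: mat_def intro!: analytic_intros)
  qed
  then show "(\<lambda>c. det (Y - mat c)) holomorphic_on UNIV"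
    by (simp add: analytic_on_open)
  fix B
  let ?h = "\<lambda>c. \<chi> i j. Y $ i $ j * inverse c - (if i = j then 1 else 0)"
  have entry: "((\<lambda>c. ?h c $ i $ j) \<longlongrightarrow> (- mat 1 :: complex^'n^'n) $ i $ j) at_infinity" for i j
  proof -
    have "((\<lambda>c. Y $ i $ j * inverse c - (if i = j then 1 else 0)) \<longlongrightarrow> Y $ i $ j * 0 - (if i = j then 1 else 0)) at_infinity"
      by (intro tendsto_intros tendsto_inverse_0)
    then show ?thesis
      by (simp add: mat_def if_distrib[of uminus] cong: if_cong)
  qed
  have "((\<lambda>c. det (?h c)) \<longlongrightarrow> det (- mat 1 :: complex^'n^'n)) at_infinity"
    unfolding det_def by (intro tendsto_intros entry)
  moreover have "det (- mat 1 :: complex^'n^'n) \<noteq> 0"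
  proof -
    have "(- mat 1 :: complex^'n^'n) = (\<chi> i. (- 1) *s (mat 1 $ i))"
      by (simp add: vec_eq_iff)
    then have "det (- mat 1 :: complex^'n^'n) = (- 1) ^ CARD('n) * det (mat 1 :: complex^'n^'n)"
      using det_rows_mul[of "\<lambda>_. - 1" "\<lambda>i. mat 1 $ i :: complex^'n"] by simp
    then show ?thesis by (simp add: det_I)
  qed
  moreover have "filterlim (\<lambda>c::complex. c ^ CARD('n)) at_infinity at_infinity"
    by (intro filterlim_power_at_infinity filterlim_ident) (simp add: card_gt_0_iff)
  ultimately have "filterlim (\<lambda>c. det (?h c) * c ^ CARD('n)) at_infinity at_infinity"
    by (intro tendsto_mult_filterlim_at_infinity)
  then have "eventually (\<lambda>c. B \<le> cmod (det (?h c) * c ^ CARD('n))) at_infinity"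
    by (auto simp: filterlim_at_infinity_conv_norm_at_top filterlim_at_top)
  moreover have "eventually (\<lambda>c::complex. c \<noteq> 0) at_infinity"
    by (rule eventually_not_equal_at_infinity)
  ultimately show "eventually (\<lambda>c. B \<le> cmod (det (Y - mat c))) at_infinity"
  proof eventually_elim
    case (elim c)
    have "Y - mat c = (\<chi> i. c *s (?h c $ i))"
      using elim(2) by (simp add: vec_eq_iff mat_def field_simps)
    then have "det (Y - mat c) = c ^ CARD('n) * det (\<chi> i. ?h c $ i)"
      using det_rows_mul[of "\<lambda>_. c" "\<lambda>i. ?h c $ i"] by simp
    with elim show ?case by (simp add: mult.commute)
  qed
qed blast

text \<open>An eigenspace of \<open>Y\<close> is invariant under every matrix that commutes with \<open>Y\<close>.\<close>
lemma schur:
  fixes A B Y :: "complex^'n^'n"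
  assumes irr: "\<not> reducible_pair A B" and "Y ** A = A ** Y" "Y ** B = B ** Y"
  obtains c where "Y = mat c"
proof -
  obtain c where c: "det (Y - mat c) = 0"
    using ex_eigenvalue by blast
  define W where "W = {x. Y *v x = c *s x}"
  have mc: "mat c *v x = c *s x" for x :: "complex^'n"
    by (simp add: matrix_vector_mult_def mat_def vec_eq_iff if_distrib[of "\<lambda>t. t * _"] cong: if_cong)
  have "\<not> invertible (Y - mat c)"
    using c by (simp add: invertible_det_nz)
  then have "\<not> (\<exists>B. B ** (Y - mat c) = mat 1)"
    using invertible_left_inverse by blast
  then obtain x where x: "(Y - mat c) *v x = 0" "x \<noteq> 0"
    by (auto simp: matrix_left_invertible_ker)
  then have "x \<in> W"
    by (simp add: W_def matrix_vector_mult_diff_rdistrib mc)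
  with x have "W \<noteq> {0}" by auto
  moreover have "vec.subspace W"
    by (auto simp: vec.subspace_def W_def vec.add vec.scale matrix_vector_right_distrib vector_add_ldistrib vec.scale_left_commute)
  moreover have "(*v) C ` W \<subseteq> W" if "Y ** C = C ** Y" for C
  proof clarify
    fix x assume "x \<in> W"
    then have "Y *v (C *v x) = C *v (c *s x)"
      by (simp add: W_def matrix_vector_mul_assoc that) (simp flip: matrix_vector_mul_assoc)
    then show "C *v x \<in> W"
      by (simp add: W_def vec.scale)
  qed
  ultimately have "W = UNIV"
    using irr assms(2,3) unfolding reducible_pair_def by blast
  then have "Y *v x = mat c *v x" for x
    by (auto simp: W_def mc)
  then have "Y = mat c"
    by (simp add: matrix_eq)
  then show ?thesis by (rule that)
qed

text \<open>If \<open>X\<close> and \<open>Y\<close> solve the same equations, then \<open>X\<inverse> Y\<close> commutes with every \<open>B k\<close>.\<close>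
lemma intertwiner_unique:
  fixes A B :: "'k \<Rightarrow> complex^'n^'n"
  assumes irr: "\<not> reducible_pair (B i) (B j)"
    and X: "\<And>k. k \<in> {i, j} \<Longrightarrow> A k ** X ** B k = X" "det X \<noteq> 0"
    and Y: "\<And>k. k \<in> {i, j} \<Longrightarrow> A k ** Y ** B k = Y"
  obtains c where "Y = mat c ** X"
proof -
  obtain X' where X': "X' ** X = mat 1" "X ** X' = mat 1"
    using matrix_inv_left_right[OF X(2)] by blast
  have comm: "(X' ** Y) ** B k = B k ** (X' ** Y)" if k: "k \<in> {i, j}" for k
  proof -
    have "det (A k) * det X * det (B k) = det X"
      using X(1)[OF k] by (metis det_mul)
    then have "det (A k) \<noteq> 0" using X(2) by auto
    then obtain A' where A': "A' ** A k = mat 1"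
      using matrix_inv_left_right by blast
    have *: "Z ** B k = A' ** Z" if "A k ** Z ** B k = Z" for Z
      by (metis A' that matrix_mul_assoc matrix_mul_lid)
    have "(X' ** Y) ** B k = X' ** A' ** Y"
      using *[OF Y[OF k]] by (metis matrix_mul_assoc)
    also have "X' ** A' = X' ** (A' ** X) ** X'"
      by (metis X'(2) matrix_mul_assoc matrix_mul_rid)
    also have "\<dots> = X' ** (X ** B k) ** X'"
      using *[OF X(1)[OF k]] by simp
    also have "\<dots> = B k ** X'"
      by (metis X'(1) matrix_mul_assoc matrix_mul_lid)
    finally show ?thesis by (simp add: matrix_mul_assoc)
  qed
  obtain c where "X' ** Y = mat c"
    by (rule schur[OF irr, of "X' ** Y"]) (use comm in auto)
  then have "Y = X ** mat c"
    by (metis X'(2) matrix_mul_assoc matrix_mul_lid)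
  also have "X ** mat c = mat c ** X"
    by (simp add: matrix_matrix_mult_def mat_def vec_eq_iff if_distrib[of "\<lambda>t. t * _"] if_distrib[of "\<lambda>t. _ * t"] mult.commute cong: if_cong)
  finally show ?thesis by (rule that)
qed

text \<open>The circle has a connected open neighbourhood, an annulus, on which \<open>f\<close> is analytic.\<close>
lemma analytic_circle_nonzero_cosparse:
  assumes f: "f analytic_on circle" and p0: "p0 \<in> circle" "f p0 \<noteq> 0"
  shows "eventually (\<lambda>z. f z \<noteq> 0) (cosparse circle)"
proof -
  obtain r P where r: "0 < r" "r < 1" "P \<subseteq> circle"
    and an: "\<And>z. r < cmod z \<Longrightarrow> cmod z < 1 / r \<Longrightarrow> z \<notin> P \<Longrightarrow> f analytic_on {z}"
    using eventually_cosparse_circle_annulus[OF analytic_on_circle_eventually[OF f]] by metis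
  define A where "A = {z. r < cmod (z - 0) \<and> cmod (z - 0) < 1 / r}"
  have A: "open A" "connected A"
    unfolding A_def by (intro open_Collect_conj open_Collect_less continuous_intros)
      (rule connected_annulus, simp)
  have "1 < 1 / r" using r by simp
  then have circA: "circle \<subseteq> A" using r by (auto simp: A_def)
  have "f analytic_on {z}" if "z \<in> A" for z
    using an[of z] f r(3) that analytic_on_analytic_at[of f circle] by (cases "z \<in> P") (auto simp: A_def)
  then have "f analytic_on A" using analytic_on_analytic_at by blast
  then have "eventually (\<lambda>z. f z = 0) (cosparse A) \<or> eventually (\<lambda>z. f z \<noteq> 0) (cosparse A)"
    by (intro meromorphic_imp_constant_or_avoid analytic_on_imp_meromorphic_on A)
  moreover have "\<not> eventually (\<lambda>z. f z = 0) (cosparse A)"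
  proof
    assume "eventually (\<lambda>z. f z = 0) (cosparse A)"
    then have "eventually (\<lambda>z. f z = 0) (at p0)"
      using p0 circA by (auto simp: eventually_cosparse_iff_at)
    then have "f \<midarrow>p0\<rightarrow> 0" by (rule tendsto_eventually)
    moreover have "f \<midarrow>p0\<rightarrow> f p0"
      using analytic_on_analytic_at[of f circle] f p0 by (intro isContD analytic_at_imp_isCont) auto
    ultimately show False using p0 LIM_unique by blast
  qed
  ultimately show ?thesis
    using circA by (auto simp: eventually_cosparse_iff_at)
qed

lemma hermitian_square:
  fixes L :: "complex^'m^'m" and y :: "complex^'m"
  shows "(\<Sum>i\<in>UNIV. cnj (y $ i) * ((ctranspose L ** L) *v y) $ i) = of_real (\<Sum>a\<in>UNIV. (cmod ((L *v y) $ a))\<^sup>2)"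
proof -
  have "(\<Sum>i\<in>UNIV. cnj (y $ i) * ((ctranspose L ** L) *v y) $ i)
      = (\<Sum>i\<in>UNIV. \<Sum>a\<in>UNIV. cnj (y $ i) * (cnj (L $ a $ i) * (L *v y) $ a))"
    by (simp only: matrix_vector_mul_assoc[symmetric] matrix_vector_mult_def[of "ctranspose L"])
       (simp add: ctranspose_def sum_distrib_left)
  also have "\<dots> = (\<Sum>a\<in>UNIV. \<Sum>i\<in>UNIV. cnj (y $ i) * (cnj (L $ a $ i) * (L *v y) $ a))"
    by (rule sum.swap)
  also have "\<dots> = (\<Sum>a\<in>UNIV. cnj ((L *v y) $ a) * (L *v y) $ a)"
  proof (intro sum.cong refl)
    fix a
    have "cnj ((L *v y) $ a) = (\<Sum>i\<in>UNIV. cnj (L $ a $ i) * cnj (y $ i))"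
      by (simp add: matrix_vector_mult_def)
    then show "(\<Sum>i\<in>UNIV. cnj (y $ i) * (cnj (L $ a $ i) * (L *v y) $ a)) = cnj ((L *v y) $ a) * (L *v y) $ a"
      by (simp add: sum_distrib_left sum_distrib_right mult_ac)
  qed
  also have "\<dots> = of_real (\<Sum>a\<in>UNIV. (cmod ((L *v y) $ a))\<^sup>2)"
    by (simp add: complex_norm_square mult.commute del: of_real_power)
  finally show ?thesis .
qed

text \<open>
  The quadratic form of \<open>S\<close> at \<open>y\<close> is the sum of all \<open>\<parallel>L\<^sub>k y\<parallel>\<^sup>2\<close> and of \<open>\<bar>y\<^sub>m\<bar>\<^sup>2\<close>, so a null vector
  of \<open>S\<close> lies in every kernel and has \<open>m\<close>-th coordinate 0.
\<close>
lemma sum_ctranspose_square_injective: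
  fixes L :: "'k \<Rightarrow> complex^'m^'m"
  assumes "finite K"
    and ker: "\<And>y. (\<And>k. k \<in> K \<Longrightarrow> L k *v y = 0) \<Longrightarrow> y $ m = 0 \<Longrightarrow> y = 0"
    and S: "\<And>i j. S $ i $ j = (\<Sum>k\<in>K. (ctranspose (L k) ** L k) $ i $ j) + (if i = m \<and> j = m then 1 else 0)"
  shows "det S \<noteq> 0"
proof -
  have "y = 0" if Sy: "S *v y = 0" for y
  proof -
    have Sy_i: "(S *v y) $ i = (\<Sum>k\<in>K. ((ctranspose (L k) ** L k) *v y) $ i) + (if i = m then y $ m else 0)" for i
    proof -
      have "(S *v y) $ i = (\<Sum>j\<in>UNIV. \<Sum>k\<in>K. (ctranspose (L k) ** L k) $ i $ j * y $ j) + (\<Sum>j\<in>UNIV. (if i = m \<and> j = m then 1 else 0) * y $ j)"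
        by (simp add: matrix_vector_mult_def S distrib_right sum.distrib sum_distrib_right)
      also have "(\<Sum>j\<in>UNIV. (if i = m \<and> j = m then 1 else 0) * y $ j) = (if i = m then y $ m else 0)"
        by (cases "i = m") (auto simp: if_distrib[of "\<lambda>t. t * _"] cong: if_cong)
      also have "(\<Sum>j\<in>UNIV. \<Sum>k\<in>K. (ctranspose (L k) ** L k) $ i $ j * y $ j) = (\<Sum>k\<in>K. ((ctranspose (L k) ** L k) *v y) $ i)"
        by (subst sum.swap) (simp add: matrix_vector_mult_def)
      finally show ?thesis .
    qed
    have "0 = (\<Sum>i\<in>UNIV. cnj (y $ i) * (S *v y) $ i)"
      using Sy by simp
    also have "\<dots> = (\<Sum>i\<in>UNIV. \<Sum>k\<in>K. cnj (y $ i) * ((ctranspose (L k) ** L k) *v y) $ i) + cnj (y $ m) * y $ m"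
      unfolding Sy_i by (simp add: distrib_left sum.distrib sum_distrib_left if_distrib[of "\<lambda>t. _ * t"] cong: if_cong)
    also have "\<dots> = (\<Sum>k\<in>K. \<Sum>i\<in>UNIV. cnj (y $ i) * ((ctranspose (L k) ** L k) *v y) $ i) + cnj (y $ m) * y $ m"
      by (subst sum.swap) (rule refl)
    also have "\<dots> = of_real ((\<Sum>k\<in>K. \<Sum>a\<in>UNIV. (cmod ((L k *v y) $ a))\<^sup>2) + (cmod (y $ m))\<^sup>2)"
      by (simp add: hermitian_square del: of_real_power)
         (simp add: complex_norm_square mult.commute del: of_real_power)
    finally have "complex_of_real ((\<Sum>k\<in>K. \<Sum>a\<in>UNIV. (cmod ((L k *v y) $ a))\<^sup>2) + (cmod (y $ m))\<^sup>2) = 0"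
      by (rule sym)
    then have "(\<Sum>k\<in>K. \<Sum>a\<in>UNIV. (cmod ((L k *v y) $ a))\<^sup>2) + (cmod (y $ m))\<^sup>2 = 0"
      by (simp only: of_real_eq_0_iff)
    moreover have "0 \<le> (\<Sum>k\<in>K. \<Sum>a\<in>UNIV. (cmod ((L k *v y) $ a))\<^sup>2)"
      by (intro sum_nonneg) auto
    ultimately have "(\<Sum>k\<in>K. \<Sum>a\<in>UNIV. (cmod ((L k *v y) $ a))\<^sup>2) = 0" "(cmod (y $ m))\<^sup>2 = 0"
      using zero_le_power2[of "cmod (y $ m)"] by linarith+
    then have "L k *v y = 0" "y $ m = 0" if "k \<in> K" for k
      using that \<open>finite K\<close> by (auto simp: sum_nonneg_eq_0_iff sum_nonneg vec_eq_iff)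
    then show ?thesis
      using ker[of y] \<open>(cmod (y $ m))\<^sup>2 = 0\<close> by simp
  qed
  then have "\<exists>B. B ** S = mat 1"
    by (simp add: matrix_left_invertible_ker)
  then show ?thesis
    by (metis invertible_left_inverse invertible_det_nz)
qed

text \<open>
  A common kernel vector with \<open>m\<close>-th coordinate 1 depends meromorphically on the point. The matrix
  \<open>S\<close> of the preceding lemma is made analytic by reflection; it is invertible at \<open>p0\<close> and therefore
  near the circle off isolated points. Every kernel vector \<open>x\<close> satisfies \<open>S x = x\<^sub>m e\<^sub>m\<close>, because
  the terms \<open>L\<^sub>k x\<close> drop out, so \<open>x\<close> is \<open>x\<^sub>m\<close> times the \<open>m\<close>-th column of the inverse of \<open>S\<close>. This
  is pure algebra and so holds off the circle as well.
\<close>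
lemma meromorphic_kernel_vector:
  fixes L :: "'k \<Rightarrow> complex \<Rightarrow> complex^'m^'m"
  assumes "finite K" and L: "\<And>k. k \<in> K \<Longrightarrow> mat_analytic_on (L k) circle"
    and p0: "p0 \<in> circle"
    and ker: "\<And>y. (\<And>k. k \<in> K \<Longrightarrow> L k p0 *v y = 0) \<Longrightarrow> y $ m = 0 \<Longrightarrow> y = 0"
  obtains y :: "complex \<Rightarrow> complex^'m" where "\<And>i. (\<lambda>z. y z $ i) meromorphic_on circle"
    "eventually (\<lambda>z. \<forall>x. (\<forall>k\<in>K. L k z *v x = 0) \<longrightarrow> x = x $ m *s y z) (cosparse circle)"
proof -
  define S :: "complex \<Rightarrow> complex^'m^'m" where "S = (\<lambda>z. \<chi> i j. (\<Sum>k\<in>K. \<Sum>a\<in>UNIV. circle_reflect (\<lambda>z. L k z $ a $ i) z * L k z $ a $ j)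
      + (if i = m \<and> j = m then 1 else 0))"
  have Lan: "(\<lambda>z. L k z $ i $ j) analytic_on circle" if "k \<in> K" for k i j
    using L[OF that] by (simp add: mat_analytic_on_def)
  have San: "(\<lambda>z. S z $ i $ j) analytic_on circle" for i j
    by (cases "i = m \<and> j = m")
       (auto simp: S_def intro!: analytic_intros circle_reflect_analytic Lan)
  have "det (S p0) \<noteq> 0"
  proof (rule sum_ctranspose_square_injective[OF \<open>finite K\<close>, of "\<lambda>k. L k p0" m])
    show "S p0 $ i $ j = (\<Sum>k\<in>K. (ctranspose (L k p0) ** L k p0) $ i $ j) + (if i = m \<and> j = m then 1 else 0)" for i j
      using p0 by (simp add: S_def circle_reflect_on_circle matrix_matrix_mult_def ctranspose_def)
  qed (use ker in auto)
  then have ev: "eventually (\<lambda>z. det (S z) \<noteq> 0) (cosparse circle)"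
    by (intro analytic_circle_nonzero_cosparse[OF _ p0] det_analytic San)
  define y where "y = (\<lambda>z. column m (matrix_inv (S z)))"
  have "mat_meromorphic_on (\<lambda>z. matrix_inv (S z)) circle"
    by (intro mat_meromorphic_inv ev) (simp add: mat_meromorphic_on_def analytic_on_imp_meromorphic_on San)
  then have "(\<lambda>z. y z $ i) meromorphic_on circle" for i
    by (simp add: y_def column_def mat_meromorphic_on_def)
  moreover have "eventually (\<lambda>z. \<forall>x. (\<forall>k\<in>K. L k z *v x = 0) \<longrightarrow> x = x $ m *s y z) (cosparse circle)"
    using ev
  proof (eventually_elim, intro allI impI)
    fix z and x :: "complex^'m"
    assume nz: "det (S z) \<noteq> 0" and x: "\<forall>k\<in>K. L k z *v x = 0"
    have "(S z *v x) $ i = x $ m * (if i = m then 1 else 0)" for i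
    proof -
      have "(S z *v x) $ i = (\<Sum>j\<in>UNIV. \<Sum>k\<in>K. \<Sum>a\<in>UNIV. circle_reflect (\<lambda>z. L k z $ a $ i) z * (L k z $ a $ j * x $ j))
          + (\<Sum>j\<in>UNIV. (if i = m \<and> j = m then 1 else 0) * x $ j)"
        by (simp add: S_def matrix_vector_mult_def distrib_right sum.distrib sum_distrib_right mult.assoc)
      also have "(\<Sum>j\<in>UNIV. (if i = m \<and> j = m then 1 else 0) * x $ j) = x $ m * (if i = m then 1 else 0)"
        by (cases "i = m") (auto simp: if_distrib[of "\<lambda>t. t * _"] cong: if_cong)
      also have "(\<Sum>j\<in>UNIV. \<Sum>k\<in>K. \<Sum>a\<in>UNIV. circle_reflect (\<lambda>z. L k z $ a $ i) z * (L k z $ a $ j * x $ j))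
        = (\<Sum>k\<in>K. \<Sum>a\<in>UNIV. \<Sum>j\<in>UNIV. circle_reflect (\<lambda>z. L k z $ a $ i) z * (L k z $ a $ j * x $ j))"
        by (subst sum.swap, rule sum.cong[OF refl], rule sum.swap)
      also have "\<dots> = (\<Sum>k\<in>K. \<Sum>a\<in>UNIV. circle_reflect (\<lambda>z. L k z $ a $ i) z * (L k z *v x) $ a)"
        by (simp add: matrix_vector_mult_def sum_distrib_left)
      also have "\<dots> = 0"
        using x by (intro sum.neutral ballI) simp
      finally show ?thesis by simp
    qed
    then have "S z *v x = x $ m *s axis m 1"
      by (simp add: vec_eq_iff axis_def)
    then have "matrix_inv (S z) *v (S z *v x) = x $ m *s (matrix_inv (S z) *v axis m 1)"
      by (simp add: vec.scale)
    moreover have "matrix_inv (S z) *v axis m 1 = y z"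
      by (simp add: y_def vec_eq_iff matrix_vector_mult_def column_def axis_def if_distrib[of "\<lambda>t. _ * t"] cong: if_cong)
    ultimately show "x = x $ m *s y z"
      by (simp add: matrix_vector_mul_assoc matrix_inv_left_right[OF nz])
  qed
  ultimately show ?thesis by (rule that)
qed

text \<open>
  The equations \<open>A\<^sub>k X B\<^sub>k = X\<close> are linear in the entries of \<open>X\<close>, so this is the preceding lemma for
  vectors indexed by pairs.
\<close>
lemma meromorphic_intertwiner:
  fixes A B :: "'k \<Rightarrow> complex \<Rightarrow> complex^'n^'n"
  assumes "finite K" and A: "\<And>k. k \<in> K \<Longrightarrow> mat_analytic_on (A k) circle"
    and B: "\<And>k. k \<in> K \<Longrightarrow> mat_analytic_on (B k) circle"
    and p0: "p0 \<in> circle"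
    and ker: "\<And>X. (\<And>k. k \<in> K \<Longrightarrow> A k p0 ** X ** B k p0 = X) \<Longrightarrow> X $ a $ b = 0 \<Longrightarrow> X = 0"
  obtains Y where "mat_meromorphic_on Y circle"
    "eventually (\<lambda>z. \<forall>X. (\<forall>k\<in>K. A k z ** X ** B k z = X) \<longrightarrow> X = mat (X $ a $ b) ** Y z) (cosparse circle)"
proof -
  define L :: "'k \<Rightarrow> complex \<Rightarrow> complex^('n\<times>'n)^('n\<times>'n)"
    where "L = (\<lambda>k z. \<chi> u v. A k z $ fst u $ fst v * B k z $ snd v $ snd u - (if u = v then 1 else 0))"
  define vc :: "complex^'n^'n \<Rightarrow> complex^('n\<times>'n)" where "vc = (\<lambda>X. \<chi> u. X $ fst u $ snd u)"
  have Lv: "(L k z *v x) $ u = (A k z ** (\<chi> i j. x $ (i, j)) ** B k z) $ fst u $ snd u - x $ u" for k z x u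
  proof -
    have "(L k z *v x) $ u = (\<Sum>v\<in>UNIV. A k z $ fst u $ fst v * B k z $ snd v $ snd u * x $ v) - x $ u"
      by (simp add: L_def matrix_vector_mult_def left_diff_distrib sum_subtractf if_distrib[of "\<lambda>t. t * _"] cong: if_cong)
    also have "(\<Sum>v\<in>UNIV. A k z $ fst u $ fst v * B k z $ snd v $ snd u * x $ v)
        = (\<Sum>c\<in>UNIV. \<Sum>d\<in>UNIV. A k z $ fst u $ c * B k z $ d $ snd u * x $ (c, d))"
      by (simp add: sum.cartesian_product flip: UNIV_Times_UNIV) (auto intro!: sum.cong)
    also have "\<dots> = (A k z ** (\<chi> i j. x $ (i, j)) ** B k z) $ fst u $ snd u"
      by (subst sum.swap) (simp add: matrix_matrix_mult_def sum_distrib_left sum_distrib_right mult_ac)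
    finally show ?thesis .
  qed
  have Lker: "L k z *v x = 0 \<longleftrightarrow> A k z ** (\<chi> i j. x $ (i, j)) ** B k z = (\<chi> i j. x $ (i, j))" for k z x
  proof -
    have "M = (\<chi> i j. x $ (i, j)) \<longleftrightarrow> (\<forall>i j. M $ i $ j = x $ (i, j))" for M :: "complex^'n^'n"
      by (simp add: vec_eq_iff)
    then show ?thesis
      by (simp add: vec_eq_iff[of "L k z *v x"] Lv)
  qed
  have Lan: "mat_analytic_on (L k) circle" if "k \<in> K" for k
    using A[OF that] B[OF that] unfolding mat_analytic_on_def L_def
    by (auto intro!: analytic_intros)
  have L0: "x = 0" if "\<And>k. k \<in> K \<Longrightarrow> L k p0 *v x = 0" "x $ (a, b) = 0" for x
  proof -
    have "(\<chi> i j. x $ (i, j)) = (0 :: complex^'n^'n)"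
      by (rule ker) (use that Lker in auto)
    then show ?thesis by (auto simp: vec_eq_iff)
  qed
  obtain y :: "complex \<Rightarrow> complex^('n\<times>'n)" where y: "\<And>i. (\<lambda>z. y z $ i) meromorphic_on circle"
    "eventually (\<lambda>z. \<forall>x. (\<forall>k\<in>K. L k z *v x = 0) \<longrightarrow> x = x $ (a, b) *s y z) (cosparse circle)"
    by (rule meromorphic_kernel_vector[of K L p0 "(a, b)"]) (use \<open>finite K\<close> Lan p0 L0 in blast)+
  define Y :: "complex \<Rightarrow> complex^'n^'n" where "Y = (\<lambda>z. \<chi> i j. y z $ (i, j))"
  have "eventually (\<lambda>z. \<forall>X. (\<forall>k\<in>K. A k z ** X ** B k z = X) \<longrightarrow> X = mat (X $ a $ b) ** Y z) (cosparse circle)"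
    using y(2)
  proof (eventually_elim, intro allI impI)
    fix z and X :: "complex^'n^'n"
    assume *: "\<forall>x. (\<forall>k\<in>K. L k z *v x = 0) \<longrightarrow> x = x $ (a, b) *s y z"
      and X: "\<forall>k\<in>K. A k z ** X ** B k z = X"
    have "(\<chi> i j. vc X $ (i, j)) = X" by (simp add: vc_def vec_eq_iff)
    then have "\<forall>k\<in>K. L k z *v vc X = 0"
      using X by (simp add: Lker)
    with * have eq: "vc X = vc X $ (a, b) *s y z" by blast
    have X_entry: "X $ i $ j = X $ a $ b * y z $ (i, j)" for i j
      using arg_cong[OF eq, of "\<lambda>v. v $ (i, j)"] by (simp add: vc_def)
    have "(mat c ** Y z) $ i $ j = c * y z $ (i, j)" for c i j
      by (simp add: Y_def matrix_matrix_mult_def mat_def if_distrib[of "\<lambda>t. t * _"] cong: if_cong)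
    then have "\<forall>i j. X $ i $ j = (mat (X $ a $ b) ** Y z) $ i $ j"
      by (simp only:) (intro allI X_entry)
    then show "X = mat (X $ a $ b) ** Y z"
      unfolding vec_eq_iff .
  qed
  moreover have "mat_meromorphic_on Y circle"
    using y(1) by (simp add: Y_def mat_meromorphic_on_def)
  ultimately show ?thesis by (rule that[rotated])
qed

section \<open>Positive functions on the circle as squared moduli\<close>

definition pos_real :: "complex \<Rightarrow> bool" where
  "pos_real w \<longleftrightarrow> (\<exists>x>0. w = complex_of_real x)"

lemma pos_real_powi: "pos_real w \<Longrightarrow> pos_real (w powi m)"
  unfolding pos_real_def by (metis zero_less_power_int of_real_power_int)

lemma pos_real_divide: "pos_real v \<Longrightarrow> pos_real w \<Longrightarrow> pos_real (v / w)"
  unfolding pos_real_def by (metis divide_pos_pos of_real_divide)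

lemma pos_real_limit:
  assumes "(h \<longlongrightarrow> c) F" "F \<noteq> bot" "eventually (\<lambda>s. pos_real (h s)) F" "c \<noteq> 0"
  shows "pos_real c"
proof -
  have re: "((\<lambda>s. Re (h s)) \<longlongrightarrow> Re c) F" and im: "((\<lambda>s. Im (h s)) \<longlongrightarrow> Im c) F"
    using assms(1) by (auto intro: tendsto_intros)
  have "0 \<le> Re c"
    by (rule tendsto_lowerbound[OF re _ assms(2)])
       (use assms(3) in \<open>auto simp: pos_real_def elim!: eventually_mono\<close>)
  moreover have "Im c = 0"
  proof (rule tendsto_unique[OF assms(2) im])
    show "((\<lambda>s. Im (h s)) \<longlongrightarrow> 0) F"
      by (rule tendsto_eventually) (use assms(3) in \<open>auto simp: pos_real_def elim!: eventually_mono\<close>)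
  qed
  ultimately show ?thesis
    unfolding pos_real_def using assms(4) by (intro exI[of _ "Re c"]) (auto simp: complex_eq_iff less_le)
qed

text \<open>
  On the circle this is \<open>\<bar>z - p\<bar>\<^sup>2\<close>; since \<open>cnj z = 1 / z\<close> there, it can be written as a function
  that is holomorphic near the circle.
\<close>
definition dist_square :: "complex \<Rightarrow> complex \<Rightarrow> complex" where
  "dist_square p z = - (z - p)\<^sup>2 / (z * p)"

lemma dist_square_on_circle:
  assumes "p \<in> circle" "z \<in> circle"
  shows "dist_square p z = of_real ((cmod (z - p))\<^sup>2)"
proof -
  have cn: "cnj w = 1 / w" if "w \<in> circle" for w
    using that complex_norm_square[of w] by (auto simp: eq_divide_eq mult.commute)
  have "of_real ((cmod (z - p))\<^sup>2) = (z - p) * (1 / z - 1 / p)"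
    using assms by (simp add: complex_norm_square cn del: of_real_power)
  also have "\<dots> = dist_square p z"
    using assms zero_neq_one[where ?'a=real]
    by (cases "z = 0"; cases "p = 0") (auto simp: dist_square_def divide_simps power2_eq_square algebra_simps)
  finally show ?thesis by simp
qed

lemma dist_square_pos: "p \<in> circle \<Longrightarrow> z \<in> circle \<Longrightarrow> z \<noteq> p \<Longrightarrow> pos_real (dist_square p z)"
  using dist_square_on_circle[of p z] by (auto simp: pos_real_def simp del: of_real_power intro!: exI[of _ "(cmod (z - p))\<^sup>2"])

text \<open>
  On the arc \<open>z = p e\<^sup>i\<^sup>s\<close> one has \<open>z - p = 2 \<i> p e\<^sup>i\<^sup>s\<^sup>/\<^sup>2 sin (s / 2)\<close>. The sine changes its sign at
  \<open>s = 0\<close> and the other factors have a nonzero limit, so the product cannot stay positive.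
\<close>
lemma no_simple_sign_change:
  assumes p: "p \<in> circle" and g: "g analytic_on {p}" "g p \<noteq> 0"
    and ev: "eventually (\<lambda>z. pos_real (g z * (z - p))) (at p within circle)"
  shows False
proof -
  define h where "h = (\<lambda>s. g (p * cis s) * (2 * \<i> * p * cis (s / 2)))"
  have eq: "g (p * cis s) * (p * cis s - p) = h s * of_real (sin (s / 2))" for s
  proof -
    have "cis s - 1 = 2 * \<i> * cis (s / 2) * of_real (sin (s / 2))"
    proof -
      have "cos s = 1 - 2 * (sin (s / 2))\<^sup>2" "sin s = 2 * sin (s / 2) * cos (s / 2)"
        using cos_double_sin[of "s / 2"] sin_double[of "s / 2"] by simp_all
      then show ?thesis
        by (simp add: complex_eq_iff power2_eq_square)
    qed
    then show ?thesis by (simp add: h_def algebra_simps flip: right_diff_distrib)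
  qed
  have ev': "eventually (\<lambda>s. pos_real (h s * of_real (sin (s / 2)))) (at 0)"
    using filterlim_iff[THEN iffD1, OF circle_point_tendsto(2)[OF p]] ev by (auto simp: eq)
  have "(\<lambda>s. p * cis s) \<midarrow>0\<rightarrow> p"
    by (rule circle_point_tendsto[OF p])
  then have "(\<lambda>s. g (p * cis s)) \<midarrow>0\<rightarrow> g p"
    using isCont_tendsto_compose[OF analytic_at_imp_isCont[OF g(1)]] by blast
  then have "h \<midarrow>0\<rightarrow> g p * (2 * \<i> * p * cis (0 / 2))"
    unfolding h_def by (intro tendsto_intros) auto
  then have lim: "h \<midarrow>0\<rightarrow> 2 * \<i> * p * g p"
    by (simp add: mult_ac)
  have nz: "2 * \<i> * p * g p \<noteq> 0" using p g by auto
  have "eventually (\<lambda>s::real. s \<in> {-1<..<1} - {0}) (at 0)"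
    by (intro eventually_at_in_open) auto
  then have sgn: "eventually (\<lambda>s::real. \<bar>s\<bar> < 1 \<and> s \<noteq> 0) (at 0)"
    by eventually_elim auto
  have "eventually (\<lambda>s. pos_real (h s)) (at_right 0)"
  proof -
    have "eventually (\<lambda>s. pos_real (h s * of_real (sin (s / 2))) \<and> \<bar>s\<bar> < 1 \<and> s \<noteq> 0 \<and> s \<in> {0<..}) (at_right 0)"
      using ev' sgn by (auto simp: eventually_at_filter elim: eventually_elim2)
    then show ?thesis
    proof eventually_elim
      case (elim s)
      have "0 < sin (s / 2)" using elim pi_gt3 by (intro sin_gt_zero) auto
      then have "pos_real (of_real (sin (s / 2)))" by (auto simp: pos_real_def)
      moreover have "h s = h s * of_real (sin (s / 2)) / of_real (sin (s / 2))"
        using \<open>0 < sin (s / 2)\<close> by simp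
      ultimately show ?case using elim pos_real_divide by metis
    qed
  qed
  then have "pos_real (2 * \<i> * p * g p)"
    using lim nz by (intro pos_real_limit[of h _ "at_right 0"]) (auto simp: filterlim_at_split)
  moreover have "eventually (\<lambda>s. pos_real (- h s)) (at_left 0)"
  proof -
    have "eventually (\<lambda>s. pos_real (h s * of_real (sin (s / 2))) \<and> \<bar>s\<bar> < 1 \<and> s \<noteq> 0 \<and> s \<in> {..<0}) (at_left 0)"
      using ev' sgn by (auto simp: eventually_at_filter elim: eventually_elim2)
    then show ?thesis
    proof eventually_elim
      case (elim s)
      have "0 < sin (- s / 2)" using elim pi_gt3 by (intro sin_gt_zero) auto
      then have "pos_real (of_real (sin (- s / 2)))" by (auto simp: pos_real_def)
      moreover have "- h s = h s * of_real (sin (s / 2)) / of_real (sin (- s / 2))"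
        using \<open>0 < sin (- s / 2)\<close> by simp
      ultimately show ?case using elim pos_real_divide by metis
    qed
  qed
  then have "pos_real (- (2 * \<i> * p * g p))"
    using lim nz by (intro pos_real_limit[of "\<lambda>s. - h s" _ "at_left 0"] tendsto_minus) (auto simp: filterlim_at_split)
  ultimately show False
    by (auto simp: pos_real_def complex_eq_iff)
qed

text \<open>
  The order of a zero or pole of a function that is positive on the circle is even, since an odd
  order would cause a change of sign. A power of \<open>\<bar>z - p\<bar>\<^sup>2\<close> therefore takes it away completely and
  leaves a positive value at \<open>p\<close>.
\<close>
lemma positive_even_order:
  assumes p: "p \<in> circle" and d: "d meromorphic_on {p}"
    and pos: "eventually (\<lambda>z. pos_real (d z)) (at p within circle)"
  obtains m g where "g analytic_on {p}" "pos_real (g p)"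
    "eventually (\<lambda>z. d z = g z * dist_square p z powi m) (at p)"
proof -
  have p0: "p \<noteq> 0" using p by auto
  have iso: "isolated_singularity_at d p" "not_essential d p"
    using d by (auto simp: meromorphic_at_iff)
  have "\<exists>\<^sub>F z in at p. d z \<noteq> 0"
  proof -
    have "\<exists>\<^sub>F z in at p within circle. pos_real (d z)"
      using pos at_within_circle_neq_bot[OF p] by (intro eventually_frequently)
    then have "\<exists>\<^sub>F z in at p within circle. d z \<noteq> 0"
      by (rule frequently_elim1) (auto simp: pos_real_def)
    then show ?thesis
      unfolding frequently_def using filter_leD[OF at_le[OF subset_UNIV]] by blast
  qed
  from zorder_exist[OF iso this] obtain g0 k r where g0: "g0 p \<noteq> 0" "r > 0" "g0 holomorphic_on cball p r"
    "\<forall>w\<in>cball p r - {p}. d w = g0 w * (w - p) powi k \<and> g0 w \<noteq> 0"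
    by blast
  have g0an: "g0 analytic_on {p}"
    using g0(2,3) by (auto simp: analytic_at_ball intro: holomorphic_on_subset[OF _ ball_subset_cball])
  have "eventually (\<lambda>z. z \<in> ball p r - {p}) (at p)"
    using g0(2) by (intro eventually_at_in_open) auto
  then have d_eq: "eventually (\<lambda>z. d z = g0 z * (z - p) powi k \<and> z \<noteq> p) (at p)"
    by eventually_elim (use g0(4) in auto)
  have ez: "eventually (\<lambda>z. z \<noteq> 0) (at p)"
    using p0 by (intro eventually_neq_at_within)
  define m where "m = k div 2"
  define g where "g = (\<lambda>z. g0 z * (- z * p) powi m)"
  have gan: "g analytic_on {p}"
    unfolding g_def by (intro analytic_intros g0an) (use p0 in auto)
  have gp: "g p \<noteq> 0" using g0(1) p0 by (simp add: g_def)
  have sq: "(z - p) powi (2 * m) = (- z * p) powi m * dist_square p z powi m" if "z \<noteq> 0" for z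
  proof -
    have "(- z * p) * dist_square p z = (z - p)\<^sup>2"
      using that p0 by (simp add: dist_square_def)
    then show ?thesis
      by (simp add: power_int_mult flip: power_int_mult_distrib)
  qed
  have d_eq2: "eventually (\<lambda>z. d z = g z * dist_square p z powi m * (z - p) powi (k - 2 * m) \<and> z \<noteq> p) (at p)"
    using d_eq ez
  proof eventually_elim
    case (elim z)
    have "(z - p) powi k = (z - p) powi (2 * m) * (z - p) powi (k - 2 * m)"
      using elim by (subst power_int_add[symmetric]) auto
    with elim sq[of z] show ?case by (simp add: g_def)
  qed
  have "eventually (\<lambda>z. pos_real (d z) \<and> z \<in> circle \<and> d z = g z * dist_square p z powi m * (z - p) powi (k - 2 * m) \<and> z \<noteq> p) (at p within circle)"
    using pos d_eq2 by (auto simp: eventually_at_filter elim: eventually_elim2)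
  then have ev: "eventually (\<lambda>z. pos_real (g z * (z - p) powi (k - 2 * m))) (at p within circle)"
  proof eventually_elim
    case (elim z)
    have "pos_real (dist_square p z powi m)"
      using elim p by (intro pos_real_powi dist_square_pos) auto
    moreover from this have "g z * (z - p) powi (k - 2 * m) = d z / dist_square p z powi m"
      using elim by (auto simp: pos_real_def)
    ultimately show ?case
      using elim pos_real_divide by metis
  qed
  consider "k - 2 * m = 0" | "k - 2 * m = 1"
    unfolding m_def by linarith
  then show ?thesis
  proof cases
    case 1
    have "(g \<longlongrightarrow> g p) (at p within circle)"
      using analytic_at_imp_isCont[OF gan] continuous_at_imp_continuous_at_within continuous_within by blast
    then have "pos_real (g p)"
      by (rule pos_real_limit[OF _ at_within_circle_neq_bot[OF p] _ gp]) (use ev 1 in simp)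
    moreover have "eventually (\<lambda>z. d z = g z * dist_square p z powi m) (at p)"
      using d_eq2 by eventually_elim (simp add: 1)
    ultimately show ?thesis using gan that by blast
  next
    case 2
    then have False
      using no_simple_sign_change[OF p gan gp] ev by simp
    then show ?thesis ..
  qed
qed

text \<open>
  In the closed unit disc \<open>1 - z / p\<close> meets the branch cut of the logarithm only at \<open>z = p\<close>. This gives
  single-valued roots of \<open>(z - p)\<^sup>m\<close> inside the circle, even though the point \<open>p\<close> is in general a
  branch point.
\<close>
lemma nth_root_of_linear_factor:
  fixes m :: int
  assumes p: "p \<in> circle" and n: "n > 0"
  defines "\<psi> \<equiv> \<lambda>z. exp (of_int m / of_nat n * (Ln (- p) + Ln (1 - z / p)))"
  assumes z: "cmod z \<le> 1" "z \<noteq> p"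
  shows "\<psi> analytic_on {z}" "\<psi> z \<noteq> 0" "\<psi> z ^ n = (z - p) powi m"
proof -
  have p0: "p \<noteq> 0" using p by auto
  have ns: "1 - z / p \<notin> \<real>\<^sub>\<le>\<^sub>0"
  proof
    assume "1 - z / p \<in> \<real>\<^sub>\<le>\<^sub>0"
    then have *: "Re (z / p) \<ge> 1" "Im (z / p) = 0"
      by (auto simp: complex_nonpos_Reals_iff)
    have "cmod (z / p) \<le> 1" using z p by (simp add: norm_divide)
    with * have "Re (z / p) = 1"
      using abs_Re_le_cmod[of "z / p"] by linarith
    with * have "z / p = 1" by (simp add: complex_eq_iff)
    with z(2) p0 show False by simp
  qed
  show "\<psi> analytic_on {z}"
    unfolding \<psi>_def by (intro analytic_intros) (use ns p0 in auto)
  show "\<psi> z \<noteq> 0" by (simp add: \<psi>_def)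
  have nz: "1 - z / p \<noteq> 0" using ns by auto
  have "\<psi> z ^ n = exp (of_int m * (Ln (- p) + Ln (1 - z / p)))"
    using n by (simp add: \<psi>_def flip: exp_of_nat_mult)
  also have "\<dots> = exp (Ln (- p) + Ln (1 - z / p)) powi m"
    by (simp add: exp_power_int mult.commute)
  also have "exp (Ln (- p) + Ln (1 - z / p)) = - p * (1 - z / p)"
    using p0 nz by (simp add: exp_add)
  also have "\<dots> = z - p"
    using p0 by (simp add: field_simps)
  finally show "\<psi> z ^ n = (z - p) powi m" .
qed

text \<open>
  Induction over the points of the circle where \<open>d\<close> is not yet known to be analytic and positive. Each
  is removed by dividing by a power of \<open>\<bar>z - p\<bar>\<^sup>2\<close>, which contributes the factor \<open>(z - p)\<^sup>m\<close> to \<open>f\<close>.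
  When no such point is left, \<open>d\<close> stays off the branch cut near the circle and \<open>f = exp (Ln d / 2)\<close>
  works. Both kinds of factors have \<open>n\<close>-th roots in the closed disc, collected in \<open>\<phi>\<close>.
\<close>
lemma positive_circle_factorization_off_finite_set:
  assumes "finite F" "n > 0" "d meromorphic_on circle"
    and "\<And>p. p \<in> circle - F \<Longrightarrow> d analytic_on {p} \<and> pos_real (d p)"
  shows "\<exists>f \<phi>. f meromorphic_on circle \<and> eventually (\<lambda>p. of_real ((cmod (f p))\<^sup>2) = d p) generic_circle \<and>
    eventually (\<lambda>z. cmod z \<le> 1 \<longrightarrow> \<phi> analytic_on {z} \<and> \<phi> z \<noteq> 0 \<and> \<phi> z ^ n = f z) (cosparse circle)"
  using assms(1,3,4)
proof (induction F arbitrary: d rule: finite_induct)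
  case empty
  define f where "f = (\<lambda>z. exp (Ln (d z) / 2))"
  define \<phi> where "\<phi> = (\<lambda>z. exp (Ln (d z) / (2 * of_nat n)))"
  have notneg: "d z \<notin> \<real>\<^sub>\<le>\<^sub>0" if "z \<in> circle" for z
    using empty.prems(2)[of z] that by (auto simp: pos_real_def)
  have dan: "d analytic_on circle"
    using empty.prems(2) analytic_on_analytic_at[of d circle] by auto
  have "f analytic_on circle" "\<phi> analytic_on circle"
    unfolding f_def \<phi>_def using dan notneg \<open>n > 0\<close>
    by (auto intro!: analytic_intros)
  moreover have "eventually (\<lambda>p. of_real ((cmod (f p))\<^sup>2) = d p) generic_circle"
    using eventually_generic_in_circle
  proof eventually_elim
    case (elim p)
    then obtain x where x: "x > 0" "d p = of_real x"
      using empty.prems(2)[of p] by (auto simp: pos_real_def)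
    have "cmod (f p) = exp (ln x / 2)"
      using x by (simp add: f_def norm_exp_eq_Re Ln_of_real)
    then have "(cmod (f p))\<^sup>2 = exp (2 * (ln x / 2))"
      by (simp only: exp_double)
    with x show ?case by simp
  qed
  moreover have "\<phi> z ^ n = f z" for z
    using \<open>n > 0\<close> by (simp add: f_def \<phi>_def flip: exp_of_nat_mult)
  moreover have "\<phi> z \<noteq> 0" for z by (simp add: \<phi>_def)
  ultimately show ?case
    using analytic_on_circle_eventually[of \<phi>]
    by (intro exI[of _ f] exI[of _ \<phi>] conjI analytic_on_imp_meromorphic_on) (auto elim: eventually_mono)
next
  case (insert p F)
  show ?case
  proof (cases "p \<in> circle")
    case False
    then show ?thesis using insert.prems by (intro insert.IH) auto
  next
    case p: True
    then have p0: "p \<noteq> 0" by auto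
    have "eventually (\<lambda>z. pos_real (d z)) generic_circle"
      using insert.prems(2) insert.hyps(1) unfolding eventually_generic_circle_iff
      by (intro exI[of _ "insert p F \<inter> circle"]) blast
    then have "eventually (\<lambda>z. pos_real (d z)) (at p within circle)"
      using p by (rule eventually_generic_circle_at)
    moreover have "d meromorphic_on {p}"
      using insert.prems(1) p by (auto intro: meromorphic_on_subset)
    ultimately obtain m g where g: "g analytic_on {p}" "pos_real (g p)"
      "eventually (\<lambda>z. d z = g z * dist_square p z powi m) (at p)"
      using positive_even_order[OF p] by metis
    have ds_an: "(\<lambda>z. dist_square p z) analytic_on circle"
      unfolding dist_square_def by (intro analytic_intros) (use p0 in auto)
    define d0 where "d0 = (\<lambda>z. d z / dist_square p z powi m)"
    define d1 where "d1 = (\<lambda>z. if z = p then g p else d0 z)"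
    have d0m: "d0 meromorphic_on circle"
      unfolding d0_def by (intro meromorphic_intros insert.prems(1) analytic_on_imp_meromorphic_on ds_an)
    have d1_near: "eventually (\<lambda>z. d1 z = d0 z) (nhds q)" if "q \<noteq> p" for q
      using t1_space_nhds[OF that] by eventually_elim (simp add: d1_def)
    have d1_at: "eventually (\<lambda>z. d1 z = d0 z) (at q)" for q
    proof -
      have "eventually (\<lambda>z. z \<noteq> p) (at q)" by (rule eventually_neq_at_within)
      then show ?thesis by eventually_elim (simp add: d1_def)
    qed
    have d1m: "d1 meromorphic_on circle"
      using meromorphic_on_cong[of circle d1 d0 circle] d1_at d0m by blast
    have "eventually (\<lambda>z. d1 z = g z) (at p)"
    proof -
      have "eventually (\<lambda>z. z \<noteq> 0) (at p)"
        using p0 by (intro eventually_neq_at_within)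
      moreover have "eventually (\<lambda>z. z \<noteq> p) (at p)"
        by (intro eventually_neq_at_within)
      ultimately show ?thesis using g(3)
      proof eventually_elim
        case (elim z)
        then have "dist_square p z \<noteq> 0" using p0 by (simp add: dist_square_def)
        with elim show ?case by (simp add: d1_def d0_def)
      qed
    qed
    then have d1_p: "eventually (\<lambda>z. d1 z = g z) (nhds p)"
      by (simp add: eventually_nhds_conv_at d1_def)
    have "d1 analytic_on {q} \<and> pos_real (d1 q)" if q: "q \<in> circle - F" for q
    proof (cases "q = p")
      case True
      then show ?thesis
        using analytic_at_cong[OF d1_p refl] g(1,2) by (simp add: d1_def)
    next
      case False
      then have dq: "d analytic_on {q}" "pos_real (d q)"
        using insert.prems(2)[of q] q by auto
      have pq: "pos_real (dist_square p q)"
        using dist_square_pos[OF p, of q] False q by auto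
      then have nz: "dist_square p q \<noteq> 0" by (auto simp: pos_real_def)
      have "(\<lambda>z. dist_square p z) analytic_on {q}"
        using ds_an q by (auto intro: analytic_on_subset)
      then have "d0 analytic_on {q}"
        unfolding d0_def by (intro analytic_intros dq) (use nz in auto)
      then have "d1 analytic_on {q}"
        using analytic_at_cong[OF d1_near[OF False] refl] by simp
      moreover have "pos_real (d1 q)"
        using False dq pq by (simp add: d1_def d0_def pos_real_divide pos_real_powi)
      ultimately show ?thesis by simp
    qed
    from insert.IH[OF d1m this] obtain f1 \<phi>1 where IH: "f1 meromorphic_on circle"
      "eventually (\<lambda>p. of_real ((cmod (f1 p))\<^sup>2) = d1 p) generic_circle"
      "eventually (\<lambda>z. cmod z \<le> 1 \<longrightarrow> \<phi>1 analytic_on {z} \<and> \<phi>1 z \<noteq> 0 \<and> \<phi>1 z ^ n = f1 z) (cosparse circle)"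
      by blast
    define f where "f = (\<lambda>z. f1 z * (z - p) powi m)"
    define \<psi> where "\<psi> = (\<lambda>z. exp (of_int m / of_nat n * (Ln (- p) + Ln (1 - z / p))))"
    define \<phi> where "\<phi> = (\<lambda>z. \<phi>1 z * \<psi> z)"
    have ne_p: "eventually (\<lambda>z. z \<noteq> p) (cosparse circle)"
      by (simp add: eventually_cosparse_iff_at eventually_neq_at_within)
    have "f meromorphic_on circle"
      unfolding f_def by (intro meromorphic_intros IH(1))
    moreover have "eventually (\<lambda>p. of_real ((cmod (f p))\<^sup>2) = d p) generic_circle"
      using IH(2) eventually_generic_in_circle eventually_cosparse_imp_generic[OF ne_p]
    proof eventually_elim
      case (elim z)
      have pq: "pos_real (dist_square p z)"
        using dist_square_pos[OF p, of z] elim by auto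
      have "of_real ((cmod (f z))\<^sup>2) = of_real ((cmod (f1 z))\<^sup>2) * complex_of_real ((cmod (z - p))\<^sup>2) powi m"
        by (simp add: f_def norm_mult norm_power_int power_mult_distrib power_int_power flip: of_real_power of_real_power_int)
           (simp add: power_int_power' mult.commute flip: power_int_mult of_real_mult)
      also have "\<dots> = d1 z * dist_square p z powi m"
        using elim dist_square_on_circle[OF p, of z] by simp
      also have "\<dots> = d z"
        using elim pq by (auto simp: d1_def d0_def pos_real_def)
      finally show ?case .
    qed
    moreover have "eventually (\<lambda>z. cmod z \<le> 1 \<longrightarrow> \<phi> analytic_on {z} \<and> \<phi> z \<noteq> 0 \<and> \<phi> z ^ n = f z) (cosparse circle)"
      using IH(3) ne_p
    proof (eventually_elim, intro impI)
      fix z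
      assume "cmod z \<le> 1 \<longrightarrow> \<phi>1 analytic_on {z} \<and> \<phi>1 z \<noteq> 0 \<and> \<phi>1 z ^ n = f1 z" "z \<noteq> p" "cmod z \<le> 1"
      then show "\<phi> analytic_on {z} \<and> \<phi> z \<noteq> 0 \<and> \<phi> z ^ n = f z"
        using nth_root_of_linear_factor[OF p \<open>n > 0\<close>, of z m]
        by (auto simp: \<phi>_def \<psi>_def f_def power_mult_distrib intro!: analytic_on_mult)
    qed
    ultimately show ?thesis by blast
  qed
qed

lemma positive_circle_factorization:
  assumes "n > 0" "d meromorphic_on circle" "eventually (\<lambda>p. pos_real (d p)) generic_circle"
  obtains f \<phi> where "f meromorphic_on circle" "eventually (\<lambda>p. of_real ((cmod (f p))\<^sup>2) = d p) generic_circle"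
    "eventually (\<lambda>z. cmod z \<le> 1 \<longrightarrow> \<phi> analytic_on {z} \<and> \<phi> z \<noteq> 0 \<and> \<phi> z ^ n = f z) (cosparse circle)"
proof -
  have "eventually (\<lambda>p. d analytic_on {p} \<and> pos_real (d p)) generic_circle"
    using eventually_cosparse_imp_generic[OF meromorphic_on_imp_analytic_cosparse[OF assms(2)]] assms(3)
    by eventually_elim blast
  then obtain F where F: "finite F" "\<And>p. p \<in> circle - F \<Longrightarrow> d analytic_on {p} \<and> pos_real (d p)"
    unfolding eventually_generic_circle_iff by blast
  from positive_circle_factorization_off_finite_set[OF F(1) assms(1,2) F(2)] show ?thesis
    using that by blast
qed

section \<open>Positive definite matrix functions as Gram matrices\<close>

text \<open>
  The set \<open>S\<close> shrinks as Cholesky's algorithm removes one coordinate after the other; a removed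
  coordinate leaves a zero row and a zero column behind.
\<close>
definition posdef_on :: "'n set \<Rightarrow> ('n::finite \<Rightarrow> 'n \<Rightarrow> complex) \<Rightarrow> bool" where
  "posdef_on S X \<longleftrightarrow> (\<forall>i j. X j i = cnj (X i j)) \<and> (\<forall>i j. i \<notin> S \<or> j \<notin> S \<longrightarrow> X i j = 0) \<and>
     (\<forall>x. (\<exists>i\<in>S. x i \<noteq> 0) \<longrightarrow> 0 < Re (\<Sum>i\<in>S. \<Sum>j\<in>S. cnj (x i) * X i j * x j))"

lemma posdef_on_diag:
  fixes X :: "'n::finite \<Rightarrow> 'n \<Rightarrow> complex"
  assumes X: "posdef_on S X" and a: "a \<in> S"
  shows "pos_real (X a a)"
proof -
  define e :: "'n \<Rightarrow> complex" where "e = (\<lambda>i. if i = a then 1 else 0)"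
  have pos: "(\<exists>i\<in>S. x i \<noteq> 0) \<Longrightarrow> 0 < Re (\<Sum>i\<in>S. \<Sum>j\<in>S. cnj (x i) * X i j * x j)" for x
    using X unfolding posdef_on_def by blast
  have "0 < Re (\<Sum>i\<in>S. \<Sum>j\<in>S. cnj (e i) * X i j * e j)"
    by (rule pos) (use a in \<open>auto simp: e_def\<close>)
  also have "(\<Sum>i\<in>S. \<Sum>j\<in>S. cnj (e i) * X i j * e j) = X a a"
    using a by (simp add: e_def if_distrib[of "\<lambda>t. t * _"] if_distrib[of "\<lambda>t. _ * t"] if_distrib[of cnj] cong: if_cong)
  finally have "0 < Re (X a a)" .
  moreover have "X a a = cnj (X a a)"
    using X unfolding posdef_on_def by blast
  then have "Im (X a a) = 0"
    by (simp add: complex_eq_iff)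
  ultimately show ?thesis
    unfolding pos_real_def by (intro exI[of _ "Re (X a a)"]) (simp add: complex_eq_iff)
qed

text \<open>
  The value of the Schur complement at \<open>x\<close> is the value of the form of \<open>X\<close> at the vector that
  extends \<open>x\<close> by the minimizing coordinate \<open>y\<^sub>a = - u / X\<^sub>a\<^sub>a\<close>, where \<open>u = \<Sum>\<^sub>j X\<^sub>a\<^sub>j x\<^sub>j\<close>.
\<close>
lemma posdef_on_schur_complement:
  assumes X: "posdef_on (insert a S) X" and a: "a \<notin> S"
  shows "posdef_on S (\<lambda>i j. X i j - X i a * X a j / X a a)"
proof -
  have fin: "finite S" by (rule finite)
  have herm: "X j i = cnj (X i j)" for i j
    using X unfolding posdef_on_def by blast
  have out: "X i j = 0" if "i \<notin> insert a S \<or> j \<notin> insert a S" for i j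
    using X that unfolding posdef_on_def by blast
  have "pos_real (X a a)"
    by (rule posdef_on_diag[OF X]) simp
  then obtain t where t: "t > 0" "X a a = of_real t"
    unfolding pos_real_def by blast
  have "0 < Re (\<Sum>i\<in>S. \<Sum>j\<in>S. cnj (x i) * (X i j - X i a * X a j / X a a) * x j)" if x: "\<exists>i\<in>S. x i \<noteq> 0" for x
  proof -
    define u where "u = (\<Sum>j\<in>S. X a j * x j)"
    have cu: "(\<Sum>i\<in>S. cnj (x i) * X i a) = cnj u"
      unfolding u_def by (simp add: herm[of a] mult.commute)
    define y where "y = (\<lambda>i. if i = a then - u / X a a else x i)"
    have ya: "y a = - u / X a a"
      by (simp add: y_def)
    have yS: "y i = x i" if "i \<in> S" for i
      using that a by (auto simp: y_def)
    have "\<exists>i\<in>insert a S. y i \<noteq> 0"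
      using x yS by auto
    then have "0 < Re (\<Sum>i\<in>insert a S. \<Sum>j\<in>insert a S. cnj (y i) * X i j * y j)"
      using X unfolding posdef_on_def by blast
    also have "(\<Sum>i\<in>insert a S. \<Sum>j\<in>insert a S. cnj (y i) * X i j * y j)
      = cnj (y a) * X a a * y a + cnj (y a) * u + (cnj u * y a + (\<Sum>i\<in>S. \<Sum>j\<in>S. cnj (x i) * X i j * x j))"
    proof -
      have "(\<Sum>j\<in>S. cnj (y a) * X a j * y j) = cnj (y a) * u"
        by (simp add: u_def sum_distrib_left yS mult.assoc)
      moreover have "(\<Sum>i\<in>S. cnj (y i) * X i a * y a) = cnj u * y a"
        by (simp add: cu[symmetric] sum_distrib_right yS)
      ultimately show ?thesis
        using a fin by (simp add: sum.distrib yS)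
    qed
    also have "\<dots> = (\<Sum>i\<in>S. \<Sum>j\<in>S. cnj (x i) * X i j * x j) - cnj u * u / X a a"
      using t by (simp add: ya field_simps)
    also have "cnj u * u / X a a = (\<Sum>i\<in>S. \<Sum>j\<in>S. cnj (x i) * (X i a * X a j / X a a) * x j)"
      unfolding cu[symmetric] unfolding u_def sum_product sum_divide_distrib
      by (intro sum.cong refl) (simp add: mult_ac)
    finally show ?thesis
      by (simp add: algebra_simps sum_subtractf)
  qed
  moreover have "X j i - X j a * X a i / X a a = cnj (X i j - X i a * X a j / X a a)" for i j
    unfolding herm[of i j] herm[of a j] herm[of i a] using t by (simp add: mult.commute)
  moreover have "X i j - X i a * X a j / X a a = 0" if "i \<notin> S \<or> j \<notin> S" for i j
    using that out[of i j] out[of i a] out[of a j] t by (cases "i = a"; cases "j = a") auto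
  ultimately show ?thesis unfolding posdef_on_def by blast
qed

text \<open>
  Cholesky's algorithm: the coordinate \<open>a\<close> is eliminated by the Schur complement, and its row is
  \<open>X\<^sub>a\<^sub>j\<close> divided by a square root of \<open>X\<^sub>a\<^sub>a\<close>. To stay within the meromorphic functions, the positive
  square root is replaced by the conjugate of a meromorphic \<open>f\<close> with \<open>\<bar>f\<bar>\<^sup>2 = X\<^sub>a\<^sub>a\<close>; dividing by
  it means multiplying by \<open>f / X\<^sub>a\<^sub>a\<close>.
\<close>
lemma posdef_on_factorization:
  fixes X :: "complex \<Rightarrow> 'n::finite \<Rightarrow> 'n \<Rightarrow> complex"
  assumes "finite S" "\<And>i j. (\<lambda>z. X z i j) meromorphic_on circle"
    "eventually (\<lambda>p. posdef_on S (X p)) generic_circle"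
  shows "\<exists>V. (\<forall>a j. (\<lambda>z. V z a j) meromorphic_on circle) \<and>
    eventually (\<lambda>p. \<forall>i j. X p i j = (\<Sum>a\<in>S. cnj (V p a i) * V p a j)) generic_circle"
  using assms
proof (induction S arbitrary: X rule: finite_induct)
  case empty
  from empty.prems(2) have "eventually (\<lambda>p. \<forall>i j. X p i j = 0) generic_circle"
    by (rule eventually_mono) (unfold posdef_on_def, blast)
  then show ?case
    by (intro exI[of _ "\<lambda>_ _ _. 0"]) (simp add: meromorphic_on_const)
next
  case (insert a S)
  have diag: "eventually (\<lambda>p. pos_real (X p a a)) generic_circle"
    using insert.prems(2) by (rule eventually_mono) (rule posdef_on_diag, auto)
  obtain f where f: "f meromorphic_on circle"
    "eventually (\<lambda>p. of_real ((cmod (f p))\<^sup>2) = X p a a) generic_circle"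
    by (rule positive_circle_factorization[OF zero_less_one insert.prems(1) diag]) (rule that)
  define X' where "X' = (\<lambda>z i j. X z i j - X z i a * X z a j / X z a a)"
  have "(\<lambda>z. X' z i j) meromorphic_on circle" for i j
    unfolding X'_def by (intro meromorphic_intros insert.prems(1))
  moreover have "eventually (\<lambda>p. posdef_on S (X' p)) generic_circle"
    using insert.prems(2) unfolding X'_def
    by (rule eventually_mono) (rule posdef_on_schur_complement[OF _ insert.hyps(2)])
  ultimately obtain V where V: "\<And>a j. (\<lambda>z. V z a j) meromorphic_on circle"
    "eventually (\<lambda>p. \<forall>i j. X' p i j = (\<Sum>a\<in>S. cnj (V p a i) * V p a j)) generic_circle"
    using insert.IH[of X'] by blast
  define W where "W = (\<lambda>z b j. if b = a then X z a j * f z / X z a a else V z b j)"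
  have "(\<lambda>z. W z b j) meromorphic_on circle" for b j
    unfolding W_def by (cases "b = a") (auto intro!: meromorphic_intros insert.prems(1) f V)
  moreover have "eventually (\<lambda>p. \<forall>i j. X p i j = (\<Sum>b\<in>insert a S. cnj (W p b i) * W p b j)) generic_circle"
    using insert.prems(2) V(2) f(2)
  proof (eventually_elim, intro allI)
    fix p i j
    assume X: "posdef_on (insert a S) (X p)" and V': "\<forall>i j. X' p i j = (\<Sum>a\<in>S. cnj (V p a i) * V p a j)"
      and fp: "of_real ((cmod (f p))\<^sup>2) = X p a a"
    have herm: "X p j i = cnj (X p i j)" for i j
      using X unfolding posdef_on_def by blast
    have "pos_real (X p a a)"
      by (rule posdef_on_diag[OF X]) simp
    then obtain t where t: "t > 0" "X p a a = of_real t"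
      unfolding pos_real_def by blast
    have "(\<Sum>b\<in>S. cnj (W p b i) * W p b j) = (\<Sum>b\<in>S. cnj (V p b i) * V p b j)"
      using insert.hyps(2) by (intro sum.cong) (auto simp: W_def)
    then have "(\<Sum>b\<in>insert a S. cnj (W p b i) * W p b j) = cnj (W p a i) * W p a j + X' p i j"
      using insert.hyps V' by simp
    also have "cnj (W p a i) * W p a j = X p i a * X p a j * (f p * cnj (f p)) / (X p a a * X p a a)"
      using t by (simp add: W_def herm[of a i])
    also have "f p * cnj (f p) = X p a a"
      using fp by (simp add: complex_norm_square del: of_real_power)
    finally show "X p i j = (\<Sum>b\<in>insert a S. cnj (W p b i) * W p b j)"
      using t by (simp add: X'_def)
  qed
  ultimately show ?case by (intro exI[of _ W]) simp
qed

lemma positive_definite_factorization: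
  fixes X :: "complex \<Rightarrow> complex^'n^'n"
  assumes X: "mat_meromorphic_on X circle"
    and pos: "eventually (\<lambda>p. \<exists>B. det B \<noteq> 0 \<and> X p = ctranspose B ** B) generic_circle"
  obtains V where "mat_meromorphic_on V circle" "eventually (\<lambda>p. X p = ctranspose (V p) ** V p) generic_circle"
proof -
  have "eventually (\<lambda>p. posdef_on UNIV (\<lambda>i j. X p $ i $ j)) generic_circle"
    using pos
  proof eventually_elim
    case (elim p)
    then obtain B where B: "det B \<noteq> 0" "X p = ctranspose B ** B" by blast
    have entry: "X p $ i $ j = (\<Sum>a\<in>UNIV. cnj (B $ a $ i) * B $ a $ j)" for i j
      by (simp add: B(2) matrix_matrix_mult_def ctranspose_def)
    have "0 < Re (\<Sum>i\<in>UNIV. \<Sum>j\<in>UNIV. cnj (x i) * X p $ i $ j * x j)" if "\<exists>i. x i \<noteq> 0" for x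
    proof -
      define y :: "complex^'n" where "y = (\<chi> i. x i)"
      have "(\<Sum>i\<in>UNIV. \<Sum>j\<in>UNIV. cnj (x i) * X p $ i $ j * x j) = (\<Sum>i\<in>UNIV. cnj (y $ i) * ((ctranspose B ** B) *v y) $ i)"
        by (simp add: y_def B(2)[symmetric] matrix_vector_mult_def sum_distrib_left mult.assoc)
      also have "\<dots> = of_real (\<Sum>a\<in>UNIV. (cmod ((B *v y) $ a))\<^sup>2)"
        by (rule hermitian_square)
      finally have eq: "Re (\<Sum>i\<in>UNIV. \<Sum>j\<in>UNIV. cnj (x i) * X p $ i $ j * x j) = (\<Sum>a\<in>UNIV. (cmod ((B *v y) $ a))\<^sup>2)"
        by simp
      have "y \<noteq> 0" using that by (auto simp: y_def vec_eq_iff)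
      have "B *v y \<noteq> 0"
      proof
        assume "B *v y = 0"
        then have "matrix_inv B *v (B *v y) = 0" by simp
        with \<open>y \<noteq> 0\<close> show False
          by (simp add: matrix_vector_mul_assoc matrix_inv_left_right[OF B(1)])
      qed
      then obtain a where "(B *v y) $ a \<noteq> 0" by (auto simp: vec_eq_iff)
      then show ?thesis
        unfolding eq by (intro sum_pos2[of _ a]) auto
    qed
    then show ?case
      by (simp add: posdef_on_def) (simp add: entry mult.commute)
  qed
  then have "\<exists>V :: complex \<Rightarrow> 'n \<Rightarrow> 'n \<Rightarrow> complex. (\<forall>a j. (\<lambda>z. V z a j) meromorphic_on circle) \<and>
      eventually (\<lambda>p. \<forall>i j. X p $ i $ j = (\<Sum>a\<in>UNIV. cnj (V p a i) * V p a j)) generic_circle"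
    using posdef_on_factorization[of UNIV "\<lambda>z i j. X z $ i $ j"] X
    by (simp add: mat_meromorphic_on_def)
  then obtain V :: "complex \<Rightarrow> 'n \<Rightarrow> 'n \<Rightarrow> complex"
    where V: "\<And>a j. (\<lambda>z. V z a j) meromorphic_on circle"
    "eventually (\<lambda>p. \<forall>i j. X p $ i $ j = (\<Sum>a\<in>UNIV. cnj (V p a i) * V p a j)) generic_circle"
    by auto
  show ?thesis
  proof (rule that)
    show "mat_meromorphic_on (\<lambda>z. \<chi> a j. V z a j) circle"
      using V(1) by (simp add: mat_meromorphic_on_def)
    show "eventually (\<lambda>p. X p = ctranspose (\<chi> a j. V p a j) ** (\<chi> a j. V p a j)) generic_circle"
      using V(2) by (rule eventually_mono) (simp add: vec_eq_iff matrix_matrix_mult_def ctranspose_def)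
  qed
qed

section \<open>Unitary matrices and invariant Hermitian forms\<close>

lemma ctranspose_mult: "ctranspose (A ** B) = ctranspose B ** ctranspose A"
  by (simp add: ctranspose_def matrix_matrix_mult_def vec_eq_iff mult.commute)

lemma ctranspose_mat: "ctranspose (mat c) = mat (cnj c)"
  by (simp add: ctranspose_def mat_def vec_eq_iff)

lemma det_ctranspose: "det (ctranspose A) = cnj (det A)"
proof -
  have "ctranspose A = transpose (\<chi> i j. cnj (A $ i $ j))"
    by (simp add: ctranspose_def transpose_def)
  then have "det (ctranspose A) = det (\<chi> i j. cnj (A $ i $ j))"
    by simp
  also have "\<dots> = cnj (det A)"
    by (simp add: det_def)
  finally show ?thesis .
qed

lemma mat_scalar_entry: "(mat c ** A) $ i $ j = c * A $ i $ j" for A :: "complex^'n^'n"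
  by (simp add: matrix_matrix_mult_def mat_def if_distrib[of "\<lambda>t. t * _"] cong: if_cong)

lemma mat_scalar_commute: "A ** mat c = mat c ** A" for A :: "complex^'n^'n"
  unfolding vec_eq_iff mat_scalar_entry
  by (simp add: matrix_matrix_mult_def mat_def if_distrib[of "\<lambda>t. _ * t"] mult.commute cong: if_cong)

lemma mat_mult_mat: "mat c ** mat d = (mat (c * d) :: complex^'n^'n)"
  unfolding vec_eq_iff mat_scalar_entry by (simp add: mat_def)

lemma det_scalar_mult: "det (mat c ** A) = c ^ CARD('n) * det A" for A :: "complex^'n^'n"
proof -
  have "mat c ** A = (\<chi> i. c *s A $ i)"
    unfolding vec_eq_iff mat_scalar_entry by simp
  then show ?thesis
    using det_rows_mul[of "\<lambda>_. c" "\<lambda>i. A $ i"] by simp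
qed

lemma SU_I:
  fixes A :: "complex^'n^'n"
  assumes "ctranspose A ** A = mat 1" "det A = 1"
  shows "A \<in> SU"
  using assms matrix_left_right_inverse[of A "ctranspose A"] by (auto simp: SU_def)

lemma SU_entry_le_1:
  assumes "A \<in> SU"
  shows "cmod (A $ i $ j) \<le> 1"
proof -
  have "(A ** ctranspose A) $ i $ i = 1"
    using assms by (simp add: SU_def mat_def)
  then have "complex_of_real (\<Sum>k\<in>UNIV. (cmod (A $ i $ k))\<^sup>2) = 1"
    by (simp add: matrix_matrix_mult_def ctranspose_def complex_norm_square del: of_real_power)
  then have "(\<Sum>k\<in>UNIV. (cmod (A $ i $ k))\<^sup>2) = 1"
    by (simp only: of_real_eq_1_iff)
  then have "(cmod (A $ i $ j))\<^sup>2 \<le> 1"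
    using member_le_sum[of j UNIV "\<lambda>k. (cmod (A $ i $ k))\<^sup>2"] by simp
  then show ?thesis
    by (simp add: abs_square_le_1[of "cmod (A $ i $ j)", simplified] power_le_one_iff)
qed

text \<open>Closedness lets unitarity pass from the generic points of the circle to all of them.\<close>
lemma closed_SU: "closed (SU :: (complex^'n^'n) set)"
proof -
  have "SU = {A :: complex^'n^'n. (\<forall>i j. (A ** ctranspose A) $ i $ j = mat 1 $ i $ j) \<and>
      (\<forall>i j. (ctranspose A ** A) $ i $ j = mat 1 $ i $ j) \<and> det A = 1}"
    by (auto simp: SU_def vec_eq_iff)
  also have "closed \<dots>"
    unfolding matrix_matrix_mult_def ctranspose_def det_def
    by (intro closed_Collect_conj closed_Collect_all closed_Collect_eq)
       (simp_all, intro continuous_intros, auto intro!: continuous_intros)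
  finally show ?thesis .
qed

lemma SU_by_continuity:
  assumes G: "mat_analytic_on G circle" and gen: "eventually (\<lambda>p. G p \<in> SU) generic_circle"
  shows "G ` circle \<subseteq> SU"
proof clarify
  fix p :: complex assume p: "p \<in> circle"
  have "((\<lambda>z. G z) \<longlongrightarrow> G p) (at p within circle)"
  proof (intro vec_tendstoI)
    fix i j
    have "(\<lambda>z. G z $ i $ j) analytic_on {p}"
      using G p analytic_on_analytic_at unfolding mat_analytic_on_def by blast
    then show "((\<lambda>z. G z $ i $ j) \<longlongrightarrow> G p $ i $ j) (at p within circle)"
      using analytic_at_imp_isCont continuous_at_imp_continuous_at_within continuous_within by blast
  qed
  then show "G p \<in> SU"
    by (rule Lim_in_closed_set[OF closed_SU eventually_generic_circle_at[OF gen p] at_within_circle_neq_bot[OF p]])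
qed

text \<open>
  This lemma and the next are the dictionary between unitarizing matrices \<open>V\<close> and invariant
  positive definite forms \<open>V\<^sup>* V\<close>.
\<close>
lemma unitarized_imp_invariant_form:
  fixes V M :: "complex^'n^'n"
  assumes V: "det V \<noteq> 0" and U: "V ** M ** matrix_inv V \<in> SU"
  shows "ctranspose M ** (ctranspose V ** V) ** M = ctranspose V ** V"
proof -
  define N where "N = V ** M ** matrix_inv V"
  have VM: "V ** M = N ** V"
    unfolding N_def using matrix_inv_left_right(1)[OF V] by (metis matrix_mul_assoc matrix_mul_rid)
  have "ctranspose M ** (ctranspose V ** V) ** M = ctranspose (V ** M) ** (V ** M)"
    by (simp add: ctranspose_mult matrix_mul_assoc)
  also have "\<dots> = ctranspose V ** (ctranspose N ** N) ** V"
    unfolding VM by (simp add: ctranspose_mult matrix_mul_assoc)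
  also have "ctranspose N ** N = mat 1"
    using U by (simp add: SU_def N_def)
  finally show ?thesis by simp
qed

lemma invariant_form_imp_unitarized:
  fixes V M :: "complex^'n^'n"
  assumes V: "det V \<noteq> 0" and M: "det M = 1"
    and inv: "ctranspose M ** (ctranspose V ** V) ** M = ctranspose V ** V"
  shows "V ** M ** matrix_inv V \<in> SU"
proof (rule SU_I)
  define W where "W = matrix_inv V"
  have W: "V ** W = mat 1" "W ** V = mat 1"
    using matrix_inv_left_right[OF V] by (simp_all add: W_def)
  have "ctranspose (V ** M ** W) ** (V ** M ** W)
      = ctranspose W ** (ctranspose M ** (ctranspose V ** V) ** M) ** W"
    by (simp add: ctranspose_mult matrix_mul_assoc)
  also have "\<dots> = ctranspose (V ** W) ** (V ** W)"
    unfolding inv by (simp add: ctranspose_mult matrix_mul_assoc)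
  finally show "ctranspose (V ** M ** matrix_inv V) ** (V ** M ** matrix_inv V) = mat 1"
    by (simp add: W W_def[symmetric] ctranspose_mat)
  have "det V * det W = 1" using W(1) by (metis det_mul det_I)
  then show "det (V ** M ** matrix_inv V) = 1"
    by (simp add: det_mul M W_def[symmetric])
qed

lemma conj_by_scalar_multiple:
  fixes V M :: "complex^'n^'n"
  assumes V: "det V \<noteq> 0" and c: "c \<noteq> 0"
  shows "(mat c ** V) ** M ** matrix_inv (mat c ** V) = V ** M ** matrix_inv V"
proof -
  have "(matrix_inv V ** mat (1 / c)) ** (mat c ** V) = matrix_inv V ** (mat (1 / c) ** mat c) ** V"
    by (simp add: matrix_mul_assoc)
  also have "\<dots> = mat 1"
    using c by (simp add: mat_mult_mat matrix_inv_left_right[OF V])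
  finally have "matrix_inv (mat c ** V) = matrix_inv V ** mat (1 / c)"
    by (rule left_inverse_imp_matrix_inv)
  then have "(mat c ** V) ** M ** matrix_inv (mat c ** V) = mat c ** (V ** M ** matrix_inv V ** mat (1 / c))"
    by (simp add: matrix_mul_assoc)
  also have "\<dots> = (mat c ** mat (1 / c)) ** (V ** M ** matrix_inv V)"
    by (simp only: mat_scalar_commute[of "V ** M ** matrix_inv V"] matrix_mul_assoc)
  also have "\<dots> = V ** M ** matrix_inv V"
    using c by (simp add: mat_mult_mat)
  finally show ?thesis .
qed

lemma gram_matrix_diagonal_pos:
  fixes V :: "complex^'n^'n"
  assumes V: "det V \<noteq> 0"
  shows "\<exists>t>0. (ctranspose V ** V) $ a $ a = complex_of_real t"
proof -
  have "(ctranspose V ** V) $ a $ a = of_real (\<Sum>b\<in>UNIV. (cmod (V $ b $ a))\<^sup>2)"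
    by (simp add: matrix_matrix_mult_def ctranspose_def complex_norm_square mult.commute del: of_real_power)
  moreover have "\<exists>b. V $ b $ a \<noteq> 0"
  proof (rule ccontr)
    assume "\<not> (\<exists>b. V $ b $ a \<noteq> 0)"
    then have "column a V = 0" by (simp add: column_def vec_eq_iff)
    then show False using V det_zero_column(1)[of a V] by simp
  qed
  then have "0 < (\<Sum>b\<in>UNIV. (cmod (V $ b $ a))\<^sup>2)"
    by (auto intro!: sum_pos2)
  ultimately show ?thesis by blast
qed

text \<open>If the zeros accumulated at a point of the circle, \<open>g\<close> would vanish identically near that point.\<close>
lemma generic_nonzero_imp_cosparse:
  assumes g: "g meromorphic_on circle" and gen: "eventually (\<lambda>p. g p \<noteq> 0) generic_circle"
  shows "eventually (\<lambda>z. g z \<noteq> 0) (cosparse circle)"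
  unfolding eventually_cosparse_iff_at
proof (intro ballI, rule ccontr)
  fix p assume p: "p \<in> circle" and "\<not> eventually (\<lambda>z. g z \<noteq> 0) (at p)"
  then have "frequently (\<lambda>z. g z = 0) (at p)"
    by (simp add: frequently_def)
  moreover have "g meromorphic_on {p}"
    using g p meromorphic_on_subset[of g circle "{p}"] by blast
  ultimately have "eventually (\<lambda>z. g z = 0) (at p)"
    by (intro meromorphic_frequently_0_imp_eventually)
  then have "eventually (\<lambda>z. g z = 0) (at p within circle)"
    using filter_leD[OF at_le[OF subset_UNIV]] by blast
  with eventually_generic_circle_at[OF gen p] have "eventually (\<lambda>_. False) (at p within circle)"
    by eventually_elim simp
  with at_within_circle_neq_bot[OF p] show False
    by (simp add: eventually_False)
qed

lemma mat_meromorphic_analytic_cosparse: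
  assumes "mat_meromorphic_on A circle"
  shows "eventually (\<lambda>z. mat_analytic_on A {z}) (cosparse circle)"
  using assms unfolding mat_meromorphic_on_def mat_analytic_on_def
  by (simp add: eventually_all_finite meromorphic_on_imp_analytic_cosparse)

lemma mat_analytic_on_pointwise: "mat_analytic_on A S \<longleftrightarrow> (\<forall>z\<in>S. mat_analytic_on A {z})"
  unfolding mat_analytic_on_def by (meson analytic_on_analytic_at)

lemma mat_analytic_imp_holomorphic: "mat_analytic_on A S \<Longrightarrow> mat_holomorphic_on A S"
  by (auto simp: mat_analytic_on_def mat_holomorphic_on_def analytic_imp_holomorphic)

definition mat_reflect :: "(complex \<Rightarrow> complex^'n^'n) \<Rightarrow> complex \<Rightarrow> complex^'n^'n" where
  "mat_reflect A z = ctranspose (A (1 / cnj z))"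

lemma mat_reflect_on_circle: "z \<in> circle \<Longrightarrow> mat_reflect A z = ctranspose (A z)"
  by (simp add: mat_reflect_def complex_div_cnj[of 1 "cnj z"])

lemma mat_reflect_analytic:
  assumes "mat_analytic_on A circle"
  shows "mat_analytic_on (mat_reflect A) circle"
  unfolding mat_analytic_on_def
proof (intro allI)
  fix i j
  have "(\<lambda>z. mat_reflect A z $ i $ j) = circle_reflect (\<lambda>z. A z $ j $ i)"
    by (simp add: fun_eq_iff mat_reflect_def circle_reflect_def ctranspose_def)
  then show "(\<lambda>z. mat_reflect A z $ i $ j) analytic_on circle"
    using assms by (simp add: circle_reflect_analytic mat_analytic_on_def)
qed

lemma circle_identity_imp_cosparse:
  assumes "f analytic_on circle" "g analytic_on circle" "\<And>z. z \<in> circle \<Longrightarrow> f z = g z"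
  shows "eventually (\<lambda>z. f z = g z) (cosparse circle)"
  unfolding eventually_cosparse_iff_at
proof
  fix p assume p: "p \<in> circle"
  have "eventually (\<lambda>z. f z = g z) (at p within circle)"
    using assms(3) by (auto simp: eventually_at_filter)
  then have "eventually (\<lambda>z. f z = g z) (nhds p)"
    using assms(1,2) p at_within_circle_neq_bot[OF p]
    by (intro analytic_eq_within_imp_eq[of f p g circle]) (use analytic_on_analytic_at in blast)+
  then show "eventually (\<lambda>z. f z = g z) (at p)"
    by (simp add: eventually_nhds_conv_at)
qed

section \<open>Existence of unitarizers\<close>

text \<open>
  Three matrix functions share the form \<open>X = V\<^sup>* V\<close> up to scalars: \<open>V0\<close> comes from the factorization
  of the normalized invariant form \<open>Y\<close>; \<open>V\<close> is \<open>V0\<close> with one row multiplied by a scalar that is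
  unimodular on the circle, so that \<open>det V = f\<close> has the \<open>n\<close>-th root \<open>\<phi>\<close>; and \<open>W = V / \<phi>\<close> has
  determinant 1. The first two are meromorphic near the circle, \<open>W\<close> is defined in the closed disc
  near the circle. Conjugation by \<open>W\<close> and by \<open>V\<close> is the same.
\<close>
lemma pointwise_imp_simultaneously_unitarizable:
  fixes M :: "nat \<Rightarrow> complex \<Rightarrow> complex^'n^'n"
  assumes ana: "\<And>k. k \<in> {1..q} \<Longrightarrow> circle_analytic (M k)"
    and SL: "\<And>k. k \<in> {1..q} \<Longrightarrow> M k ` circle \<subseteq> SL"
    and ij: "i \<in> {1..q}" "j \<in> {1..q}"
    and irr: "eventually (\<lambda>p. \<not> reducible_pair (M i p) (M j p)) generic_circle"
    and pw: "eventually (\<lambda>p. pointwise_unitarizable_at q M p) generic_circle"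
  shows "\<exists>r\<in>{0<..<1}. simultaneously_unitarizable r q M"
proof -
  have "\<exists>G. mat_analytic_on G circle \<and> (\<forall>z\<in>circle. G z = M k z)" if "k \<in> {1..q}" for k
    using circle_analytic_extension[OF ana[OF that]] by metis
  then obtain Mt where Mt: "\<And>k. k \<in> {1..q} \<Longrightarrow> mat_analytic_on (Mt k) circle"
      "\<And>k z. k \<in> {1..q} \<Longrightarrow> z \<in> circle \<Longrightarrow> Mt k z = M k z"
    by metis
  have detM: "det (M k z) = 1" if "k \<in> {1..q}" "z \<in> circle" for k z
    using SL[OF that(1)] that(2) unfolding SL_def by blast
  define good where "good = (\<lambda>p. p \<in> circle \<and> \<not> reducible_pair (M i p) (M j p) \<and> pointwise_unitarizable_at q M p)"
  have ev_good: "eventually good generic_circle"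
    using irr pw eventually_generic_in_circle unfolding good_def by eventually_elim blast
  obtain p0 where p0: "good p0"
    using eventually_happens[OF ev_good] generic_circle_neq_bot by blast
  obtain a :: 'n where True by simp
  have form: "\<exists>B. det B \<noteq> 0 \<and>
      (\<forall>k\<in>{1..q}. ctranspose (M k p) ** (ctranspose B ** B) ** M k p = ctranspose B ** B) \<and>
      (\<exists>t>0. (ctranspose B ** B) $ a $ a = of_real t) \<and>
      (\<forall>Y. (\<forall>k\<in>{1..q}. ctranspose (M k p) ** Y ** M k p = Y) \<longrightarrow> (\<exists>c. Y = mat c ** (ctranspose B ** B)))"
    if p: "good p" for p
  proof -
    obtain V where V: "V \<in> SL" "\<And>k. k \<in> {1..q} \<Longrightarrow> V ** M k p ** matrix_inv V \<in> SU"
      using p unfolding good_def pointwise_unitarizable_at_def by blast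
    have dV: "det V \<noteq> 0" using V(1) by (simp add: SL_def)
    have inv: "ctranspose (M k p) ** (ctranspose V ** V) ** M k p = ctranspose V ** V" if "k \<in> {1..q}" for k
      by (rule unitarized_imp_invariant_form[OF dV V(2)[OF that]])
    have dX: "det (ctranspose V ** V) \<noteq> 0"
      using dV by (simp add: det_mul det_ctranspose)
    have "\<exists>c. Y = mat c ** (ctranspose V ** V)"
      if "\<forall>k\<in>{1..q}. ctranspose (M k p) ** Y ** M k p = Y" for Y
      by (rule intertwiner_unique[of "\<lambda>k. M k p" i j "\<lambda>k. ctranspose (M k p)" "ctranspose V ** V" Y])
         (use p ij that inv dX in \<open>auto simp: good_def\<close>)
    with dV inv gram_matrix_diagonal_pos[OF dV] show ?thesis by blast
  qed
  have refl_an: "mat_analytic_on (mat_reflect (Mt k)) circle" if "k \<in> {1..q}" for k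
    by (rule mat_reflect_analytic[OF Mt(1)[OF that]])
  have Mt_refl: "mat_reflect (Mt k) p = ctranspose (M k p)" if "p \<in> circle" "k \<in> {1..q}" for k p
    using that by (simp add: mat_reflect_on_circle Mt(2))
  have p0c: "p0 \<in> circle" using p0 by (simp add: good_def)
  \<comment> \<open>An invariant form at \<open>p0\<close> is a multiple of a positive definite one, whose diagonal entries do not vanish.\<close>
  have ker0: "Y = 0" if Y: "\<And>k. k \<in> {1..q} \<Longrightarrow> mat_reflect (Mt k) p0 ** Y ** Mt k p0 = Y" "Y $ a $ a = 0" for Y
  proof -
    have Y': "\<forall>k\<in>{1..q}. ctranspose (M k p0) ** Y ** M k p0 = Y"
      using Y(1) Mt(2) Mt_refl p0c by metis
    from form[OF p0] obtain B t where B: "t > 0" "(ctranspose B ** B) $ a $ a = complex_of_real t"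
      "\<forall>Y. (\<forall>k\<in>{1..q}. ctranspose (M k p0) ** Y ** M k p0 = Y) \<longrightarrow> (\<exists>c. Y = mat c ** (ctranspose B ** B))"
      by blast
    then obtain c where c: "Y = mat c ** (ctranspose B ** B)" using Y' by blast
    then have "c * complex_of_real t = 0"
      using Y(2) B(2) by (simp add: mat_scalar_entry)
    then have "c = 0" using B(1) by simp
    then show "Y = 0"
      unfolding c vec_eq_iff mat_scalar_entry by simp
  qed
  obtain Y where Y: "mat_meromorphic_on Y circle"
    "eventually (\<lambda>z. \<forall>X. (\<forall>k\<in>{1..q}. mat_reflect (Mt k) z ** X ** Mt k z = X) \<longrightarrow> X = mat (X $ a $ a) ** Y z) (cosparse circle)"
    by (rule meromorphic_intertwiner[of "{1..q}" "\<lambda>k. mat_reflect (Mt k)" Mt p0 a a])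
       (use Mt(1) refl_an p0c ker0 in \<open>blast intro: finite_atLeastAtMost\<close>)+
  \<comment> \<open>The solution with \<open>(a, a)\<close> entry 1 is a positive multiple of a pointwise form, hence again a Gram matrix.\<close>
  have Y_form: "eventually (\<lambda>p. \<exists>B. det B \<noteq> 0 \<and> Y p = ctranspose B ** B \<and>
      (\<forall>k\<in>{1..q}. ctranspose (M k p) ** Y p ** M k p = Y p)) generic_circle"
    using ev_good eventually_cosparse_imp_generic[OF Y(2)]
  proof eventually_elim
    case (elim p)
    then have pc: "p \<in> circle" by (simp add: good_def)
    from form[OF elim(1)] obtain B t where B: "det B \<noteq> 0"
      "\<forall>k\<in>{1..q}. ctranspose (M k p) ** (ctranspose B ** B) ** M k p = ctranspose B ** B"
      "t > 0" "(ctranspose B ** B) $ a $ a = complex_of_real t"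
      by blast
    have "\<forall>k\<in>{1..q}. mat_reflect (Mt k) p ** (ctranspose B ** B) ** Mt k p = ctranspose B ** B"
      using B(2) Mt(2) Mt_refl pc by simp
    then have XY: "ctranspose B ** B = mat (of_real t) ** Y p"
      using elim(2) B(4) by metis
    define s where "s = complex_of_real (1 / sqrt t)"
    have s: "s * s = of_real (1 / t)" "cnj s = s"
      using B(3) by (simp_all add: s_def flip: of_real_mult)
    have "mat (of_real (1 / t)) ** (ctranspose B ** B) = mat (of_real (1 / t) * of_real t) ** Y p"
      unfolding XY by (simp add: matrix_mul_assoc mat_mult_mat)
    then have Yp: "Y p = mat (of_real (1 / t)) ** (ctranspose B ** B)"
      using B(3) by (simp flip: of_real_mult)
    also have "\<dots> = ctranspose (mat s ** B) ** (mat s ** B)"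
    proof -
      have "ctranspose (mat s ** B) ** (mat s ** B) = ctranspose B ** (mat s ** mat s) ** B"
        by (simp add: ctranspose_mult ctranspose_mat s matrix_mul_assoc)
      also have "\<dots> = mat (of_real (1 / t)) ** (ctranspose B ** B)"
        by (simp only: mat_mult_mat s(1) mat_scalar_commute[of "ctranspose B"] matrix_mul_assoc)
      finally show ?thesis by simp
    qed
    finally have "Y p = ctranspose (mat s ** B) ** (mat s ** B)" .
    moreover have "det (mat s ** B) \<noteq> 0"
      using B(1,3) by (simp add: det_scalar_mult s_def)
    moreover have "ctranspose (M k p) ** Y p ** M k p = Y p" if "k \<in> {1..q}" for k
    proof -
      have "ctranspose (M k p) ** Y p ** M k p
          = mat (of_real (1 / t)) ** (ctranspose (M k p) ** (ctranspose B ** B) ** M k p)"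
        unfolding Yp by (simp only: matrix_mul_assoc mat_scalar_commute[of "ctranspose (M k p)"])
      also have "\<dots> = Y p"
        using B(2) that Yp by simp
      finally show ?thesis .
    qed
    ultimately show ?case by blast
  qed
  then have "eventually (\<lambda>p. \<exists>B. det B \<noteq> 0 \<and> Y p = ctranspose B ** B) generic_circle"
    by (rule eventually_mono) blast
  then obtain V0 where V0: "mat_meromorphic_on V0 circle" "eventually (\<lambda>p. Y p = ctranspose (V0 p) ** V0 p) generic_circle"
    by (rule positive_definite_factorization[OF Y(1)])
  have V0_form: "eventually (\<lambda>p. det (V0 p) \<noteq> 0 \<and>
      (\<forall>k\<in>{1..q}. ctranspose (M k p) ** (ctranspose (V0 p) ** V0 p) ** M k p = ctranspose (V0 p) ** V0 p)) generic_circle"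
    using Y_form V0(2)
  proof eventually_elim
    case (elim p)
    then obtain B where B: "det B \<noteq> 0" "Y p = ctranspose B ** B" by blast
    then have "det (Y p) \<noteq> 0" by (simp add: det_mul det_ctranspose)
    then have "det (V0 p) \<noteq> 0" using elim(2) by (auto simp: det_mul)
    with elim show ?case by auto
  qed
  have detV0_mero: "(\<lambda>z. det (V0 z)) meromorphic_on circle"
    using V0(1) by (intro det_meromorphic) (simp add: mat_meromorphic_on_def)
  have "eventually (\<lambda>p. det (V0 p) \<noteq> 0) generic_circle"
    using V0_form by (rule eventually_mono) blast
  then have detV0_nz: "eventually (\<lambda>z. det (V0 z) \<noteq> 0) (cosparse circle)"
    by (rule generic_nonzero_imp_cosparse[OF detV0_mero])
  have detY_mero: "(\<lambda>z. det (Y z)) meromorphic_on circle"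
    using Y(1) by (intro det_meromorphic) (simp add: mat_meromorphic_on_def)
  have detY: "eventually (\<lambda>p. det (Y p) = of_real ((cmod (det (V0 p)))\<^sup>2)) generic_circle"
    using V0(2) by (rule eventually_mono) (simp add: det_mul det_ctranspose complex_norm_square mult.commute del: of_real_power)
  have "eventually (\<lambda>p. pos_real (det (Y p))) generic_circle"
    using detY V0_form unfolding pos_real_def
    by eventually_elim (metis norm_eq_zero zero_less_power2)
  then obtain f \<phi> where f: "f meromorphic_on circle" "eventually (\<lambda>p. of_real ((cmod (f p))\<^sup>2) = det (Y p)) generic_circle"
    and \<phi>: "eventually (\<lambda>z. cmod z \<le> 1 \<longrightarrow> \<phi> analytic_on {z} \<and> \<phi> z \<noteq> 0 \<and> \<phi> z ^ CARD('n) = f z) (cosparse circle)"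
    by (rule positive_circle_factorization[OF zero_less_card_finite detY_mero])
  \<comment> \<open>On the circle \<open>\<bar>f\<bar>\<^sup>2 = det Y = \<bar>det V0\<bar>\<^sup>2\<close>, so the quotient \<open>f / det V0\<close> has modulus 1 there.\<close>
  define c where "c = (\<lambda>z b. if b = a then f z / det (V0 z) else 1)"
  define V where "V = (\<lambda>z. (\<chi> b. c z b *s V0 z $ b) :: complex^'n^'n)"
  have V_mero: "mat_meromorphic_on V circle"
  proof -
    have "(\<lambda>z. c z b) meromorphic_on circle" for b
      unfolding c_def by (cases "b = a") (auto intro!: meromorphic_intros f(1) detV0_mero)
    then show ?thesis
      using V0(1) unfolding mat_meromorphic_on_def V_def
      by (auto intro!: meromorphic_intros)
  qed
  have detV: "eventually (\<lambda>z. det (V z) = f z) (cosparse circle)"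
    using detV0_nz
  proof eventually_elim
    case (elim z)
    have "det (V z) = prod (c z) UNIV * det (V0 z)"
      unfolding V_def using det_rows_mul[of "c z" "\<lambda>b. V0 z $ b"] by simp
    also have "prod (c z) UNIV = f z / det (V0 z)"
      by (simp add: c_def prod.delta)
    finally show ?case using elim by simp
  qed
  have V_form: "eventually (\<lambda>p. det (V p) \<noteq> 0 \<and>
      (\<forall>k\<in>{1..q}. ctranspose (M k p) ** (ctranspose (V p) ** V p) ** M k p = ctranspose (V p) ** V p)) generic_circle"
    using V0_form f(2) detY eventually_cosparse_imp_generic[OF detV]
  proof eventually_elim
    case (elim p)
    have "complex_of_real ((cmod (f p))\<^sup>2) = of_real ((cmod (det (V0 p)))\<^sup>2)"
      using elim by simp
    then have "(cmod (f p))\<^sup>2 = (cmod (det (V0 p)))\<^sup>2"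
      by (simp only: of_real_eq_iff)
    then have nf: "cmod (f p) = cmod (det (V0 p))"
      by (simp add: power2_eq_iff_nonneg)
    then have "f p \<noteq> 0" using elim(1) by auto
    have "cmod (c p b) = 1" for b
      using nf elim(1) by (simp add: c_def norm_divide)
    then have "cnj (c p b) * c p b = 1" for b
      using complex_norm_square[of "c p b"] by (simp add: mult.commute)
    then have unit: "cnj (c p b * x) * (c p b * y) = cnj x * y" for b x y
      by (metis (no_types, opaque_lifting) complex_cnj_mult mult.assoc mult.left_commute mult_1)
    have "ctranspose (V p) ** V p = ctranspose (V0 p) ** V0 p"
      by (simp add: vec_eq_iff matrix_matrix_mult_def ctranspose_def V_def unit del: complex_cnj_mult)
    with elim(1,4) \<open>f p \<noteq> 0\<close> show ?case by simp
  qed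
  define N where "N = (\<lambda>k z. V z ** Mt k z ** matrix_inv (V z))"
  have detV_mero: "(\<lambda>z. det (V z)) meromorphic_on circle"
    using V_mero by (intro det_meromorphic) (simp add: mat_meromorphic_on_def)
  have "eventually (\<lambda>p. det (V p) \<noteq> 0) generic_circle"
    using V_form by (rule eventually_mono) blast
  then have detV_nz: "eventually (\<lambda>z. det (V z) \<noteq> 0) (cosparse circle)"
    by (rule generic_nonzero_imp_cosparse[OF detV_mero])
  have N_mero: "mat_meromorphic_on (N k) circle" if "k \<in> {1..q}" for k
    unfolding N_def
    by (intro mat_meromorphic_mult mat_meromorphic_inv V_mero detV_nz mat_analytic_imp_meromorphic Mt(1) that)
  have N_SU: "eventually (\<lambda>p. N k p \<in> SU) generic_circle" if k: "k \<in> {1..q}" for k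
    using V_form eventually_generic_in_circle
  proof eventually_elim
    case (elim p)
    then show ?case
      using invariant_form_imp_unitarized[of "V p" "M k p"] detM[OF k] k by (simp add: N_def Mt(2))
  qed
  \<comment> \<open>Unitarity bounds the meromorphic functions \<open>N k\<close> on the circle, so they extend across it.\<close>
  define G where "G = (\<lambda>k z. (\<chi> b d. remove_sings (\<lambda>w. N k w $ b $ d) z) :: complex^'n^'n)"
  have G_circle: "mat_analytic_on (G k) circle" if k: "k \<in> {1..q}" for k
    unfolding mat_analytic_on_def
  proof (intro allI)
    fix b d
    have "remove_sings (\<lambda>w. N k w $ b $ d) analytic_on {p}" if p: "p \<in> circle" for p
    proof (rule meromorphic_bounded_imp_removable[OF _ at_within_circle_neq_bot[OF p]])
      show "(\<lambda>w. N k w $ b $ d) meromorphic_on {p}"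
        using N_mero[OF k] p meromorphic_on_subset[of _ circle "{p}"] unfolding mat_meromorphic_on_def by blast
      show "eventually (\<lambda>w. cmod (N k w $ b $ d) \<le> 1) (at p within circle)"
        using eventually_generic_circle_at[OF N_SU[OF k] p] by (rule eventually_mono) (rule SU_entry_le_1)
    qed
    then have "remove_sings (\<lambda>w. N k w $ b $ d) analytic_on circle"
      by (subst analytic_on_analytic_at) blast
    then show "(\<lambda>z. G k z $ b $ d) analytic_on circle"
      by (simp add: G_def)
  qed
  have G_N: "G k z = N k z" if "mat_analytic_on (N k) {z}" for k z
    using that by (simp add: G_def vec_eq_iff mat_analytic_on_def)
  have G_SU: "G k ` circle \<subseteq> SU" if k: "k \<in> {1..q}" for k
  proof (rule SU_by_continuity[OF G_circle[OF k]])
    show "eventually (\<lambda>p. G k p \<in> SU) generic_circle"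
      using N_SU[OF k] eventually_cosparse_imp_generic[OF mat_meromorphic_analytic_cosparse[OF N_mero[OF k]]]
      by eventually_elim (simp add: G_N)
  qed
  have detMt: "eventually (\<lambda>z. det (Mt k z) = 1) (cosparse circle)" if k: "k \<in> {1..q}" for k
    by (rule circle_identity_imp_cosparse)
       (use Mt k detM in \<open>auto simp: mat_analytic_on_def intro!: det_analytic\<close>)
  define Q where "Q = (\<lambda>z. (cmod z \<le> 1 \<longrightarrow> \<phi> analytic_on {z} \<and> \<phi> z \<noteq> 0 \<and> \<phi> z ^ CARD('n) = f z) \<and>
      mat_analytic_on V {z} \<and> det (V z) = f z \<and> det (V z) \<noteq> 0 \<and>
      (\<forall>k\<in>{1..q}. mat_analytic_on (N k) {z} \<and> mat_analytic_on (Mt k) {z} \<and> det (Mt k z) = 1))"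
  have "eventually Q (cosparse circle)"
    unfolding Q_def
    by (intro eventually_conj eventually_ball_finite finite_atLeastAtMost ballI \<phi> detV detV_nz detMt
        mat_meromorphic_analytic_cosparse[OF V_mero] mat_meromorphic_analytic_cosparse[OF N_mero]
        mat_meromorphic_analytic_cosparse[OF mat_analytic_imp_meromorphic[OF Mt(1)]])
  then obtain r P where r: "0 < r" "r < 1" "finite P" "P \<subseteq> circle"
    and near: "\<And>z. r < cmod z \<Longrightarrow> cmod z < 1 / r \<Longrightarrow> z \<notin> P \<Longrightarrow> Q z"
    by (rule eventually_cosparse_circle_annulus) blast
  have near_z: "\<phi> analytic_on {z} \<and> \<phi> z \<noteq> 0 \<and> \<phi> z ^ CARD('n) = f z \<and>
      mat_analytic_on V {z} \<and> det (V z) = f z \<and> det (V z) \<noteq> 0 \<and>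
      (\<forall>k\<in>{1..q}. mat_analytic_on (N k) {z} \<and> mat_analytic_on (Mt k) {z} \<and> det (Mt k z) = 1)"
    if "z \<in> annulus r 1 \<union> (circle - P)" for z
  proof -
    have "r < cmod z" "cmod z \<le> 1" "z \<notin> P"
      using that r(2,4) by (auto simp: annulus_def)
    moreover have "1 < 1 / r" using r by simp
    ultimately show ?thesis using near[of z] unfolding Q_def by fastforce
  qed
  define W where "W = (\<lambda>z. mat (1 / \<phi> z) ** V z)"
  have W_an: "mat_analytic_on W (annulus r 1 \<union> (circle - P))"
  proof (rule mat_analytic_on_pointwise[THEN iffD2], rule ballI)
    fix z assume "z \<in> annulus r 1 \<union> (circle - P)"
    from near_z[OF this] show "mat_analytic_on W {z}"
      unfolding mat_analytic_on_def W_def mat_scalar_entry by (auto intro!: analytic_intros)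
  qed
  have W_SL: "det (W z) = 1" if "z \<in> annulus r 1" for z
    using near_z[of z] that by (auto simp: W_def det_scalar_mult power_divide)
  have "unitarizer r q M W"
    unfolding unitarizer_def
  proof (intro conjI exI ballI)
    show "mat_holomorphic_on W (annulus r 1)"
      using mat_analytic_imp_holomorphic[OF W_an] unfolding mat_holomorphic_on_def
      by (meson holomorphic_on_subset sup_ge1)
    show "W ` annulus r 1 \<subseteq> SL"
      using W_SL by (auto simp: SL_def)
    show "holomorphic_extension (annulus r 1) W (circle - P) W"
      using W_an by (simp add: holomorphic_extension_def)
    fix k assume k: "k \<in> {1..q}"
    have Mt_an: "mat_analytic_on (Mt k) (annulus r 1 \<union> circle)"
      using near_z Mt(1)[OF k, THEN mat_analytic_on_pointwise[THEN iffD1]] k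
      by (intro mat_analytic_on_pointwise[THEN iffD2]) blast
    show "extends_to_annulus r (M k) (Mt k)"
      unfolding extends_to_annulus_def holomorphic_extension_def
    proof (intro conjI exI)
      show "mat_holomorphic_on (Mt k) (annulus r 1)"
        using mat_analytic_imp_holomorphic[OF Mt_an] unfolding mat_holomorphic_on_def
        by (meson holomorphic_on_subset sup_ge1)
      show "Mt k ` annulus r 1 \<subseteq> SL"
        using near_z k by (auto simp: SL_def)
    qed (use Mt_an Mt(2) k in auto)
    have "mat_analytic_on (G k) {z}" if "z \<in> annulus r 1" for z
      using near_z[of z] that k unfolding G_def mat_analytic_on_def
      by (auto intro: remove_sings_analytic_on)
    then have G_an: "mat_analytic_on (G k) (annulus r 1 \<union> circle)"
      using G_circle[OF k, THEN mat_analytic_on_pointwise[THEN iffD1]]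
      by (intro mat_analytic_on_pointwise[THEN iffD2]) blast
    show "extends_to_SU_on_circle r (\<lambda>z. W z ** Mt k z ** matrix_inv (W z))"
      unfolding extends_to_SU_on_circle_def holomorphic_extension_def
    proof (intro exI[of _ "G k"] conjI ballI)
      show "G k z = W z ** Mt k z ** matrix_inv (W z)" if z: "z \<in> annulus r 1" for z
      proof -
        have "det (V z) \<noteq> 0" "1 / \<phi> z \<noteq> 0" "G k z = N k z"
          using near_z[of z] z k G_N[of k z] by auto
        with conj_by_scalar_multiple[of "V z" "1 / \<phi> z" "Mt k z"] show ?thesis
          by (simp add: W_def N_def)
      qed
    qed (use G_an G_SU k mat_analytic_imp_circle_analytic[OF G_circle[OF k]] in auto)
  qed (use r in auto)
  then show ?thesis
    using r unfolding simultaneously_unitarizable_def by auto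
qed

section \<open>Boundary values of unitarizers\<close>

lemma islimpt_annulus:
  assumes "p \<in> circle" "r < 1"
  shows "p islimpt annulus r 1"
  unfolding islimpt_approachable
proof (intro allI impI)
  fix e :: real assume e: "e > 0"
  define m where "m = min (e / 2) (min ((1 - r) / 2) (1 / 2))"
  have m: "0 < m" "m < e" "m < 1 - r" "m < 1"
    using e assms(2) by (auto simp: m_def min_def)
  have "cmod (of_real (1 - m) * p) = 1 - m"
    using assms(1) m by (simp only: norm_mult norm_of_real) simp
  moreover have "of_real (1 - m) * p - p = of_real (- m) * p"
    by (simp add: algebra_simps)
  then have "dist (of_real (1 - m) * p) p = m"
    using assms(1) m by (simp only: dist_norm norm_mult norm_of_real) simp
  ultimately show "\<exists>x'\<in>annulus r 1. x' \<noteq> p \<and> dist x' p < e"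
    using m by (intro bexI[of _ "of_real (1 - m) * p"]) (auto simp: annulus_def)
qed

lemma eq_on_annulus_imp_eq:
  assumes p: "p \<in> circle" and r: "r < 1" and "f analytic_on {p}" "g analytic_on {p}"
    and "\<And>z. z \<in> annulus r 1 \<Longrightarrow> f z = g z"
  shows "f p = g p"
proof -
  have "eventually (\<lambda>z. f z = g z) (nhds p)"
  proof (rule analytic_eq_within_imp_eq)
    show "at p within annulus r 1 \<noteq> bot"
      using islimpt_annulus[OF p r] trivial_limit_within by blast
    show "eventually (\<lambda>z. f z = g z) (at p within annulus r 1)"
      using assms(5) by (auto simp: eventually_at_filter)
  qed fact+
  then show ?thesis by (rule eventually_nhds_x_imp_x)
qed

lemma mat_eq_on_annulus_imp_eq:
  fixes A B :: "complex \<Rightarrow> complex^'n^'n"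
  assumes "p \<in> circle" "r < 1" "mat_analytic_on A {p}" "mat_analytic_on B {p}"
    and "\<And>z. z \<in> annulus r 1 \<Longrightarrow> A z = B z"
  shows "A p = B p"
  unfolding vec_eq_iff
proof (intro allI)
  fix i j
  show "A p $ i $ j = B p $ i $ j"
    by (rule eq_on_annulus_imp_eq[of p r "\<lambda>z. A z $ i $ j" "\<lambda>z. B z $ i $ j"])
       (use assms in \<open>auto simp: mat_analytic_on_def\<close>)
qed

lemma mat_analytic_subset: "mat_analytic_on A S \<Longrightarrow> T \<subseteq> S \<Longrightarrow> mat_analytic_on A T"
  unfolding mat_analytic_on_def using analytic_on_subset by blast

lemma mat_circle_identity_imp_cosparse:
  fixes A B :: "complex \<Rightarrow> complex^'n^'n"
  assumes "mat_analytic_on A circle" "mat_analytic_on B circle" "\<And>z. z \<in> circle \<Longrightarrow> A z = B z"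
  shows "eventually (\<lambda>z. A z = B z) (cosparse circle)"
proof -
  have "eventually (\<lambda>z. A z $ i $ j = B z $ i $ j) (cosparse circle)" for i j
    by (rule circle_identity_imp_cosparse) (use assms in \<open>auto simp: mat_analytic_on_def\<close>)
  then show ?thesis
    by (simp add: vec_eq_iff eventually_all_finite)
qed

lemma eventually_near_circle_annulus:
  assumes "r < 1"
  shows "eventually (\<lambda>z. cmod z < 1 \<longrightarrow> z \<in> annulus r 1) (cosparse circle)"
  unfolding eventually_cosparse_iff_at
proof
  fix p :: complex assume "p \<in> circle"
  then have "eventually (\<lambda>z. z \<in> {z. r < cmod z}) (at p)"
    using assms by (intro eventually_at_in_open' open_Collect_less continuous_intros) auto
  then show "eventually (\<lambda>z. cmod z < 1 \<longrightarrow> z \<in> annulus r 1) (at p)"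
    by eventually_elim (auto simp: annulus_def)
qed

text \<open>
  All the information about a unitarizer that enters the remaining proofs. The map \<open>W\<close> is the
  extension of \<open>V\<close> and \<open>N k\<close> that of \<open>V M V\<inverse>\<close>. The last conclusion uses a prescribed
  extension \<open>Mh k\<close> of \<open>M k\<close>, so that it can be compared for two unitarizers with different radii.
\<close>
lemma unitarizer_boundary_values:
  fixes M :: "nat \<Rightarrow> complex \<Rightarrow> complex^'n^'n"
  assumes V: "unitarizer r q M V"
    and Mh: "\<And>k. k \<in> {1..q} \<Longrightarrow> mat_analytic_on (Mh k) circle"
      "\<And>k z. k \<in> {1..q} \<Longrightarrow> z \<in> circle \<Longrightarrow> Mh k z = M k z"
  obtains F W N where "finite F" "F \<subseteq> circle" "mat_analytic_on W (annulus r 1 \<union> (circle - F))"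
    "\<And>z. z \<in> annulus r 1 \<Longrightarrow> W z = V z" "\<And>z. z \<in> annulus r 1 \<union> (circle - F) \<Longrightarrow> det (W z) = 1"
    "\<And>k. k \<in> {1..q} \<Longrightarrow> mat_analytic_on (N k) circle" "\<And>k. k \<in> {1..q} \<Longrightarrow> N k ` circle \<subseteq> SU"
    "\<And>k p. k \<in> {1..q} \<Longrightarrow> p \<in> circle - F \<Longrightarrow> W p ** M k p = N k p ** W p"
    "\<And>k. k \<in> {1..q} \<Longrightarrow> eventually (\<lambda>z. cmod z < 1 \<longrightarrow> V z ** Mh k z = N k z ** V z) (cosparse circle)"
proof -
  from V obtain F W Mt where r: "0 < r" "r < 1" and VSL: "V ` annulus r 1 \<subseteq> SL"
    and F: "finite F" "F \<subseteq> circle" and W: "holomorphic_extension (annulus r 1) V (circle - F) W"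
    and Mt: "\<And>k. k \<in> {1..q} \<Longrightarrow> extends_to_annulus r (M k) (Mt k)"
      "\<And>k. k \<in> {1..q} \<Longrightarrow> extends_to_SU_on_circle r (\<lambda>z. V z ** Mt k z ** matrix_inv (V z))"
    unfolding unitarizer_def by blast
  have W_an: "mat_analytic_on W (annulus r 1 \<union> (circle - F))" and WV: "\<And>z. z \<in> annulus r 1 \<Longrightarrow> W z = V z"
    using W by (auto simp: holomorphic_extension_def)
  have detV: "det (V z) = 1" if "z \<in> annulus r 1" for z
    using VSL that unfolding SL_def by blast
  have detW: "det (W z) = 1" if z: "z \<in> annulus r 1 \<union> (circle - F)" for z
  proof (cases "z \<in> annulus r 1")
    case False
    then have zc: "z \<in> circle" using z by blast
    have "(\<lambda>w. det (W w)) analytic_on {z}"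
      using mat_analytic_subset[OF W_an, of "{z}"] z by (intro det_analytic) (simp add: mat_analytic_on_def)
    then show ?thesis
      by (intro eq_on_annulus_imp_eq[OF zc r(2), of "\<lambda>w. det (W w)" "\<lambda>_. 1"]) (auto simp: WV detV)
  qed (simp add: WV detV)
  have "\<exists>G. mat_analytic_on G (annulus r 1 \<union> circle) \<and> (\<forall>z\<in>annulus r 1. G z = Mt k z) \<and> (\<forall>z\<in>circle. G z = M k z)"
    if "k \<in> {1..q}" for k
    using Mt(1)[OF that] unfolding extends_to_annulus_def holomorphic_extension_def by blast
  then obtain Gm where Gm: "\<And>k. k \<in> {1..q} \<Longrightarrow> mat_analytic_on (Gm k) (annulus r 1 \<union> circle)"
    "\<And>k z. k \<in> {1..q} \<Longrightarrow> z \<in> annulus r 1 \<Longrightarrow> Gm k z = Mt k z"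
    "\<And>k z. k \<in> {1..q} \<Longrightarrow> z \<in> circle \<Longrightarrow> Gm k z = M k z"
    by metis
  have "\<exists>G. mat_analytic_on G (annulus r 1 \<union> circle) \<and>
      (\<forall>z\<in>annulus r 1. G z = V z ** Mt k z ** matrix_inv (V z)) \<and> G ` circle \<subseteq> SU"
    if "k \<in> {1..q}" for k
    using Mt(2)[OF that] unfolding extends_to_SU_on_circle_def holomorphic_extension_def by blast
  then obtain N where N: "\<And>k. k \<in> {1..q} \<Longrightarrow> mat_analytic_on (N k) (annulus r 1 \<union> circle)"
    "\<And>k z. k \<in> {1..q} \<Longrightarrow> z \<in> annulus r 1 \<Longrightarrow> N k z = V z ** Mt k z ** matrix_inv (V z)"
    "\<And>k. k \<in> {1..q} \<Longrightarrow> N k ` circle \<subseteq> SU"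
    by metis
  have VN: "V z ** Gm k z = N k z ** V z" if "k \<in> {1..q}" "z \<in> annulus r 1" for k z
  proof -
    have "N k z ** V z = V z ** Mt k z ** (matrix_inv (V z) ** V z)"
      using N(2)[OF that] by (simp add: matrix_mul_assoc)
    then show ?thesis
      using detV[OF that(2)] Gm(2)[OF that] by (simp add: matrix_inv_left_right)
  qed
  show ?thesis
  proof (rule that[OF F W_an WV detW])
    show "mat_analytic_on (N k) circle" if "k \<in> {1..q}" for k
      using N(1)[OF that] by (rule mat_analytic_subset) blast
    show "N k ` circle \<subseteq> SU" if "k \<in> {1..q}" for k
      by (rule N(3)[OF that])
    show "W p ** M k p = N k p ** W p" if k: "k \<in> {1..q}" and p: "p \<in> circle - F" for k p
    proof -
      have an: "mat_analytic_on W {p}" "mat_analytic_on (Gm k) {p}" "mat_analytic_on (N k) {p}"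
        using mat_analytic_subset[OF W_an, of "{p}"] mat_analytic_subset[OF Gm(1)[OF k], of "{p}"]
          mat_analytic_subset[OF N(1)[OF k], of "{p}"] p by auto
      have "W p ** Gm k p = N k p ** W p"
        by (rule mat_eq_on_annulus_imp_eq[of p r "\<lambda>z. W z ** Gm k z" "\<lambda>z. N k z ** W z"])
           (use an p r VN[OF k] WV in \<open>auto intro: mat_analytic_mult\<close>)
      then show ?thesis using Gm(3)[OF k] p by simp
    qed
    show "eventually (\<lambda>z. cmod z < 1 \<longrightarrow> V z ** Mh k z = N k z ** V z) (cosparse circle)" if k: "k \<in> {1..q}" for k
    proof -
      have "mat_analytic_on (Gm k) circle"
        using Gm(1)[OF k] by (rule mat_analytic_subset) blast
      then have "eventually (\<lambda>z. Gm k z = Mh k z) (cosparse circle)"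
        by (intro mat_circle_identity_imp_cosparse Mh(1)[OF k]) (simp_all add: Gm(3)[OF k] Mh(2)[OF k])
      with eventually_near_circle_annulus[OF r(2)] show ?thesis
      proof eventually_elim
        case (elim z)
        with VN[OF k, of z] show ?case by simp
      qed
    qed
  qed
qed

lemma simultaneously_imp_pointwise_unitarizable:
  fixes M :: "nat \<Rightarrow> complex \<Rightarrow> complex^'n^'n"
  assumes ana: "\<And>k. k \<in> {1..q} \<Longrightarrow> circle_analytic (M k)"
    and V: "unitarizer r q M V"
  shows "eventually (pointwise_unitarizable_at q M) generic_circle"
proof -
  have "\<exists>G. mat_analytic_on G circle \<and> (\<forall>z\<in>circle. G z = M k z)" if "k \<in> {1..q}" for k
    using circle_analytic_extension[OF ana[OF that]] by metis
  then obtain Mh where Mh: "\<And>k. k \<in> {1..q} \<Longrightarrow> mat_analytic_on (Mh k) circle"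
      "\<And>k z. k \<in> {1..q} \<Longrightarrow> z \<in> circle \<Longrightarrow> Mh k z = M k z"
    by metis
  obtain F W N where F: "finite F" "F \<subseteq> circle"
    and W: "\<And>z. z \<in> annulus r 1 \<union> (circle - F) \<Longrightarrow> det (W z) = 1"
    and N: "\<And>k. k \<in> {1..q} \<Longrightarrow> N k ` circle \<subseteq> SU"
      "\<And>k p. k \<in> {1..q} \<Longrightarrow> p \<in> circle - F \<Longrightarrow> W p ** M k p = N k p ** W p"
    by (rule unitarizer_boundary_values[OF V Mh]) blast+
  have "pointwise_unitarizable_at q M p" if p: "p \<in> circle - F" for p
    unfolding pointwise_unitarizable_at_def
  proof (intro bexI[of _ "W p"] ballI)
    show "W p \<in> SL" using W[of p] p by (simp add: SL_def)
    fix k assume k: "k \<in> {1..q}"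
    have "W p ** M k p ** matrix_inv (W p) = N k p ** (W p ** matrix_inv (W p))"
      using N(2)[OF k p] by (simp add: matrix_mul_assoc)
    also have "\<dots> = N k p" using W[of p] p by (simp add: matrix_inv_left_right)
    also have "\<dots> \<in> SU" using N(1)[OF k] p by blast
    finally show "W p ** M k p ** matrix_inv (W p) \<in> SU" .
  qed
  then show ?thesis
    unfolding eventually_generic_circle_iff using F by blast
qed

text \<open>
  Near \<open>p\<close> the nonvanishing function \<open>h\<close> has an analytic \<open>n\<close>-th root \<open>\<rho>\<close>. On the convex part of a
  small disc that lies inside the circle, \<open>u / \<rho>\<close> is continuous with values among the \<open>n\<close>-th roots
  of unity, hence constant.
\<close>
lemma local_root_extension:
  assumes p: "p \<in> circle" and r: "r < 1" and n: "n > 0"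
    and h: "h analytic_on {p}" "h p \<noteq> 0"
    and u: "u holomorphic_on annulus r 1"
    and uh: "eventually (\<lambda>z. cmod z < 1 \<longrightarrow> u z ^ n = h z) (at p)"
  obtains g where "g analytic_on {p}" "eventually (\<lambda>z. cmod z < 1 \<longrightarrow> g z = u z) (nhds p)"
    "eventually (\<lambda>z. g z ^ n = h z) (nhds p)"
proof -
  have "eventually (\<lambda>z. h z \<noteq> 0) (nhds p)"
    using tendsto_imp_eventually_ne[of h "h p" "nhds p" 0] h(2)
      isContD[OF analytic_at_imp_isCont[OF h(1)]] tendsto_at_iff_tendsto_nhds[of h p] by simp
  moreover have "eventually (\<lambda>z. cmod z < 1 \<longrightarrow> u z ^ n = h z) (nhds p)"
    using uh p by (simp add: eventually_nhds_conv_at)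
  moreover have "eventually (\<lambda>z. z \<in> {z. r < cmod z}) (nhds p)"
    using p r by (intro eventually_nhds_in_open open_Collect_less continuous_intros) auto
  ultimately have "eventually (\<lambda>z. h analytic_on {z} \<and> h z \<noteq> 0 \<and> (cmod z < 1 \<longrightarrow> u z ^ n = h z) \<and> r < cmod z) (nhds p)"
    using analytic_at_eventually[OF h(1)] by eventually_elim simp
  then obtain e where e: "e > 0" "\<And>z. dist z p < e \<Longrightarrow> h analytic_on {z} \<and> h z \<noteq> 0 \<and> (cmod z < 1 \<longrightarrow> u z ^ n = h z) \<and> r < cmod z"
    unfolding eventually_nhds_metric by blast
  have hB: "h holomorphic_on ball p e"
    using e(2) by (intro analytic_imp_holomorphic analytic_on_analytic_at[THEN iffD2]) (auto simp: dist_commute)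
  obtain l where l: "l holomorphic_on ball p e" "\<And>z. z \<in> ball p e \<Longrightarrow> h z = exp (l z)"
    using contractible_imp_holomorphic_log[OF hB convex_imp_contractible[OF convex_ball]] e(2)
    by (metis dist_commute mem_ball)
  define \<rho> where "\<rho> = (\<lambda>z. exp (l z / of_nat n))"
  have \<rho>: "\<rho> holomorphic_on ball p e"
    unfolding \<rho>_def using n by (intro holomorphic_intros l(1)) auto
  have \<rho>n: "\<rho> z ^ n = h z" if "z \<in> ball p e" for z
    using l(2)[OF that] n by (simp add: \<rho>_def flip: exp_of_nat_mult)
  have \<rho>0: "\<rho> z \<noteq> 0" for z by (simp add: \<rho>_def)
  define H where "H = ball p e \<inter> ball 0 1"
  have H_sub: "H \<subseteq> annulus r 1"
    using e(2) by (auto simp: H_def annulus_def dist_commute)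
  have conn: "connected H"
    unfolding H_def by (intro convex_connected convex_Int convex_ball)
  have root1: "(u z / \<rho> z) ^ n = 1" if "z \<in> H" for z
  proof -
    have "u z ^ n = h z" "h z \<noteq> 0" "\<rho> z ^ n = h z"
      using e(2)[of z] \<rho>n[of z] that by (auto simp: H_def dist_commute)
    then show ?thesis by (simp add: power_divide)
  qed
  have "(\<lambda>z. u z / \<rho> z) constant_on H"
  proof (rule continuous_finite_range_constant[OF conn])
    have "(\<lambda>z. u z / \<rho> z) holomorphic_on H"
      using \<rho>0 by (intro holomorphic_intros holomorphic_on_subset[OF u H_sub] holomorphic_on_subset[OF \<rho>]) (auto simp: H_def)
    then show "continuous_on H (\<lambda>z. u z / \<rho> z)"
      by (rule holomorphic_on_imp_continuous_on)
    have "(\<lambda>z. u z / \<rho> z) ` H \<subseteq> {w. w ^ n = 1}"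
      using root1 by blast
    moreover have "finite {w :: complex. w ^ n = 1}"
      using finite_roots_unity[of n] n by simp
    ultimately show "finite ((\<lambda>z. u z / \<rho> z) ` H)"
      by (rule finite_subset)
  qed
  then obtain c where c: "\<And>z. z \<in> H \<Longrightarrow> u z / \<rho> z = c"
    unfolding constant_on_def by blast
  have "H \<noteq> {}"
  proof -
    obtain x where "x \<in> annulus r 1" "dist x p < e"
      using islimpt_annulus[OF p r] e(1) unfolding islimpt_approachable by blast
    then have "x \<in> H" by (auto simp: H_def annulus_def dist_commute)
    then show ?thesis by blast
  qed
  then have cn: "c ^ n = 1" using c root1 by blast
  show ?thesis
  proof (rule that[of "\<lambda>z. c * \<rho> z"])
    show "(\<lambda>z. c * \<rho> z) analytic_on {p}"
      using e(1) \<rho> by (auto simp: analytic_at_ball intro!: holomorphic_intros)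
    have near: "eventually (\<lambda>z. z \<in> ball p e) (nhds p)"
      using e(1) by (intro eventually_nhds_in_open) auto
    then show "eventually (\<lambda>z. cmod z < 1 \<longrightarrow> c * \<rho> z = u z) (nhds p)"
    proof (eventually_elim, intro impI)
      fix z assume "z \<in> ball p e" "cmod z < 1"
      then have "u z / \<rho> z = c" by (intro c) (simp add: H_def)
      then show "c * \<rho> z = u z" using \<rho>0[of z] by (auto simp: field_simps)
    qed
    show "eventually (\<lambda>z. (c * \<rho> z) ^ n = h z) (nhds p)"
      using near by eventually_elim (simp add: power_mult_distrib cn \<rho>n)
  qed
qed


section \<open>Uniqueness of unitarizers\<close>

text \<open>
  The two invariant forms are proportional by irreducibility; the factor is positive because
  diagonal entries are, and an \<open>n\<close>-th root of unity because both determinants are 1. So the forms agree.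
\<close>
lemma normalized_unitarizers_differ_by_SU:
  fixes W1 W2 :: "complex^'n^'n"
  assumes irr: "\<not> reducible_pair (A i) (A j)"
    and W: "det W1 = 1" "det W2 = 1"
    and U: "\<And>k. k \<in> {i, j} \<Longrightarrow> W1 ** A k ** matrix_inv W1 \<in> SU" "\<And>k. k \<in> {i, j} \<Longrightarrow> W2 ** A k ** matrix_inv W2 \<in> SU"
  shows "W2 ** matrix_inv W1 \<in> SU"
proof -
  have nz: "det W1 \<noteq> 0" "det W2 \<noteq> 0" using W by auto
  have "det (ctranspose W1 ** W1) \<noteq> 0" using W by (simp add: det_mul det_ctranspose)
  then obtain c where c: "ctranspose W2 ** W2 = mat c ** (ctranspose W1 ** W1)"
    using intertwiner_unique[of A i j "\<lambda>k. ctranspose (A k)" "ctranspose W1 ** W1" "ctranspose W2 ** W2"]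
      irr unitarized_imp_invariant_form[OF nz(1) U(1)] unitarized_imp_invariant_form[OF nz(2) U(2)]
    by metis
  have "1 = det (mat c ** (ctranspose W1 ** W1))"
    unfolding c[symmetric] using W by (simp add: det_mul det_ctranspose)
  also have "\<dots> = c ^ CARD('n) * det (ctranspose W1 ** W1)"
    by (rule det_scalar_mult)
  finally have cn: "c ^ CARD('n) = 1"
    using W by (simp add: det_mul det_ctranspose)
  obtain a :: 'n where True by simp
  obtain s t where st: "s > 0" "t > 0" "(ctranspose W1 ** W1) $ a $ a = complex_of_real s" "(ctranspose W2 ** W2) $ a $ a = complex_of_real t"
    using gram_matrix_diagonal_pos[OF nz(1), of a] gram_matrix_diagonal_pos[OF nz(2), of a] by blast
  have "complex_of_real t = c * of_real s"
    using st(3,4) unfolding c mat_scalar_entry by simp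
  then have cr: "c = of_real (t / s)"
    using st(1) by (simp add: field_simps)
  then have "complex_of_real ((t / s) ^ CARD('n)) = 1"
    using cn by simp
  then have "(t / s) ^ CARD('n) = 1"
    by (simp only: of_real_eq_1_iff)
  then have "t / s = 1"
    using st(1,2) power_eq_1_iff[of "t / s" "CARD('n)"] by simp
  then have eq: "ctranspose W2 ** W2 = ctranspose W1 ** W1"
    unfolding c cr by simp
  show ?thesis
  proof (rule SU_I)
    define R where "R = matrix_inv W1"
    have R: "W1 ** R = mat 1"
      using matrix_inv_left_right[OF nz(1)] by (simp add: R_def)
    have "ctranspose (W2 ** R) ** (W2 ** R) = ctranspose R ** (ctranspose W2 ** W2) ** R"
      by (simp add: ctranspose_mult matrix_mul_assoc)
    also have "\<dots> = ctranspose (W1 ** R) ** (W1 ** R)"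
      unfolding eq by (simp add: ctranspose_mult matrix_mul_assoc)
    finally show "ctranspose (W2 ** matrix_inv W1) ** (W2 ** matrix_inv W1) = mat 1"
      by (simp add: R ctranspose_mat R_def[symmetric])
    have "det W1 * det R = 1" using R by (metis det_mul det_I)
    then show "det (W2 ** matrix_inv W1) = 1"
      using W by (simp add: det_mul R_def[symmetric])
  qed
qed

text \<open>
  At generic points of the circle \<open>U = W2 W1\<inverse>\<close> is unitary, but near an exceptional point there is
  no bound for \<open>V1\<close> and \<open>V2\<close> in the annulus, and unitarity on the circle alone would permit an
  essential singularity of the kind of \<open>exp ((z + p) / (z - p))\<close>. It is the relation
  \<open>U N1 = N2 U\<close> with irreducible analytic families \<open>N1\<close> and \<open>N2\<close> that excludes it.
\<close>
lemma unitarizers_unique: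
  fixes M :: "nat \<Rightarrow> complex \<Rightarrow> complex^'n^'n"
  assumes ana: "\<And>k. k \<in> {1..q} \<Longrightarrow> circle_analytic (M k)"
    and ij: "i \<in> {1..q}" "j \<in> {1..q}"
    and irr: "eventually (\<lambda>p. \<not> reducible_pair (M i p) (M j p)) generic_circle"
    and V1: "unitarizer r1 q M V1" and V2: "unitarizer r2 q M V2"
  shows "extends_to_SU_on_circle (max r1 r2) (\<lambda>z. V2 z ** matrix_inv (V1 z))"
proof -
  define r where "r = max r1 r2"
  define n where "n = CARD('n)"
  have n0: "n > 0" by (simp add: n_def)
  have r: "r < 1" "r1 \<le> r" "r2 \<le> r"
    using V1 V2 by (auto simp: r_def unitarizer_def)
  have ann: "z \<in> annulus r1 1" "z \<in> annulus r2 1" if "z \<in> annulus r 1" for z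
    using that by (auto simp: annulus_def r_def)
  have "\<exists>G. mat_analytic_on G circle \<and> (\<forall>z\<in>circle. G z = M k z)" if "k \<in> {1..q}" for k
    using circle_analytic_extension[OF ana[OF that]] by metis
  then obtain Mh where Mh: "\<And>k. k \<in> {1..q} \<Longrightarrow> mat_analytic_on (Mh k) circle"
      "\<And>k z. k \<in> {1..q} \<Longrightarrow> z \<in> circle \<Longrightarrow> Mh k z = M k z"
    by metis
  obtain F1 W1 N1 where F1: "finite F1" "F1 \<subseteq> circle"
    and W1: "mat_analytic_on W1 (annulus r1 1 \<union> (circle - F1))"
    "\<And>z. z \<in> annulus r1 1 \<Longrightarrow> W1 z = V1 z" "\<And>z. z \<in> annulus r1 1 \<union> (circle - F1) \<Longrightarrow> det (W1 z) = 1"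
    and N1: "\<And>k. k \<in> {1..q} \<Longrightarrow> mat_analytic_on (N1 k) circle" "\<And>k. k \<in> {1..q} \<Longrightarrow> N1 k ` circle \<subseteq> SU"
    "\<And>k p. k \<in> {1..q} \<Longrightarrow> p \<in> circle - F1 \<Longrightarrow> W1 p ** M k p = N1 k p ** W1 p"
    "\<And>k. k \<in> {1..q} \<Longrightarrow> eventually (\<lambda>z. cmod z < 1 \<longrightarrow> V1 z ** Mh k z = N1 k z ** V1 z) (cosparse circle)"
    using unitarizer_boundary_values[OF V1 Mh] by blast
  obtain F2 W2 N2 where F2: "finite F2" "F2 \<subseteq> circle"
    and W2: "mat_analytic_on W2 (annulus r2 1 \<union> (circle - F2))"
    "\<And>z. z \<in> annulus r2 1 \<Longrightarrow> W2 z = V2 z" "\<And>z. z \<in> annulus r2 1 \<union> (circle - F2) \<Longrightarrow> det (W2 z) = 1"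
    and N2: "\<And>k. k \<in> {1..q} \<Longrightarrow> mat_analytic_on (N2 k) circle" "\<And>k. k \<in> {1..q} \<Longrightarrow> N2 k ` circle \<subseteq> SU"
    "\<And>k p. k \<in> {1..q} \<Longrightarrow> p \<in> circle - F2 \<Longrightarrow> W2 p ** M k p = N2 k p ** W2 p"
    "\<And>k. k \<in> {1..q} \<Longrightarrow> eventually (\<lambda>z. cmod z < 1 \<longrightarrow> V2 z ** Mh k z = N2 k z ** V2 z) (cosparse circle)"
    using unitarizer_boundary_values[OF V2 Mh] by blast
  define U where "U = (\<lambda>z. W2 z ** matrix_inv (W1 z))"
  define D where "D = annulus r 1 \<union> (circle - (F1 \<union> F2))"
  have D1: "D \<subseteq> annulus r1 1 \<union> (circle - F1)" and D2: "D \<subseteq> annulus r2 1 \<union> (circle - F2)"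
    using ann by (auto simp: D_def)
  have detW: "det (W1 z) = 1" "det (W2 z) = 1" if "z \<in> D" for z
    using W1(3) W2(3) D1 D2 that by blast+
  have U_an: "mat_analytic_on U D"
    unfolding U_def
    by (intro mat_analytic_mult mat_analytic_inv mat_analytic_subset[OF W1(1) D1] mat_analytic_subset[OF W2(1) D2])
       (simp add: detW)
  have detU: "det (U z) = 1" if z: "z \<in> D" for z
  proof -
    have "det (W1 z) * det (matrix_inv (W1 z)) = 1"
      using matrix_inv_left_right(2)[of "W1 z"] detW[OF z] by (metis det_mul det_I zero_neq_one)
    then show ?thesis using detW[OF z] by (simp add: U_def det_mul)
  qed
  have UN: "U z ** N1' = N2' ** U z"
    if "z \<in> D" "W1 z ** A = N1' ** W1 z" "W2 z ** A = N2' ** W2 z" for z A N1' N2'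
  proof -
    define R where "R = matrix_inv (W1 z)"
    have R: "R ** W1 z = mat 1" "W1 z ** R = mat 1"
      using matrix_inv_left_right[of "W1 z"] detW[OF that(1)] by (simp_all add: R_def)
    have "N1' = N1' ** (W1 z ** R)" by (simp add: R)
    also have "\<dots> = W1 z ** A ** R" by (simp add: that(2) matrix_mul_assoc)
    finally have "U z ** N1' = W2 z ** (R ** W1 z) ** A ** R"
      by (simp add: U_def R_def matrix_mul_assoc)
    also have "\<dots> = N2' ** U z"
      by (simp add: R that(3) U_def R_def[symmetric] matrix_mul_assoc)
    finally show ?thesis .
  qed
  define good where "good = (\<lambda>p. p \<in> circle \<and> p \<in> D \<and> \<not> reducible_pair (M i p) (M j p))"
  have "eventually (\<lambda>p. p \<in> D) generic_circle"
    unfolding eventually_generic_circle_iff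
    by (intro exI[of _ "F1 \<union> F2"]) (use F1 F2 in \<open>auto simp: D_def\<close>)
  then have ev_good: "eventually good generic_circle"
    using irr eventually_generic_in_circle unfolding good_def by eventually_elim blast
  have conjSU: "W ** A ** matrix_inv W \<in> SU"
    if "det W = 1" "W ** A = B ** W" "B \<in> SU" for W A B :: "complex^'n^'n"
  proof -
    have "W ** A ** matrix_inv W = B ** (W ** matrix_inv W)"
      using that(2) by (simp add: matrix_mul_assoc)
    then show ?thesis using that by (simp add: matrix_inv_left_right)
  qed
  have goodF: "p \<in> circle - F1" "p \<in> circle - F2" if "good p" for p
    using that by (auto simp: good_def D_def annulus_def)
  have U_SU: "U p \<in> SU" if p: "good p" for p
    unfolding U_def
  proof (rule normalized_unitarizers_differ_by_SU[of "\<lambda>k. M k p" i j])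
    show "\<not> reducible_pair (M i p) (M j p)" using p by (simp add: good_def)
    show "det (W1 p) = 1" "det (W2 p) = 1" using detW[of p] p by (simp_all add: good_def)
    fix k assume "k \<in> {i, j}"
    then have k: "k \<in> {1..q}" using ij by blast
    have "p \<in> circle" using p by (simp add: good_def)
    then show "W1 p ** M k p ** matrix_inv (W1 p) \<in> SU" "W2 p ** M k p ** matrix_inv (W2 p) \<in> SU"
      using conjSU[OF _ N1(3)[OF k goodF(1)[OF p]]] conjSU[OF _ N2(3)[OF k goodF(2)[OF p]]]
        N1(2)[OF k] N2(2)[OF k] detW[of p] p unfolding good_def by blast+
  qed
  have refl2: "mat_analytic_on (mat_reflect (N2 k)) circle" if "k \<in> {1..q}" for k
    by (rule mat_reflect_analytic[OF N2(1)[OF that]])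
  have refl_inv: "mat_reflect (N2 k) p ** N2 k p = mat 1" "N2 k p ** mat_reflect (N2 k) p = mat 1"
    if "k \<in> {1..q}" "p \<in> circle" for k p
  proof -
    have "N2 k p \<in> SU" using N2(2)[OF that(1)] that(2) by blast
    then show "mat_reflect (N2 k) p ** N2 k p = mat 1" "N2 k p ** mat_reflect (N2 k) p = mat 1"
      using that(2) by (simp_all add: mat_reflect_on_circle SU_def)
  qed
  obtain p0 where p0: "good p0"
    using eventually_happens[OF ev_good] generic_circle_neq_bot by blast
  have p0c: "p0 \<in> circle" using p0 by (simp add: good_def)
  obtain a :: 'n where True by simp
  have "\<exists>b. U p0 $ a $ b \<noteq> 0"
  proof (rule ccontr)
    assume "\<not> (\<exists>b. U p0 $ a $ b \<noteq> 0)"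
    then have "row a (U p0) = 0" by (simp add: row_def vec_eq_iff)
    then show False
      using detU[of p0] p0 det_zero_row(1)[of a "U p0"] by (simp add: good_def)
  qed
  then obtain b0 where b0: "U p0 $ a $ b0 \<noteq> 0" by blast
  \<comment> \<open>\<open>W2\<inverse> X W1\<close> commutes with the irreducible pair at \<open>p0\<close>, so \<open>X\<close> is a multiple of \<open>U p0\<close>.\<close>
  have ker0: "X = 0"
    if X: "\<And>k. k \<in> {i, j} \<Longrightarrow> mat_reflect (N2 k) p0 ** X ** N1 k p0 = X" "X $ a $ b0 = 0" for X
  proof -
    have det0: "det (W1 p0) \<noteq> 0" "det (W2 p0) \<noteq> 0"
      using detW[of p0] p0 by (simp_all add: good_def)
    define R where "R = matrix_inv (W2 p0)"
    have R: "R ** W2 p0 = mat 1" "W2 p0 ** R = mat 1"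
      using matrix_inv_left_right[OF det0(2)] by (simp_all add: R_def)
    define Z where "Z = R ** X ** W1 p0"
    have comm: "Z ** M k p0 = M k p0 ** Z" if k': "k \<in> {i, j}" for k
    proof -
      have k: "k \<in> {1..q}" using k' ij by blast
      have "X ** N1 k p0 = N2 k p0 ** (mat_reflect (N2 k) p0 ** X ** N1 k p0)"
        using refl_inv(2)[OF k p0c] by (simp add: matrix_mul_assoc)
      then have XN: "X ** N1 k p0 = N2 k p0 ** X" using X(1)[OF k'] by simp
      have "Z ** M k p0 = R ** X ** (W1 p0 ** M k p0)"
        by (simp add: Z_def matrix_mul_assoc)
      also have "\<dots> = R ** (X ** N1 k p0) ** W1 p0"
        using N1(3)[OF k goodF(1)[OF p0]] by (simp add: matrix_mul_assoc)
      also have "\<dots> = R ** (N2 k p0 ** W2 p0) ** R ** X ** W1 p0"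
        unfolding XN using R(2) by (metis matrix_mul_assoc matrix_mul_lid)
      also have "\<dots> = (R ** W2 p0) ** M k p0 ** Z"
        unfolding N2(3)[OF k goodF(2)[OF p0], symmetric] by (simp add: Z_def matrix_mul_assoc)
      finally show ?thesis by (simp add: R)
    qed
    obtain c where c: "Z = mat c"
      by (rule schur[of "M i p0" "M j p0" Z]) (use comm p0 in \<open>auto simp: good_def\<close>)
    have "X = (W2 p0 ** R) ** X ** (W1 p0 ** matrix_inv (W1 p0))"
      by (simp add: R matrix_inv_left_right[OF det0(1)])
    also have "\<dots> = W2 p0 ** Z ** matrix_inv (W1 p0)"
      by (simp add: Z_def matrix_mul_assoc)
    also have "\<dots> = mat c ** U p0"
      unfolding c U_def mat_scalar_commute by (simp add: matrix_mul_assoc)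
    finally have XU: "X = mat c ** U p0" .
    then have "c * U p0 $ a $ b0 = 0" using X(2) by (simp add: mat_scalar_entry)
    then have "c = 0" using b0 by simp
    then show "X = 0" unfolding XU vec_eq_iff mat_scalar_entry by simp
  qed
  have ij_q: "k \<in> {1..q}" if "k \<in> {i, j}" for k using that ij by blast
  have fin_ij: "finite {i, j}" by simp
  obtain Y where Y_mero: "mat_meromorphic_on Y circle" and Y: "eventually (\<lambda>z. \<forall>X. (\<forall>k\<in>{i, j}. mat_reflect (N2 k) z ** X ** N1 k z = X) \<longrightarrow> X = mat (X $ a $ b0) ** Y z) (cosparse circle)"
    by (rule meromorphic_intertwiner[of "{i, j}" "\<lambda>k. mat_reflect (N2 k)" N1 p0 a b0])
       (use refl2 N1(1) ij_q p0c ker0 fin_ij in blast)+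
  have U_ker: "mat_reflect (N2 k) z ** U z ** N1 k z = U z"
    if "z \<in> D" "mat_reflect (N2 k) z ** N2 k z = mat 1" "W1 z ** A = N1 k z ** W1 z" "W2 z ** A = N2 k z ** W2 z" for k z A
  proof -
    have "mat_reflect (N2 k) z ** U z ** N1 k z = mat_reflect (N2 k) z ** (U z ** N1 k z)"
      by (simp add: matrix_mul_assoc)
    also have "\<dots> = (mat_reflect (N2 k) z ** N2 k z) ** U z"
      unfolding UN[OF that(1,3,4)] by (simp add: matrix_mul_assoc)
    finally show ?thesis using that(2) by simp
  qed
  have Y_circle: "eventually (\<lambda>p. U p = mat (U p $ a $ b0) ** Y p) generic_circle"
    using ev_good eventually_cosparse_imp_generic[OF Y]
  proof eventually_elim
    case (elim p)
    have "\<forall>k\<in>{i, j}. mat_reflect (N2 k) p ** U p ** N1 k p = U p"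
    proof
      fix k assume "k \<in> {i, j}"
      then have k: "k \<in> {1..q}" by (rule ij_q)
      show "mat_reflect (N2 k) p ** U p ** N1 k p = U p"
        using U_ker[OF _ refl_inv(1)[OF k] N1(3)[OF k goodF(1)] N2(3)[OF k goodF(2)]] elim(1)
        by (simp add: good_def)
    qed
    with elim(2) show ?case by blast
  qed
  have Y_inside: "eventually (\<lambda>z. cmod z < 1 \<longrightarrow> z \<in> annulus r 1 \<and> U z = mat (U z $ a $ b0) ** Y z) (cosparse circle)"
  proof -
    have mat1: "mat_analytic_on (\<lambda>_. mat 1 :: complex^'n^'n) circle"
      by (simp add: mat_analytic_on_def)
    have "eventually (\<lambda>z. mat_reflect (N2 k) z ** N2 k z = mat 1) (cosparse circle)" if "k \<in> {i, j}" for k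
      by (rule mat_circle_identity_imp_cosparse[OF mat_analytic_mult[OF refl2 N2(1)] mat1])
         (use ij_q[OF that] refl_inv(1) in blast)+
    then have "eventually (\<lambda>z. \<forall>k\<in>{i, j}. mat_reflect (N2 k) z ** N2 k z = mat 1 \<and>
        (cmod z < 1 \<longrightarrow> V1 z ** Mh k z = N1 k z ** V1 z) \<and> (cmod z < 1 \<longrightarrow> V2 z ** Mh k z = N2 k z ** V2 z)) (cosparse circle)"
      by (intro eventually_ball_finite fin_ij ballI eventually_conj N1(4) N2(4) ij_q)
    with eventually_near_circle_annulus[OF r(1)] Y show ?thesis
    proof (eventually_elim, intro impI)
      fix z assume an: "cmod z < 1 \<longrightarrow> z \<in> annulus r 1" and z1: "cmod z < 1"
        and Yz: "\<forall>X. (\<forall>k\<in>{i, j}. mat_reflect (N2 k) z ** X ** N1 k z = X) \<longrightarrow> X = mat (X $ a $ b0) ** Y z"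
        and rel: "\<forall>k\<in>{i, j}. mat_reflect (N2 k) z ** N2 k z = mat 1 \<and>
          (cmod z < 1 \<longrightarrow> V1 z ** Mh k z = N1 k z ** V1 z) \<and> (cmod z < 1 \<longrightarrow> V2 z ** Mh k z = N2 k z ** V2 z)"
      have z: "z \<in> annulus r 1" using an z1 by blast
      have WV: "W1 z = V1 z" "W2 z = V2 z" using W1(2) W2(2) ann[OF z] by auto
      have "z \<in> D" using z by (simp add: D_def)
      then have "\<forall>k\<in>{i, j}. mat_reflect (N2 k) z ** U z ** N1 k z = U z"
        using rel z1 U_ker[of z] WV by (metis (no_types, lifting))
      then show "z \<in> annulus r 1 \<and> U z = mat (U z $ a $ b0) ** Y z"
        using Yz z by blast
    qed
  qed
  \<comment> \<open>The \<open>n\<close>-th powers of the entries of row \<open>a\<close> of \<open>U\<close>, expressed through the meromorphic \<open>Y\<close> alone.\<close>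
  define g where "g = (\<lambda>b z. (Y z $ a $ b) ^ n * inverse (det (Y z)))"
  have detY_mero: "(\<lambda>z. det (Y z)) meromorphic_on circle"
    using Y_mero by (intro det_meromorphic) (simp add: mat_meromorphic_on_def)
  have g_mero: "g b meromorphic_on circle" for b
    unfolding g_def using Y_mero by (intro meromorphic_intros detY_mero) (simp add: mat_meromorphic_on_def)
  have U_g: "(U z $ a $ b) ^ n = g b z" "U z $ a $ b * Y z $ a' $ b' = U z $ a' $ b' * Y z $ a $ b"
    if "z \<in> D" "U z = mat (U z $ a $ b0) ** Y z" for z b a' b'
  proof -
    define u where "u = U z $ a $ b0"
    have UY: "U z = mat u ** Y z" using that(2) by (simp add: u_def)
    have "u ^ n * det (Y z) = 1"
      using detU[OF that(1)] unfolding UY det_scalar_mult n_def .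
    then have un: "u ^ n = inverse (det (Y z))"
      using inverse_unique[of "det (Y z)" "u ^ n"] by (simp add: mult.commute)
    show "(U z $ a $ b) ^ n = g b z"
      unfolding UY mat_scalar_entry g_def by (simp add: power_mult_distrib un mult.commute)
    show "U z $ a $ b * Y z $ a' $ b' = U z $ a' $ b' * Y z $ a $ b"
      unfolding UY mat_scalar_entry by (simp add: mult_ac)
  qed
  have local_ext: "\<exists>h. h analytic_on {p} \<and> eventually (\<lambda>z. cmod z < 1 \<longrightarrow> h z = U z $ c $ d) (nhds p)"
    if p: "p \<in> circle" for p c d
  proof -
    have on_circle: "eventually (\<lambda>z. z \<in> circle \<and> z \<in> D \<and> U z \<in> SU \<and> U z = mat (U z $ a $ b0) ** Y z) (at p within circle)"
      using eventually_generic_circle_at[OF _ p, OF eventually_conj[OF ev_good Y_circle]]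
      by (rule eventually_mono) (use U_SU in \<open>auto simp: good_def\<close>)
    have in_disc: "eventually (\<lambda>z. cmod z < 1 \<longrightarrow> z \<in> annulus r 1 \<and> U z = mat (U z $ a $ b0) ** Y z) (at p)"
      using Y_inside p by (simp add: eventually_cosparse_iff_at)
    define h where "h = (\<lambda>b. remove_sings (g b))"
    have g_mero_p: "g b meromorphic_on {p}" for b
      using g_mero p meromorphic_on_subset[of "g b" circle "{p}"] by blast
    have h_an: "h b analytic_on {p}" for b
      unfolding h_def
    proof (rule meromorphic_bounded_imp_removable[OF g_mero_p at_within_circle_neq_bot[OF p]])
      show "eventually (\<lambda>z. cmod (g b z) \<le> 1) (at p within circle)"
        using on_circle
      proof eventually_elim
        case (elim z)
        then have "cmod (g b z) = cmod (U z $ a $ b) ^ n"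
          using U_g(1)[of z b] by (metis norm_power)
        also have "\<dots> \<le> 1" using SU_entry_le_1[of "U z"] elim by (intro power_le_one) auto
        finally show ?case .
      qed
    qed
    have h_g: "eventually (\<lambda>z. h b z = g b z) (at p)" for b
      unfolding h_def using g_mero_p[of b] eventually_remove_sings_eq_at by (auto simp: meromorphic_at_iff)
    have "\<exists>b. h b p \<noteq> 0"
    proof (rule ccontr)
      assume "\<not> (\<exists>b. h b p \<noteq> 0)"
      then have h0: "h b p = 0" for b by blast
      \<comment> \<open>Any \<open>\<epsilon> < 1\<close> with \<open>n \<epsilon> < 1\<close> makes a row with all entries below \<open>\<epsilon>\<close> too short to have norm 1.\<close>
      define \<epsilon> where "\<epsilon> = 1 / (2 * real n)"
      have \<epsilon>: "0 < \<epsilon>" "\<epsilon> < 1" using n0 by (auto simp: \<epsilon>_def)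
      have "eventually (\<lambda>z. cmod (g b z) < \<epsilon> ^ n) (at p within circle)" for b
      proof -
        have "(h b \<longlongrightarrow> 0) (at p)"
          using isContD[OF analytic_at_imp_isCont[OF h_an[of b]]] h0 by simp
        then have "eventually (\<lambda>z. dist (h b z) 0 < \<epsilon> ^ n) (at p)"
          by (rule tendstoD) (use \<epsilon> in simp)
        then have "eventually (\<lambda>z. cmod (g b z) < \<epsilon> ^ n) (at p)"
          using h_g[of b] by eventually_elim simp
        then show ?thesis using filter_leD[OF at_le[OF subset_UNIV]] by blast
      qed
      then have "eventually (\<lambda>z. \<forall>b. cmod (g b z) < \<epsilon> ^ n) (at p within circle)"
        by (simp add: eventually_all_finite)
      with on_circle have "eventually (\<lambda>z. False) (at p within circle)"
      proof eventually_elim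
        case (elim z)
        have small: "cmod (U z $ a $ b) < \<epsilon>" for b
        proof (rule power_less_imp_less_base)
          show "cmod (U z $ a $ b) ^ n < \<epsilon> ^ n"
            using elim U_g(1)[of z b] by (metis norm_power)
        qed (use \<epsilon> in simp)
        have "(U z ** ctranspose (U z)) $ a $ a = 1"
          using elim by (simp add: SU_def mat_def)
        then have "complex_of_real (\<Sum>k\<in>UNIV. (cmod (U z $ a $ k))\<^sup>2) = 1"
          by (simp add: matrix_matrix_mult_def ctranspose_def complex_norm_square del: of_real_power)
        then have "1 = (\<Sum>k\<in>UNIV. (cmod (U z $ a $ k))\<^sup>2)"
          by (simp only: of_real_eq_1_iff)
        also have "\<dots> \<le> (\<Sum>k\<in>(UNIV :: 'n set). \<epsilon>)"
        proof (rule sum_mono)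
          fix k
          have "(cmod (U z $ a $ k))\<^sup>2 \<le> \<epsilon> * 1"
            unfolding power2_eq_square using small[of k] \<epsilon> by (intro mult_mono) auto
          then show "(cmod (U z $ a $ k))\<^sup>2 \<le> \<epsilon>" by simp
        qed
        also have "\<dots> = 1 / 2" using n0 by (simp add: \<epsilon>_def n_def)
        finally show ?case by simp
      qed
      with at_within_circle_neq_bot[OF p] show False by (simp add: eventually_False)
    qed
    then obtain b where b: "h b p \<noteq> 0" by blast
    have u_hol: "(\<lambda>z. U z $ a $ b) holomorphic_on annulus r 1"
      using mat_analytic_subset[OF U_an, of "annulus r 1"]
      by (auto simp: D_def mat_analytic_on_def intro: analytic_imp_holomorphic)
    have uh: "eventually (\<lambda>z. cmod z < 1 \<longrightarrow> (U z $ a $ b) ^ n = h b z) (at p)"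
      using in_disc h_g[of b]
    proof (eventually_elim, intro impI)
      fix z assume "cmod z < 1 \<longrightarrow> z \<in> annulus r 1 \<and> U z = mat (U z $ a $ b0) ** Y z" "h b z = g b z" "cmod z < 1"
      then show "(U z $ a $ b) ^ n = h b z"
        using U_g(1)[of z b] by (simp add: D_def)
    qed
    obtain e where e: "e analytic_on {p}" "eventually (\<lambda>z. cmod z < 1 \<longrightarrow> e z = U z $ a $ b) (nhds p)"
      "eventually (\<lambda>z. e z ^ n = h b z) (nhds p)"
      by (rule local_root_extension[OF p r(1) n0 h_an b u_hol uh])
    \<comment> \<open>In the annulus \<open>U = u Y\<close>, so all entries are the extended entry \<open>e\<close> times a quotient of entries of \<open>Y\<close>.\<close>
    define E where "E = (\<lambda>z. e z * Y z $ c $ d / Y z $ a $ b)"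
    have Y_mero_p: "(\<lambda>z. Y z $ c $ d) meromorphic_on {p}" for c d
      using Y_mero p meromorphic_on_subset[of _ circle "{p}"] unfolding mat_meromorphic_on_def by blast
    have E_mero: "E meromorphic_on {p}"
      unfolding E_def by (intro meromorphic_intros Y_mero_p analytic_on_imp_meromorphic_on e(1))
    have "eventually (\<lambda>z. h b z \<noteq> 0) (at p)"
      using tendsto_imp_eventually_ne[OF isContD[OF analytic_at_imp_isCont[OF h_an[of b]]] b] .
    then have Y_nz: "eventually (\<lambda>z. Y z $ a $ b \<noteq> 0) (at p)"
      using h_g[of b] by eventually_elim (use n0 in \<open>auto simp: g_def\<close>)
    have e_at: "eventually (\<lambda>z. e z ^ n = h b z) (at p)" "eventually (\<lambda>z. cmod z < 1 \<longrightarrow> e z = U z $ a $ b) (at p)"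
      using e by (simp_all add: eventually_nhds_conv_at)
    have E_in: "eventually (\<lambda>z. cmod z < 1 \<longrightarrow> E z = U z $ c $ d) (at p)"
      using Y_nz e_at(2) in_disc
    proof (eventually_elim, intro impI)
      fix z assume z: "Y z $ a $ b \<noteq> 0" "cmod z < 1 \<longrightarrow> e z = U z $ a $ b"
        "cmod z < 1 \<longrightarrow> z \<in> annulus r 1 \<and> U z = mat (U z $ a $ b0) ** Y z" "cmod z < 1"
      then have "U z $ a $ b * Y z $ c $ d = U z $ c $ d * Y z $ a $ b"
        by (intro U_g(2)) (simp_all add: D_def)
      with z show "E z = U z $ c $ d" by (simp add: E_def field_simps)
    qed
    \<comment> \<open>On the circle \<open>e\<close> is only known up to an \<open>n\<close>-th root of unity, which is enough for the modulus of \<open>E\<close>.\<close>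
    have E_bd: "eventually (\<lambda>z. cmod (E z) \<le> 1) (at p within circle)"
    proof -
      have "eventually (\<lambda>z. Y z $ a $ b \<noteq> 0 \<and> e z ^ n = h b z \<and> h b z = g b z) (at p within circle)"
        using filter_leD[OF at_le[OF subset_UNIV] eventually_conj[OF Y_nz eventually_conj[OF e_at(1) h_g[of b]]]] .
      with on_circle show ?thesis
      proof eventually_elim
        case (elim z)
        have "cmod (e z) ^ n = cmod (U z $ a $ b) ^ n"
          using elim U_g(1)[of z b] by (metis norm_power)
        then have "cmod (e z) = cmod (U z $ a $ b)"
          by (rule power_eq_imp_eq_base) (use n0 in auto)
        then have "cmod (E z) = cmod (U z $ a $ b * Y z $ c $ d) / cmod (Y z $ a $ b)"
          by (simp add: E_def norm_mult norm_divide)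
        also have "U z $ a $ b * Y z $ c $ d = U z $ c $ d * Y z $ a $ b"
          using elim by (intro U_g(2)) auto
        also have "cmod (U z $ c $ d * Y z $ a $ b) / cmod (Y z $ a $ b) = cmod (U z $ c $ d)"
          using elim by (simp add: norm_mult)
        also have "\<dots> \<le> 1" using elim by (intro SU_entry_le_1) simp
        finally show ?case .
      qed
    qed
    have "remove_sings E analytic_on {p}"
      by (rule meromorphic_bounded_imp_removable[OF E_mero at_within_circle_neq_bot[OF p] E_bd])
    moreover have "eventually (\<lambda>z. remove_sings E z = E z) (at p)"
      using E_mero eventually_remove_sings_eq_at by (auto simp: meromorphic_at_iff)
    then have "eventually (\<lambda>z. cmod z < 1 \<longrightarrow> remove_sings E z = U z $ c $ d) (at p)"
      using E_in by eventually_elim simp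
    then have "eventually (\<lambda>z. cmod z < 1 \<longrightarrow> remove_sings E z = U z $ c $ d) (nhds p)"
      using p by (simp add: eventually_nhds_conv_at)
    ultimately show ?thesis by blast
  qed
  have "\<exists>G. G analytic_on (annulus r 1 \<union> circle) \<and> (\<forall>z\<in>annulus r 1. G z = U z $ c $ d)" for c d
  proof -
    have "(\<lambda>z. U z $ c $ d) holomorphic_on annulus r 1"
      using mat_analytic_subset[OF U_an, of "annulus r 1"]
      by (auto simp: D_def mat_analytic_on_def intro: analytic_imp_holomorphic)
    then obtain G where "G analytic_on (annulus r 1 \<union> circle)" "\<And>z. z \<in> annulus r 1 \<Longrightarrow> G z = U z $ c $ d"
      by (rule glue_extensions_across_circle) (use local_ext in blast)+
    then show ?thesis by blast
  qed
  then obtain G0 where G0: "\<And>c d. G0 c d analytic_on (annulus r 1 \<union> circle)"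
    "\<And>c d z. z \<in> annulus r 1 \<Longrightarrow> G0 c d z = U z $ c $ d"
    by metis
  define G where "G = (\<lambda>z. (\<chi> c d. G0 c d z) :: complex^'n^'n)"
  have G_an: "mat_analytic_on G (annulus r 1 \<union> circle)"
    using G0(1) by (simp add: G_def mat_analytic_on_def)
  have G_U: "G z = U z" if "z \<in> annulus r 1" for z
    using G0(2)[OF that] by (simp add: G_def vec_eq_iff)
  have G_circ: "mat_analytic_on G circle"
    using G_an by (rule mat_analytic_subset) blast
  have "G ` circle \<subseteq> SU"
  proof (rule SU_by_continuity[OF G_circ])
    show "eventually (\<lambda>p. G p \<in> SU) generic_circle"
      using ev_good
    proof eventually_elim
      case (elim p)
      then have pc: "p \<in> circle" "p \<in> D" by (auto simp: good_def)
      have "G p = U p"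
        by (rule mat_eq_on_annulus_imp_eq[OF pc(1) r(1)])
           (use pc mat_analytic_subset[OF G_circ, of "{p}"] mat_analytic_subset[OF U_an, of "{p}"] G_U in auto)
      then show ?case using U_SU[OF elim] by simp
    qed
  qed
  moreover have "G z = V2 z ** matrix_inv (V1 z)" if "z \<in> annulus r 1" for z
    using G_U[OF that] W1(2) W2(2) ann[OF that] by (simp add: U_def)
  ultimately show ?thesis
    unfolding extends_to_SU_on_circle_def holomorphic_extension_def r_def[symmetric]
    using G_an mat_analytic_imp_circle_analytic[OF G_circ] by blast
qed

theorem theorem4p4:
  fixes M :: "nat \<Rightarrow> complex \<Rightarrow> complex^'n^'n" and q :: nat
  assumes "2 \<le> q"
    and "\<And>k. k \<in> {1..q} \<Longrightarrow> circle_analytic (M k)"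
    and "\<And>k. k \<in> {1..q} \<Longrightarrow> M k ` circle \<subseteq> SL"
    and "\<exists>i\<in>{1..q}. \<exists>j\<in>{1..q}. \<exists>F. finite F \<and> F \<subseteq> circle \<and>
           (\<forall>p\<in>circle - F. \<not> reducible_pair (M i p) (M j p))"
  shows "((\<exists>r\<in>{0<..<1}. simultaneously_unitarizable r q M) \<longleftrightarrow>
          (\<exists>F. finite F \<and> F \<subseteq> circle \<and> (\<forall>p\<in>circle - F. pointwise_unitarizable_at q M p))) \<and>
         (\<forall>r1 r2 V1 V2. unitarizer r1 q M V1 \<and> unitarizer r2 q M V2 \<longrightarrow>
            extends_to_SU_on_circle (max r1 r2) (\<lambda>z. V2 z ** matrix_inv (V1 z)))"
proof -
  obtain i j where ij: "i \<in> {1..q}" "j \<in> {1..q}"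
    and irr: "eventually (\<lambda>p. \<not> reducible_pair (M i p) (M j p)) generic_circle"
    using assms(4) unfolding eventually_generic_circle_iff by blast
  show ?thesis
    unfolding eventually_generic_circle_iff[symmetric, of "pointwise_unitarizable_at q M"]
  proof (intro conjI iffI allI impI)
    assume "\<exists>r\<in>{0<..<1}. simultaneously_unitarizable r q M"
    then obtain r V where "unitarizer r q M V"
      unfolding simultaneously_unitarizable_def by blast
    then show "eventually (pointwise_unitarizable_at q M) generic_circle"
      by (rule simultaneously_imp_pointwise_unitarizable[OF assms(2), rotated])
  next
    assume "eventually (pointwise_unitarizable_at q M) generic_circle"
    then show "\<exists>r\<in>{0<..<1}. simultaneously_unitarizable r q M"
      by (intro pointwise_imp_simultaneously_unitarizable[OF assms(2,3) ij irr]) auto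
  next
    fix r1 r2 V1 V2
    assume "unitarizer r1 q M V1 \<and> unitarizer r2 q M V2"
    then show "extends_to_SU_on_circle (max r1 r2) (\<lambda>z. V2 z ** matrix_inv (V1 z))"
      using unitarizers_unique[OF assms(2) ij irr] by blast
  qed
qed

end
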